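(* The group $V\!\mathcal{A}$ is $2$-generated (i.e. it is generated by two elements).
   Context: Let $\mathfrak{C}_2=\{0,1\}^\omega$ be the Cantor set, ordered lexicographically. Thompson's group $V$ is the group of homeomorphisms $f$ of $\mathfrak{C}_2$ such that for every $p\in\mathfrak{C}_2$ there are finite prefixes $\alpha,\beta$ of $p$ and $f(p)$, respectively, so that $f$ agrees with the prefix replacement $\alpha\psi\mapsto\beta\psi$ in a neighborhood of $p$. For $f\in\mathrm{Homeo}(\mathfrak{C}_2)$, let $\mathrm{sing}(f)$ be the set of points $p$ such that $f$ does not agree with any element of $V$ on any neighborhood of $p$. Write $\overline{0}=000\cdots$ and $\overline{1}=111\cdots$. $V\!\mathcal{A}$ is the group of all $f\in\mathrm{Homeo}(\mathfrak{C}_2)$ such that: (1) $\mathrm{sing}(f)$ is finite, and each point of $\mathrm{sing}(f)$ ends in either $\overline{0}$ or $\overline{1}$; (2) if $p\in\mathrm{sing}(f)$, there is a neighborhood of $p$ on which $f$ is order-preserving and $L_{f(p)}\circ f$ agrees with $f\circ L_p$, where $L_p$ denotes the prefix replacement $\alpha0\psi\mapsto\alpha\psi$ if $p=\alpha\overline{0}$, or $\alpha1\psi\mapsto\alpha\psi$ if $p=\alpha\overline{1}$. *)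

theory Defs
  imports
    "HOL-Analysis.Analysis"
    "HOL-Algebra.Algebra"
    "HOL-Library.Omega_Words_Fun"
    "HOL-Library.Fun_Lexorder"
begin

text \<open>
  The digits 0 and 1 are \<^term>\<open>False\<close> and \<^term>\<open>True\<close>. The Cantor set carries the product
  topology of the discrete space \<^typ>\<open>bool\<close> (the library topology on functions) and the
  lexicographic order \<^const>\<open>less_fun\<close>.
\<close>

type_synonym cantor = "bool word"

text \<open>
  The total map below is the prefix replacement \<open>\<alpha>\<psi> \<mapsto> \<beta>\<psi>\<close> only on the points with prefix
  \<open>\<alpha>\<close>. As these form an open set, its values elsewhere do not affect local agreement near a
  point with prefix \<open>\<alpha>\<close>, which is the only way it is used.
\<close>

definition prefix_replacement :: "bool list \<Rightarrow> bool list \<Rightarrow> cantor \<Rightarrow> cantor" where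
  "prefix_replacement \<alpha> \<beta> x = \<beta> \<frown> suffix (length \<alpha>) x"

definition has_prefix :: "cantor \<Rightarrow> bool list \<Rightarrow> bool" where
  "has_prefix p \<alpha> \<longleftrightarrow> (\<exists>\<psi>. p = \<alpha> \<frown> \<psi>)"

definition agree_near :: "cantor \<Rightarrow> (cantor \<Rightarrow> cantor) \<Rightarrow> (cantor \<Rightarrow> cantor) \<Rightarrow> bool" where
  "agree_near p f g \<longleftrightarrow> (\<exists>U. open U \<and> p \<in> U \<and> (\<forall>x\<in>U. f x = g x))"

definition Homeo :: "(cantor \<Rightarrow> cantor) set" where
  "Homeo = {f. \<exists>g. homeomorphism UNIV UNIV f g}"

definition V :: "(cantor \<Rightarrow> cantor) set" where
  "V = {f \<in> Homeo. \<forall>p. \<exists>\<alpha> \<beta>. has_prefix p \<alpha> \<and> has_prefix (f p) \<beta> \<and>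
          agree_near p f (prefix_replacement \<alpha> \<beta>)}"

definition sing :: "(cantor \<Rightarrow> cantor) \<Rightarrow> cantor set" where
  "sing f = {p. \<not> (\<exists>v\<in>V. agree_near p f v)}"

definition ends_in :: "bool \<Rightarrow> cantor \<Rightarrow> bool" where
  "ends_in b p \<longleftrightarrow> (\<exists>\<alpha>. p = \<alpha> \<frown> (\<lambda>_. b))"

text \<open>
  All representatives of \<open>L\<^sub>p\<close>: the word \<open>\<alpha>\<close> in \<open>p = \<alpha>bbb\<dots>\<close> is not unique, but different choices
  give maps \<open>\<alpha>b\<psi> \<mapsto> \<alpha>\<psi>\<close> that agree near \<open>p\<close>. The set is empty if \<open>p\<close> is not eventually constant.
\<close>

definition L :: "cantor \<Rightarrow> (cantor \<Rightarrow> cantor) set" where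
  "L p = {prefix_replacement (\<alpha> @ [b]) \<alpha> | \<alpha> b. p = \<alpha> \<frown> (\<lambda>_. b)}"

text \<open>
  For singular \<open>p\<close>, the use of \<open>L\<^bsub>f(p)\<^esub>\<close> includes the requirement that \<open>f(p)\<close> is eventually
  constant; here this is part of \<open>\<exists>M\<in>L (f p)\<close>.
\<close>

definition VA :: "(cantor \<Rightarrow> cantor) set" where
  "VA = {f \<in> Homeo.
     finite (sing f) \<and> (\<forall>p\<in>sing f. ends_in False p \<or> ends_in True p) \<and>
     (\<forall>p\<in>sing f. \<exists>U. open U \<and> p \<in> U \<and> monotone_on U less_fun less_fun f \<and>
        (\<exists>K\<in>L p. \<exists>M\<in>L (f p). \<forall>x\<in>U. (M \<circ> f) x = (f \<circ> K) x))}"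

definition VA_group :: "(cantor \<Rightarrow> cantor) monoid" where
  "VA_group = BijGroup UNIV\<lparr>carrier := VA\<rparr>"

end

theory Submission
  imports Defs
begin

text \<open>
  VA is a group because its singular germs have a normal form: near a singularity, up to prefix
  replacements, an element is a map \<open>g\<close> that respects the order and commutes with the scaling
  \<open>\<psi> \<mapsto> e\<psi>\<close>, where \<open>e\<close> is the digit that repeats in the singular point (\<open>VA_iff\<close>). Such maps are closed
  under composition and inverses.

  Two elements suffice for two reasons. First, for any finite list of elements of VA that fix the
  cone of 11 there are two elements \<open>a\<close> and \<open>b\<close> such that every group containing \<open>a\<close> and \<open>b\<close> contains
  all commutators of different members of the list (\<open>two_elements_generate_commutators\<close>). Here \<open>a\<close>
  permutes the cones of a large partition cyclically, and \<open>b\<close> is a product of conjugates of the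
  members of the list by powers of \<open>a\<close>. These powers are so sparse that two conjugates of \<open>b\<close> have
  supports that overlap only where a chosen pair of members meets.

  Second, finitely many commutators, together with \<open>a\<close>, generate VA. The exchange of two disjoint
  cones is a commutator. Three such exchanges and the conjugates by \<open>a\<close> give all of V, since every
  element of V is a bijection between two complete prefix codes and hence a product of exchanges.
  It remains to obtain the germs of VA at the two constant words \<open>eee\<dots>\<close>: if a group contains V and
  all these germs, realized with no other singularity, then every element of VA lies in it,
  because its singularities can be removed one after the other (\<open>VA_generated\<close>).

  A scale-invariant germ takes the cones of one periodic sequence, in order, to those of another.
  Up to a rotation, one period of such a sequence is a complete prefix code of the cone of \<open>d\<close>, the
  digit other than \<open>e\<close>. A germ is thus a pair of codes of equal length together with a rotation
  (\<open>germ_realized\<close>); these germs form the lift to the line of Thompson's group T. All pairs of codes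
  arise from splitting corresponding cones and from rotations, so that the rotations of one code of
  each length suffice (\<open>code_vine\<close>). Their recursion \<open>vine_rotates_step\<close> reduces them to moves that
  shift a subdivision between two consecutive cones and fix the rest of the period. Up to conjugation
  these moves are all the same, and one of them is a commutator (\<open>basic_commutators\<close>): if \<open>y\<close> is the
  move that acts on a whole period and \<open>x\<close> is its copy on the cone \<open>dd\<close>, which is the first half of the
  period, then \<open>y x y\<^sup>-\<^sup>1\<close> is the copy on the cone \<open>ddd\<close>, and the quotient of the two copies is such a move.
\<close>

abbreviation inverse_map :: "('a \<Rightarrow> 'b) \<Rightarrow> 'b \<Rightarrow> 'a" where
  "inverse_map f \<equiv> inv_into UNIV f"

lemma inverse_map_apply:
  assumes "bij f"
  shows "inverse_map f (f x) = x" "f (inverse_map f x) = x"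
  using assms by (simp_all add: bij_def surj_f_inv_f)

section \<open>Words, cones and prefix replacements\<close>

declare build_cons [simp del] build_append [simp del]

lemma suffix_length_conc [simp]: "suffix (length u) (u \<frown> x) = x"
  by (rule ext) simp

lemma conc_same_iff [simp]: "u \<frown> x = u \<frown> y \<longleftrightarrow> x = y"
  by (metis suffix_length_conc)

lemma conc_const [simp]: "replicate n b \<frown> (\<lambda>_. b) = (\<lambda>_. b)"
  by (rule ext) (simp add: conc_def)

lemma conc_single_const [simp]: "[b] \<frown> (\<lambda>_. b) = (\<lambda>_. b)"
  using conc_const[of 1 b] by simp

lemma conc_Cons: "(a # u) \<frown> x = [a] \<frown> (u \<frown> x)"
  by simp

lemma conc_single_eq_iff: "[a] \<frown> x = [b] \<frown> y \<longleftrightarrow> a = b \<and> x = y"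
proof
  assume eq: "[a] \<frown> x = [b] \<frown> y"
  then have "a = b" by (metis conc_fst length_Cons list.size(3) nth_Cons_0 zero_less_Suc)
  with eq show "a = b \<and> x = y" by simp
qed simp

lemma conc_Cons_eq_iff: "(a # u) \<frown> x = (b # v) \<frown> y \<longleftrightarrow> a = b \<and> u \<frown> x = v \<frown> y"
  by (subst conc_Cons, subst (2) conc_Cons) (rule conc_single_eq_iff)

lemma word_Cons_cases: obtains d y where "x = [d] \<frown> y"
  using word_split[of x 1] by (metis One_nat_def length_0_conv length_Suc_conv)

lemma conc_eq_cases:
  assumes "u \<frown> x = v \<frown> y"
  obtains s where "v = u @ s" "x = s \<frown> y" | s where "u = v @ s" "y = s \<frown> x"
proof -
  have "(\<exists>s. v = u @ s \<and> x = s \<frown> y) \<or> (\<exists>s. u = v @ s \<and> y = s \<frown> x)"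
    using assms
  proof (induction u arbitrary: v)
    case Nil
    then show ?case by auto
  next
    case (Cons a u)
    show ?case
    proof (cases v)
      case Nil
      then show ?thesis using Cons.prems by auto
    next
      case (Cons b v')
      then show ?thesis using Cons.IH[of v'] Cons.prems by (auto simp: conc_Cons_eq_iff)
    qed
  qed
  then show thesis using that by blast
qed

lemma conc_eq_longer:
  assumes "u \<frown> x = v \<frown> y" "length u \<le> length v"
  obtains s where "v = u @ s" "x = s \<frown> y"
proof (rule conc_eq_cases[OF assms(1)])
  fix s assume "u = v @ s" "y = s \<frown> x"
  moreover from this have "s = []" using assms(2) by simp
  ultimately show thesis using that[of "[]"] by simp
qed (rule that)

definition disjoint_cones :: "bool list \<Rightarrow> bool list \<Rightarrow> bool" where
  "disjoint_cones u v \<longleftrightarrow> (\<forall>x y. u \<frown> x \<noteq> v \<frown> y)"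

lemma disjoint_cones_sym: "disjoint_cones u v \<Longrightarrow> disjoint_cones v u"
  unfolding disjoint_cones_def by metis

lemma disjoint_cones_Nil [simp]: "\<not> disjoint_cones [] v" "\<not> disjoint_cones u []"
  unfolding disjoint_cones_def by (metis conc_empty)+

lemma disjoint_cones_Cons [simp]:
  "disjoint_cones (a # u) (b # v) \<longleftrightarrow> a \<noteq> b \<or> disjoint_cones u v"
  unfolding disjoint_cones_def by (auto simp: conc_Cons_eq_iff)

lemma disjoint_cones_append [simp]:
  "disjoint_cones (u @ v) (u @ w) \<longleftrightarrow> disjoint_cones v w"
  by (induction u) auto

lemma disjoint_cones_appendL: "disjoint_cones u v \<Longrightarrow> disjoint_cones (u @ s) v"
  unfolding disjoint_cones_def by (metis conc_conc)

lemma disjoint_cones_appendR: "disjoint_cones u v \<Longrightarrow> disjoint_cones u (v @ s)"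
  unfolding disjoint_cones_def by (metis conc_conc)

lemma disjoint_cones_cases:
  obtains s where "v = u @ s" | s where "u = v @ s" | "disjoint_cones u v"
  using conc_eq_cases[of u _ v] unfolding disjoint_cones_def by metis

definition moves :: "(cantor \<Rightarrow> cantor) \<Rightarrow> bool list \<Rightarrow> bool list \<Rightarrow> bool" where
  "moves f u v \<longleftrightarrow> (\<forall>x. f (u \<frown> x) = v \<frown> x)"

lemma movesD: "moves f u v \<Longrightarrow> f (u \<frown> x) = v \<frown> x"
  by (simp add: moves_def)

lemma moves_id [simp]: "moves id u u" "moves (\<lambda>x. x) u u"
  by (simp_all add: moves_def)

lemma moves_comp: "moves g v w \<Longrightarrow> moves f u v \<Longrightarrow> moves (g \<circ> f) u w"
  by (simp add: moves_def)

lemma moves_append: "moves f u v \<Longrightarrow> moves f (u @ s) (v @ s)"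
  unfolding moves_def by (metis conc_conc)

lemma moves_inverse: "bij f \<Longrightarrow> moves f u v \<Longrightarrow> moves (inverse_map f) v u"
  unfolding moves_def by (metis bij_def inv_f_f)

lemma moves_split_iff:
  "moves f u v \<longleftrightarrow> moves f (u @ [b]) (v @ [b]) \<and> moves f (u @ [\<not> b]) (v @ [\<not> b])"
proof (intro iffI conjI moves_append)
  assume h: "moves f (u @ [b]) (v @ [b]) \<and> moves f (u @ [\<not> b]) (v @ [\<not> b])"
  show "moves f u v"
    unfolding moves_def
  proof
    fix x :: cantor
    obtain d y where x: "x = [d] \<frown> y" by (rule word_Cons_cases)
    show "f (u \<frown> x) = v \<frown> x"
      using h unfolding x moves_def by (cases "d = b") auto
  qed
qed auto

section \<open>The order and the topology of the Cantor set\<close>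

text \<open>
  The distance order from the constant word \<open>eee\<dots>\<close>: it is the lexicographic order or its converse.
  Its use lets one argument serve singularities of both kinds.
\<close>

definition farther :: "bool \<Rightarrow> cantor \<Rightarrow> cantor \<Rightarrow> bool" where
  "farther e x y \<longleftrightarrow> (\<exists>k. x k = (\<not> e) \<and> y k = e \<and> (\<forall>i<k. x i = y i))"

lemma farther_less_fun: "farther e x y \<longleftrightarrow> (if e then less_fun x y else less_fun y x)"
  unfolding farther_def less_fun_def by (cases e) fastforce+

lemma farther_asym: "farther e x y \<Longrightarrow> \<not> farther e y x"
  unfolding farther_less_fun by (auto dest: less_fun_asym split: if_splits)

lemma farther_irrefl [simp]: "\<not> farther e x x"
  unfolding farther_def by auto

lemma farther_total: "x \<noteq> y \<Longrightarrow> farther e x y \<or> farther e y x"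
proof -
  assume "x \<noteq> y"
  then have ex: "\<exists>k. x k \<noteq> y k" by auto
  define k where "k = (LEAST k. x k \<noteq> y k)"
  have "x k \<noteq> y k" "\<forall>i<k. x i = y i"
    unfolding k_def using LeastI_ex[OF ex] not_less_Least by blast+
  then show ?thesis unfolding farther_def by (cases "x k = e") (metis (full_types))+
qed

lemma farther_Cons_iff:
  "farther e ([a] \<frown> x) ([b] \<frown> y) \<longleftrightarrow> (if a = b then farther e x y else a = (\<not> e))"
proof (cases "a = b")
  case True
  have "farther e ([b] \<frown> x) ([b] \<frown> y) \<longleftrightarrow> farther e x y"
    unfolding farther_def
  proof (intro iffI; elim exE conjE)
    fix k
    assume h: "([b] \<frown> x) k = (\<not> e)" "([b] \<frown> y) k = e" "\<forall>i<k. ([b] \<frown> x) i = ([b] \<frown> y) i"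
    then obtain j where j: "k = Suc j" by (cases k) auto
    then have "\<forall>i<j. x i = y i" using h(3) by (auto dest: spec[of _ "Suc _"])
    then show "\<exists>k. x k = (\<not> e) \<and> y k = e \<and> (\<forall>i<k. x i = y i)" using h j by auto
  next
    fix k
    assume h: "x k = (\<not> e)" "y k = e" "\<forall>i<k. x i = y i"
    then show "\<exists>k. ([b] \<frown> x) k = (\<not> e) \<and> ([b] \<frown> y) k = e \<and> (\<forall>i<k. ([b] \<frown> x) i = ([b] \<frown> y) i)"
      by (intro exI[of _ "Suc k"]) (auto simp: conc_def)
  qed
  then show ?thesis using True by simp
next
  case False
  then show ?thesis unfolding farther_def
    apply auto
    subgoal for k by (cases k) auto
    subgoal by (rule exI[of _ 0]) auto
    subgoal for k by (cases k) auto
    subgoal by (rule exI[of _ 0]) auto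
    done
qed

lemma farther_conc_iff [simp]: "farther e (u \<frown> x) (u \<frown> y) \<longleftrightarrow> farther e x y"
proof (induction u)
  case (Cons a u)
  show ?case by (subst conc_Cons, subst (2) conc_Cons, subst farther_Cons_iff) (simp add: Cons)
qed simp

lemma monotone_less_fun_iff_farther:
  "monotone_on U less_fun less_fun f \<longleftrightarrow> monotone_on U (farther e) (farther e) f"
  unfolding monotone_on_def farther_less_fun by (cases e) auto

lemma open_cone: "open (range (\<lambda>x. u \<frown> x) :: cantor set)"
proof -
  have "range (\<lambda>x::cantor. u \<frown> x) = {x. \<forall>i\<in>{..<length u}. x (id i) \<in> {u ! i}}"
  proof (intro Set.set_eqI iffI)
    fix x :: cantor assume "x \<in> {x. \<forall>i\<in>{..<length u}. x (id i) \<in> {u ! i}}"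
    then have "u \<frown> suffix (length u) x = x" by (auto simp: conc_def)
    then show "x \<in> range (\<lambda>x. u \<frown> x)" by (metis rangeI)
  qed auto
  then show ?thesis
    using product_topology_basis'[of "{..<length u}" "\<lambda>i. {u ! i}" id] by (simp add: open_discrete)
qed

lemma open_contains_cone:
  assumes "open U" "p \<in> (U :: cantor set)"
  shows "\<exists>n. \<forall>x. prefix n p \<frown> x \<in> U"
proof -
  from assms(1) have "openin (product_topology (\<lambda>_. euclidean) UNIV) U"
    unfolding open_fun_def .
  from product_topology_open_contains_basis[OF this assms(2)]
  obtain B where B: "p \<in> PiE UNIV B" "finite {i. B i \<noteq> UNIV}" "PiE UNIV B \<subseteq> U"
    by auto
  obtain n where n: "\<And>i. B i \<noteq> UNIV \<Longrightarrow> i < n"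
    using B(2) by (metis (mono_tags) finite_nat_set_iff_bounded mem_Collect_eq)
  have "prefix n p \<frown> x \<in> PiE UNIV B" for x
  proof
    fix i
    show "(prefix n p \<frown> x) i \<in> B i"
      using B(1) n[of i] by (cases "i < n") (auto simp: PiE_iff)
  qed auto
  then show ?thesis using B(3) by blast
qed

lemma cantor_compact: "compact (UNIV :: cantor set)"
proof -
  have "compact (UNIV :: bool set)" by (simp add: finite_imp_compact)
  then have "compact_space (product_topology (\<lambda>_::nat. euclidean :: bool topology) UNIV)"
    by (intro iffD2[OF compact_space_product_topology] disjI2) (simp add: compact_space_def)
  then show ?thesis
    unfolding euclidean_product_topology compact_space_def by simp
qed

lemma prefix_length_conc [simp]: "prefix (length u) (u \<frown> x) = u"
  by (rule nth_equalityI) auto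

lemma continuous_cantorI:
  fixes f :: "cantor \<Rightarrow> cantor"
  assumes "\<And>p m. \<exists>n. \<forall>x. prefix m (f (prefix n p \<frown> x)) = prefix m (f p)"
  shows "continuous_on UNIV f"
proof (rule continuous_on_coordinatewise_then_product)
  fix i
  have "open ((\<lambda>x. f x i) -` B)" for B :: "bool set"
  proof (subst open_subopen, intro ballI)
    fix p assume p: "p \<in> (\<lambda>x. f x i) -` B"
    obtain n where n: "\<And>x. prefix (Suc i) (f (prefix n p \<frown> x)) = prefix (Suc i) (f p)"
      using assms by blast
    have "f (prefix n p \<frown> x) i = f p i" for x
      using arg_cong[OF n[of x], of "\<lambda>w. w ! i"] by (simp del: subseq_to_Suc)
    then have "range (\<lambda>x. prefix n p \<frown> x) \<subseteq> (\<lambda>x. f x i) -` B" using p by auto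
    moreover have "p \<in> range (\<lambda>x. prefix n p \<frown> x)" by (metis prefix_suffix rangeI)
    ultimately show "\<exists>T. open T \<and> p \<in> T \<and> T \<subseteq> (\<lambda>x. f x i) -` B"
      using open_cone by blast
  qed
  then show "continuous_on UNIV (\<lambda>x. f x i)"
    by (simp add: continuous_on_open_vimage)
qed

lemma continuous_cantorD:
  fixes f :: "cantor \<Rightarrow> cantor"
  assumes "continuous_on UNIV f" "f p = v \<frown> y"
  obtains n where "\<And>x. \<exists>z. f (prefix n p \<frown> x) = v \<frown> z"
proof -
  have o: "open (f -` range (\<lambda>x. v \<frown> x))"
    using continuous_on_open_vimage[OF open_UNIV, of f] assms(1) open_cone[of v] by simp
  have p: "p \<in> f -` range (\<lambda>x. v \<frown> x)" using assms(2) by simp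
  obtain n where n: "\<And>x. prefix n p \<frown> x \<in> f -` range (\<lambda>x. v \<frown> x)"
    using open_contains_cone[OF o p] by blast
  show thesis
  proof (rule that)
    show "\<exists>z. f (prefix n p \<frown> x) = v \<frown> z" for x
      using n[of x] unfolding vimage_eq image_iff by simp
  qed
qed

text \<open>
  Compactness makes the continuity of the inverse automatic: a continuous bijection from a compact
  space to a Hausdorff space is open.
\<close>

lemma Homeo_iff: "f \<in> Homeo \<longleftrightarrow> bij f \<and> continuous_on UNIV f"
proof
  assume "f \<in> Homeo"
  then obtain g where g: "homeomorphism UNIV UNIV f g" unfolding Homeo_def by blast
  have "bij f"
    using g unfolding homeomorphism_def by (intro bijI injI) (metis UNIV_I, blast)
  then show "bij f \<and> continuous_on UNIV f" using g homeomorphism_cont1 by blast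
next
  assume f: "bij f \<and> continuous_on UNIV f"
  have "Hausdorff_space (product_topology (\<lambda>_::nat. euclidean :: bool topology) UNIV)"
    unfolding Hausdorff_space_product_topology
  proof (intro disjI2 ballI)
    show "Hausdorff_space (euclidean :: bool topology)"
      unfolding Hausdorff_space_def
    proof (intro allI impI)
      fix x y :: bool
      assume "x \<in> topspace euclidean \<and> y \<in> topspace euclidean \<and> x \<noteq> y"
      then show "\<exists>U V. openin euclidean U \<and> openin euclidean V \<and> x \<in> U \<and> y \<in> V \<and> disjnt U V"
        by (intro exI[of _ "{x}"] exI[of _ "{y}"]) (auto simp: open_discrete disjnt_def)
    qed
  qed
  then have "Hausdorff_space (euclidean :: cantor topology)"
    unfolding euclidean_product_topology .
  then have hm: "homeomorphic_map euclidean euclidean f"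
    using f cantor_compact
    by (intro continuous_imp_homeomorphic_map) (auto simp: compact_space_def bij_def)
  then have op: "open (f ` U)" if "open U" for U
    using that homeomorphic_imp_open_map[OF hm] unfolding open_map_def by simp
  have "homeomorphism UNIV UNIV f (inverse_map f)"
  proof (rule homeomorphismI)
    have "inverse_map f -` U = f ` U" for U
      using f by (metis bij_def bij_vimage_eq_inv_image inv_inv_eq bij_imp_bij_inv)
    then show "continuous_on UNIV (inverse_map f)"
      using op by (simp add: continuous_on_open_vimage)
  qed (use f in \<open>auto simp: bij_def surj_f_inv_f\<close>)
  then show "f \<in> Homeo" unfolding Homeo_def by blast
qed

lemma Homeo_inverse:
  assumes "f \<in> Homeo"
  shows "inverse_map f \<in> Homeo"
proof -
  obtain g where g: "homeomorphism UNIV UNIV f g" using assms unfolding Homeo_def by blast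
  then have "g (f x) = x" "f (g x) = x" for x
    unfolding homeomorphism_def by auto
  then have "inverse_map f = g" by (metis inv_unique_comp comp_def eq_id_iff ext)
  then show ?thesis using homeomorphism_symD[OF g] unfolding Homeo_def by blast
qed

section \<open>Local prefix replacements and Thompson's group V\<close>

definition locally_prefix :: "(cantor \<Rightarrow> cantor) \<Rightarrow> cantor \<Rightarrow> bool" where
  "locally_prefix f p \<longleftrightarrow> (\<exists>n v. moves f (prefix n p) v)"

lemma locally_prefixI: "moves f u v \<Longrightarrow> locally_prefix f (u \<frown> x)"
  unfolding locally_prefix_def by (metis prefix_length_conc)

lemma locally_prefix_deep:
  assumes "locally_prefix f p"
  obtains n where "\<And>m. m \<ge> n \<Longrightarrow> \<exists>v. moves f (prefix m p) v \<and> length v + n \<ge> m"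
proof -
  from assms obtain n v where "moves f (prefix n p) v" unfolding locally_prefix_def by blast
  then have "moves f (prefix (n + k) p) (v @ p [n \<rightarrow> n + k])" for k
    unfolding subsequence_append by (rule moves_append)
  then have "\<exists>v. moves f (prefix m p) v \<and> length v + n \<ge> m" if "m \<ge> n" for m
    using that le_Suc_ex[OF that] by (metis (no_types, lifting) add.commute add_le_cancel_left
        diff_add_inverse le_add2 length_append subsequence_length)
  then show thesis using that by blast
qed

lemma locally_prefixE:
  assumes "locally_prefix f p"
  obtains u v x where "p = u \<frown> x" "moves f u v" "f p = v \<frown> x"
  using assms unfolding locally_prefix_def by (metis movesD prefix_suffix)

lemma locally_prefix_deepE:
  assumes "locally_prefix f p"
  obtains u v x where "p = u \<frown> x" "moves f u v" "f p = v \<frown> x" "length u \<ge> N" "length v \<ge> N"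
proof -
  obtain n where n: "\<And>m. m \<ge> n \<Longrightarrow> \<exists>v. moves f (prefix m p) v \<and> length v + n \<ge> m"
    using locally_prefix_deep[OF assms] by blast
  obtain v where v: "moves f (prefix (n + N) p) v" "length v + n \<ge> n + N" using n[of "n + N"] by auto
  show thesis
    by (rule that[of "prefix (n + N) p" "suffix (n + N) p" v])
      (use v movesD[OF v(1), of "suffix (n + N) p"] in auto)
qed

lemma locally_prefix_comp:
  assumes "locally_prefix f p" "locally_prefix g (f p)"
  shows "locally_prefix (g \<circ> f) p"
proof -
  obtain u' w y where g: "f p = u' \<frown> y" "moves g u' w"
    using locally_prefixE[OF assms(2)] by metis
  obtain u v x where f: "p = u \<frown> x" "moves f u v" "f p = v \<frown> x" "length v \<ge> length u'"
    using locally_prefix_deepE[OF assms(1), of "length u'"] by metis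
  then have "u' \<frown> y = v \<frown> x" using g(1) by simp
  then obtain s where "v = u' @ s" using conc_eq_longer f(4) by metis
  then have "moves (g \<circ> f) u (w @ s)"
    using moves_comp[OF moves_append[OF g(2)]] f(2) by blast
  then show ?thesis unfolding f(1) by (rule locally_prefixI)
qed

lemma locally_prefix_inverse:
  assumes "bij f" "locally_prefix f p"
  shows "locally_prefix (inverse_map f) (f p)"
  using assms by (metis locally_prefixE moves_inverse locally_prefixI)

lemma locally_prefix_cont:
  assumes "locally_prefix f p"
  shows "\<exists>n. \<forall>x. prefix m (f (prefix n p \<frown> x)) = prefix m (f p)"
proof -
  obtain u v x where f: "p = u \<frown> x" "moves f u v" "f p = v \<frown> x" "length v \<ge> m"
    using locally_prefix_deepE[OF assms, of m] by metis
  have "prefix m (v \<frown> y) = prefix m (v \<frown> z)" for y z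
    using f(4) by (intro nth_equalityI) auto
  then show ?thesis using f movesD[OF f(2)] by (metis prefix_length_conc)
qed

text \<open>
  For disjoint cones this is an involution in V. For other cones it has no meaning.
\<close>

definition swap :: "bool list \<Rightarrow> bool list \<Rightarrow> cantor \<Rightarrow> cantor" where
  "swap u v x =
    (if x \<in> range ((\<frown>) u) then v \<frown> suffix (length u) x
     else if x \<in> range ((\<frown>) v) then u \<frown> suffix (length v) x else x)"

context
  fixes u v :: "bool list"
  assumes disj: "disjoint_cones u v"
begin

lemma swap_left: "swap u v (u \<frown> x) = v \<frown> x"
  by (simp add: swap_def)

lemma swap_right: "swap u v (v \<frown> x) = u \<frown> x"
  using disj unfolding swap_def disjoint_cones_def by (auto; metis)

lemma moves_swap_left: "moves (swap u v) u v"
  by (simp add: moves_def swap_left)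

lemma moves_swap_right: "moves (swap u v) v u"
  by (simp add: moves_def swap_right)

lemma swap_involutive: "swap u v (swap u v x) = x"
proof -
  consider y where "x = u \<frown> y" | y where "x = v \<frown> y" | "x \<notin> range ((\<frown>) u)" "x \<notin> range ((\<frown>) v)"
    by blast
  then show ?thesis by cases (auto simp: swap_left swap_right, simp add: swap_def)
qed

lemma bij_swap: "bij (swap u v)"
  using swap_involutive by (metis bijI')

end

lemma swap_other: "x \<notin> range ((\<frown>) u) \<Longrightarrow> x \<notin> range ((\<frown>) v) \<Longrightarrow> swap u v x = x"
  by (simp add: swap_def)

lemma moves_swap_other:
  "disjoint_cones u w \<Longrightarrow> disjoint_cones v w \<Longrightarrow> moves (swap u v) w w"
  unfolding moves_def by (auto intro!: swap_other simp: disjoint_cones_def) metis+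

lemma swap_commute: "disjoint_cones u v \<Longrightarrow> swap u v = swap v u"
  unfolding swap_def disjoint_cones_def by (intro ext) (auto; metis)

lemma disjoint_cones_moves:
  assumes "bij h" "moves h u u'" "moves h v v'" "disjoint_cones u v"
  shows "disjoint_cones u' v'"
  using assms unfolding disjoint_cones_def moves_def by (metis bij_def inj_eq)

lemma swap_conjugate:
  assumes h: "bij h" "moves h u u'" "moves h v v'" and d: "disjoint_cones u v"
  shows "h \<circ> swap u v \<circ> inverse_map h = swap u' v'"
proof
  fix x
  have d': "disjoint_cones u' v'" using disjoint_cones_moves assms by blast
  define y where "y = inverse_map h x"
  have x: "x = h y" unfolding y_def using h(1) by (metis bij_inv_eq_iff)
  have "h (swap u v y) = swap u' v' (h y)"
  proof -
    consider z where "y = u \<frown> z" | z where "y = v \<frown> z" | "y \<notin> range ((\<frown>) u)" "y \<notin> range ((\<frown>) v)"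
      by blast
    then show ?thesis
    proof cases
      case 3
      have "inj h" using h(1) by (simp add: bij_def)
      then have "h y \<noteq> u' \<frown> z" "h y \<noteq> v' \<frown> z" for z
        using 3 movesD[OF h(2), of z, symmetric] movesD[OF h(3), of z, symmetric] by (auto simp: inj_eq)
      then have "h y \<notin> range ((\<frown>) u')" "h y \<notin> range ((\<frown>) v')" by blast+
      then show ?thesis using 3 by (simp add: swap_other)
    qed (simp_all add: swap_left[OF d] swap_right[OF d] swap_left[OF d'] swap_right[OF d']
        movesD[OF h(2)] movesD[OF h(3)])
  qed
  then show "(h \<circ> swap u v \<circ> inverse_map h) x = swap u' v' x"
    unfolding comp_apply y_def[symmetric] by (simp flip: x)
qed

lemma locally_prefix_swap:
  assumes d: "disjoint_cones u v"
  shows "locally_prefix (swap u v) p"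
proof -
  consider z where "p = u \<frown> z" | z where "p = v \<frown> z" | "p \<notin> range ((\<frown>) u)" "p \<notin> range ((\<frown>) v)"
    by blast
  then show ?thesis
  proof cases
    case 3
    define n where "n = max (length u) (length v)"
    have "disjoint_cones w (prefix n p)" if "w = u \<or> w = v" for w
    proof (rule disjoint_cones_cases[where u = w and v = "prefix n p"])
      fix s assume "prefix n p = w @ s"
      then have "p = w \<frown> (s \<frown> suffix n p)" by (metis prefix_suffix conc_conc)
      then show ?thesis using 3 that by blast
    next
      fix s assume s: "w = prefix n p @ s"
      then have "length w = n + length s" by simp
      then have "length s = 0" using that unfolding n_def by (auto simp: max_def split: if_splits)
      then have "p = w \<frown> suffix n p" using s by simp
      then show ?thesis using 3 that by blast
    qed
    then have "moves (swap u v) (prefix n p) (prefix n p)" by (blast intro: moves_swap_other)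
    then show ?thesis unfolding locally_prefix_def by blast
  qed (use locally_prefixI moves_swap_left[OF d] moves_swap_right[OF d] in blast)+
qed

lemma V_iff: "f \<in> V \<longleftrightarrow> bij f \<and> (\<forall>p. locally_prefix f p)"
proof
  assume f: "f \<in> V"
  have "locally_prefix f p" for p
  proof -
    from f obtain a b U where ab: "has_prefix p a" "open U" "p \<in> U"
      "\<And>x. x \<in> U \<Longrightarrow> f x = prefix_replacement a b x"
      unfolding V_def agree_near_def by blast
    obtain n where n: "\<And>x. prefix n p \<frown> x \<in> U" using open_contains_cone ab by blast
    obtain y where y: "p = a \<frown> y" using ab(1) unfolding has_prefix_def by blast
    define s where "s = prefix n y"
    have "f ((a @ s) \<frown> x) = (b @ s) \<frown> x" for x
    proof -
      have "(a @ s) \<frown> x = prefix n p \<frown> suffix n ((a @ s) \<frown> x)"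
      proof (rule ext)
        fix i
        show "((a @ s) \<frown> x) i = (prefix n p \<frown> suffix n ((a @ s) \<frown> x)) i"
          unfolding y s_def by (cases "i < n") (auto simp: conc_def nth_append)
      qed
      then have "(a @ s) \<frown> x \<in> U" using n by metis
      then have "f ((a @ s) \<frown> x) = prefix_replacement a b (a \<frown> (s \<frown> x))" using ab(4) by simp
      then show ?thesis unfolding prefix_replacement_def suffix_length_conc by simp
    qed
    then have "moves f (a @ s) (b @ s)" by (simp add: moves_def)
    moreover have "p = (a @ s) \<frown> suffix n y" unfolding y s_def conc_conc[symmetric] by simp
    ultimately show ?thesis by (metis locally_prefixI)
  qed
  then show "bij f \<and> (\<forall>p. locally_prefix f p)" using f unfolding V_def Homeo_iff by blast
next
  assume f: "bij f \<and> (\<forall>p. locally_prefix f p)"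
  then have "f \<in> Homeo"
    unfolding Homeo_iff using continuous_cantorI[of f] locally_prefix_cont by blast
  moreover have "\<exists>a b. has_prefix p a \<and> has_prefix (f p) b \<and> agree_near p f (prefix_replacement a b)" for p
  proof -
    obtain u v x where p: "p = u \<frown> x" "moves f u v" "f p = v \<frown> x" using f by (blast elim: locally_prefixE)
    have "agree_near p f (prefix_replacement u v)"
      unfolding agree_near_def
      by (rule exI[of _ "range ((\<frown>) u)"])
        (use open_cone p movesD[OF p(2)] in \<open>auto simp: prefix_replacement_def\<close>)
    then show ?thesis using p unfolding has_prefix_def by blast
  qed
  ultimately show "f \<in> V" unfolding V_def by blast
qed

lemma V_bij: "f \<in> V \<Longrightarrow> bij f"
  by (simp add: V_iff)

lemma swap_in_V: "disjoint_cones u v \<Longrightarrow> swap u v \<in> V"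
  by (simp add: V_iff bij_swap locally_prefix_swap)

lemma V_comp: "f \<in> V \<Longrightarrow> g \<in> V \<Longrightarrow> f \<circ> g \<in> V"
  by (simp add: V_iff bij_comp locally_prefix_comp)

lemma V_id: "id \<in> V"
  unfolding V_iff using locally_prefixI[OF moves_id(1)[of "[]"]] by auto

text \<open>A third cone, disjoint from the source and from the target, is used as a temporary place.\<close>

lemma V_moves_exists:
  assumes "disjoint_cones w u" "disjoint_cones w v"
  obtains f where "f \<in> V" "moves f u v"
proof
  show "swap w v \<circ> swap w u \<in> V" using assms by (intro V_comp swap_in_V)
  show "moves (swap w v \<circ> swap w u) u v"
    using assms by (blast intro: moves_comp moves_swap_left moves_swap_right)
qed

lemma disjoint_from_both:
  assumes "length u \<ge> 2" "length v \<ge> 2"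
  obtains w where "disjoint_cones w u" "disjoint_cones w v"
proof -
  obtain a b u' where u: "u = a # b # u'"
    using assms(1) by (metis Suc_le_length_iff numeral_2_eq_2)
  obtain c d v' where v: "v = c # d # v'"
    using assms(2) by (metis Suc_le_length_iff numeral_2_eq_2)
  show thesis
  proof (cases "a = c")
    case True
    then show ?thesis using that[of "[\<not> a]"] u v by simp
  next
    case False
    then show ?thesis using that[of "[a, \<not> b]"] u v by simp
  qed
qed

text \<open>
  Near \<open>p\<close>, a prefix replacement can be restricted to cones so small that they leave room for a
  third cone, and then it extends to an element of V.
\<close>

lemma sing_iff: "p \<in> sing f \<longleftrightarrow> \<not> locally_prefix f p"
proof -
  have "locally_prefix f p" if g: "g \<in> V" "agree_near p f g" for g
  proof -
    obtain U where U: "open U" "p \<in> U" "\<And>x. x \<in> U \<Longrightarrow> f x = g x"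
      using g(2) unfolding agree_near_def by blast
    obtain n where n: "\<And>x. prefix n p \<frown> x \<in> U" using open_contains_cone U by blast
    obtain u v x where p: "p = u \<frown> x" "moves g u v" "g p = v \<frown> x" "length u \<ge> n"
      using locally_prefix_deepE[of g p n] g(1) V_iff by metis
    have "prefix n p \<frown> suffix n (u \<frown> y) = u \<frown> y" for y
      using p(1,4) by (intro ext) (auto simp: conc_def)
    then have "u \<frown> y \<in> U" for y using n by metis
    then have "moves f u v" using U(3) p(2) by (simp add: moves_def)
    then show ?thesis using p(1) locally_prefixI by blast
  qed
  moreover have "\<exists>g\<in>V. agree_near p f g" if f: "locally_prefix f p"
  proof -
    obtain u v x where p: "p = u \<frown> x" "moves f u v" "length u \<ge> 2" "length v \<ge> 2"
      using locally_prefix_deepE[OF f, of 2] by metis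
    obtain g where g: "g \<in> V" "moves g u v"
      using disjoint_from_both[OF p(3,4)] V_moves_exists by metis
    have "agree_near p f g"
      unfolding agree_near_def
      by (rule exI[of _ "range ((\<frown>) u)"])
        (use open_cone p(1) movesD[OF p(2)] movesD[OF g(2)] in auto)
    then show ?thesis using g(1) by blast
  qed
  ultimately show ?thesis unfolding sing_def by blast
qed

section \<open>Self-similar singularities and the group VA\<close>

text \<open>
  These are the germs of VA at the constant word \<open>eee\<dots>\<close>, extended to the whole Cantor set by means
  of the scaling \<open>\<psi> \<mapsto> e\<psi>\<close>.
\<close>

definition scale_map :: "bool \<Rightarrow> (cantor \<Rightarrow> cantor) \<Rightarrow> bool" where
  "scale_map e g \<longleftrightarrow> (\<forall>x. g ([e] \<frown> x) = [e] \<frown> g x) \<and>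
     (\<forall>x y. farther e x y \<longrightarrow> farther e (g x) (g y))"

text \<open>
  Condition (2) on VA in a normal form: once the word \<open>u\<close> is long enough, no neighbourhood has to be
  mentioned, since a germ that commutes with the scaling extends to the whole Cantor set.
\<close>

definition self_similar_at :: "(cantor \<Rightarrow> cantor) \<Rightarrow> cantor \<Rightarrow> bool" where
  "self_similar_at f p \<longleftrightarrow>
    (\<exists>u v e g. p = u \<frown> (\<lambda>_. e) \<and> (\<forall>x. f (u \<frown> x) = v \<frown> g x) \<and> scale_map e g)"

lemma scale_map_replicate:
  "scale_map e g \<Longrightarrow> g (replicate n e \<frown> x) = replicate n e \<frown> g x"
proof (induction n)
  case (Suc n)
  have "g (replicate (Suc n) e \<frown> x) = g ([e] \<frown> (replicate n e \<frown> x))" by simp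
  also have "\<dots> = [e] \<frown> g (replicate n e \<frown> x)"
    using Suc.prems by (simp only: scale_map_def)
  also have "\<dots> = [e] \<frown> (replicate n e \<frown> g x)" by (simp only: Suc.IH[OF Suc.prems])
  finally show ?case by simp
qed simp

lemma scale_map_fixes:
  assumes "scale_map e g"
  shows "g (\<lambda>_. e) = (\<lambda>_. e)"
proof
  fix i
  have "g (\<lambda>_. e) = replicate (Suc i) e \<frown> g (\<lambda>_. e)"
    using scale_map_replicate[OF assms, of "Suc i" "\<lambda>_. e"] by (simp only: conc_const)
  then have "g (\<lambda>_. e) i = (replicate (Suc i) e \<frown> g (\<lambda>_. e)) i" by (rule fun_cong)
  also have "\<dots> = e" by (simp del: replicate_Suc)
  finally show "g (\<lambda>_. e) i = e" .
qed

lemma scale_map_inj: "scale_map e g \<Longrightarrow> inj g"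
  unfolding scale_map_def by (metis farther_irrefl farther_total injI)

lemma scale_map_farther_iff:
  "scale_map e g \<Longrightarrow> farther e (g x) (g y) \<longleftrightarrow> farther e x y"
  unfolding scale_map_def by (metis farther_asym farther_total)

lemma scale_map_id: "scale_map e (\<lambda>x. x)"
  by (simp add: scale_map_def)

lemma scale_map_comp: "scale_map e g \<Longrightarrow> scale_map e h \<Longrightarrow> scale_map e (\<lambda>x. h (g x))"
  by (simp add: scale_map_def)

lemma self_similar_atI:
  "\<lbrakk>\<And>x. f (u \<frown> x) = v \<frown> g x; scale_map e g\<rbrakk> \<Longrightarrow> self_similar_at f (u \<frown> (\<lambda>_. e))"
  unfolding self_similar_at_def by blast

lemma self_similar_deepen:
  assumes "\<And>x. f (u \<frown> x) = v \<frown> g x" "scale_map e g"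
  shows "f ((u @ replicate n e) \<frown> x) = (v @ replicate n e) \<frown> g x"
  using assms(1)[of "replicate n e \<frown> x"] scale_map_replicate[OF assms(2), of n x] by simp

text \<open>
  Because \<open>g\<close> commutes with the scaling, the same \<open>g\<close> describes the germ on every smaller cone.
\<close>

lemma self_similar_deepE:
  assumes "self_similar_at f p"
  obtains u v e g where "p = u \<frown> (\<lambda>_. e)" "f p = v \<frown> (\<lambda>_. e)" "scale_map e g"
    "\<And>x. f (u \<frown> x) = v \<frown> g x" "length u \<ge> N" "length v \<ge> N"
proof -
  obtain u v e g where *: "p = u \<frown> (\<lambda>_. e)" "\<And>x. f (u \<frown> x) = v \<frown> g x" "scale_map e g"
    using assms unfolding self_similar_at_def by blast
  have "f p = v \<frown> (\<lambda>_. e)" using * scale_map_fixes by simp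
  then show thesis
    using that[of "u @ replicate N e" e "v @ replicate N e" g]
      self_similar_deepen[OF *(2,3), of N] * by (simp flip: conc_conc)
qed

lemma const_conc_eq:
  assumes "u \<frown> (\<lambda>_. e) = u' \<frown> (\<lambda>_. e')" "length u' \<le> length u"
  obtains n where "u = u' @ replicate n e'" "e = e'"
proof -
  obtain s where s: "u = u' @ s" "(\<lambda>_. e') = s \<frown> (\<lambda>_. e)"
    using conc_eq_longer[OF assms(1)[symmetric] assms(2)] .
  have "s = replicate (length s) e'"
    using fun_cong[OF s(2)] by (intro nth_equalityI) (auto, metis conc_fst)
  moreover have "e = e'" using fun_cong[OF s(2), of "length s"] by simp
  ultimately show thesis using that s by blast
qed

lemma locally_prefix_self_similar:
  assumes "locally_prefix f p" "f p = v \<frown> (\<lambda>_. e)"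
  shows "self_similar_at f p"
proof -
  obtain u' v' x where p: "p = u' \<frown> x" "moves f u' v'" "f p = v' \<frown> x" "length v' \<ge> length v"
    using locally_prefix_deepE[OF assms(1), of "length v"] by metis
  have "v \<frown> (\<lambda>_. e) = v' \<frown> x" using p(3) assms(2) by simp
  then obtain s where s: "v' = v @ s" "(\<lambda>_. e) = s \<frown> x" using p(4) by (rule conc_eq_longer)
  have "x = (\<lambda>_. e)"
    using arg_cong[OF s(2), of "suffix (length s)"] by (simp add: suffix_def)
  then show ?thesis
    using self_similar_atI[OF movesD[OF p(2)] scale_map_id] p(1) by simp
qed

lemma self_similar_comp:
  assumes "self_similar_at f p" "self_similar_at h (f p)"
  shows "self_similar_at (h \<circ> f) p"
proof -
  obtain u' w e' g' where h: "f p = u' \<frown> (\<lambda>_. e')" "scale_map e' g'"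
    "\<And>x. h (u' \<frown> x) = w \<frown> g' x"
    using self_similar_deepE[OF assms(2)] by metis
  obtain u v e g where f: "p = u \<frown> (\<lambda>_. e)" "f p = v \<frown> (\<lambda>_. e)" "scale_map e g"
    "\<And>x. f (u \<frown> x) = v \<frown> g x" "length v \<ge> length u'"
    using self_similar_deepE[OF assms(1), of "length u'"] by metis
  obtain n where n: "v = u' @ replicate n e'" "e = e'"
    using const_conc_eq[of v e u' e'] f(2,5) h(1) by metis
  have "(h \<circ> f) (u \<frown> x) = (w @ replicate n e') \<frown> g' (g x)" for x
    using self_similar_deepen[OF h(3) h(2)] f(4) n by (simp del: conc_conc)
  moreover have "scale_map e (\<lambda>x. g' (g x))"
    using scale_map_comp[OF f(3)] h(2) n(2) by blast
  ultimately show ?thesis unfolding f(1) by (rule self_similar_atI)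
qed

text \<open>
  The inverse of \<open>f\<close> is continuous, so \<open>f\<close> takes a cone around the singularity to a set that contains
  a cone around the image.
\<close>

lemma scale_map_onto_near_end:
  assumes f: "f \<in> Homeo" and fg: "\<And>x. f (u \<frown> x) = v \<frown> g x" and g: "scale_map e g"
  shows "\<exists>n. \<forall>x. replicate n e \<frown> x \<in> range g"
proof -
  let ?p = "v \<frown> (\<lambda>_. e)"
  have bij: "bij f" and cont: "continuous_on UNIV (inverse_map f)"
    using f Homeo_inverse[OF f] by (auto simp: Homeo_iff)
  have "f (u \<frown> (\<lambda>_. e)) = ?p" using fg scale_map_fixes[OF g] by simp
  then have "inverse_map f ?p = u \<frown> (\<lambda>_. e)" using inverse_map_apply(1)[OF bij] by metis
  then obtain n where n: "\<And>x. \<exists>z. inverse_map f (prefix n ?p \<frown> x) = u \<frown> z"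
    using continuous_cantorD[OF cont] by metis
  have "replicate n e \<frown> x \<in> range g" for x
  proof -
    let ?w = "(v @ replicate n e) \<frown> x"
    have "?w = prefix n ?p \<frown> suffix n ?w"
      by (rule ext) (auto simp: conc_def nth_append)
    then obtain z where z: "inverse_map f ?w = u \<frown> z" using n by metis
    have "?w = f (u \<frown> z)" using inverse_map_apply(2)[OF bij, of ?w] z by simp
    then have "v \<frown> (replicate n e \<frown> x) = v \<frown> g z" unfolding fg by simp
    then show ?thesis by (simp only: conc_same_iff) blast
  qed
  then show ?thesis by blast
qed

lemma self_similar_inverse:
  assumes f: "f \<in> Homeo" and "self_similar_at f p"
  shows "self_similar_at (inverse_map f) (f p)"
proof -
  obtain u v e g where *: "p = u \<frown> (\<lambda>_. e)" "f p = v \<frown> (\<lambda>_. e)" "scale_map e g"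
    "\<And>x. f (u \<frown> x) = v \<frown> g x"
    using self_similar_deepE[OF assms(2)] by metis
  obtain n where "\<And>x. replicate n e \<frown> x \<in> range g"
    using scale_map_onto_near_end[OF f *(4,3)] by blast
  then have "\<forall>x. \<exists>y. g y = replicate n e \<frown> x" by (metis imageE)
  then obtain h where gh: "\<And>x. g (h x) = replicate n e \<frown> x" by metis
  have h: "inverse_map f ((v @ replicate n e) \<frown> x) = u \<frown> h x" for x
  proof -
    have "bij f" using f by (simp add: Homeo_iff)
    moreover have "(v @ replicate n e) \<frown> x = f (u \<frown> h x)" using *(4)[of "h x"] gh[of x] by simp
    ultimately show ?thesis by (simp only: inverse_map_apply)
  qed
  have "scale_map e h"
    unfolding scale_map_def
  proof (intro conjI allI impI)
    fix x
    have "g ([e] \<frown> h x) = [e] \<frown> (replicate n e \<frown> x)"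
      using *(3) gh[of x] by (simp only: scale_map_def)
    also have "\<dots> = g (h ([e] \<frown> x))"
      by (simp add: gh replicate_append_same)
    finally show "h ([e] \<frown> x) = [e] \<frown> h x"
      using scale_map_inj[OF *(3)] unfolding inj_def by metis
  next
    fix x y
    assume "farther e x y"
    then show "farther e (h x) (h y)"
      using scale_map_farther_iff[OF *(3), of "h x" "h y"] gh by simp
  qed
  from self_similar_atI[OF h this] show ?thesis using *(2) by (simp flip: conc_conc)
qed

lemma self_similar_cont:
  assumes "self_similar_at f p"
  shows "\<exists>n. \<forall>x. prefix m (f (prefix n p \<frown> x)) = prefix m (f p)"
proof -
  obtain u v e g where *: "p = u \<frown> (\<lambda>_. e)" "f p = v \<frown> (\<lambda>_. e)" "scale_map e g"
    "\<And>x. f (u \<frown> x) = v \<frown> g x" "length v \<ge> m"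
    using self_similar_deepE[OF assms, of m] by metis
  have "prefix m (v \<frown> y) = prefix m (v \<frown> z)" for y z
    using *(5) by (intro nth_equalityI) auto
  then show ?thesis using * by (metis prefix_length_conc)
qed

text \<open>
  The condition on a singularity in the definition of VA: the two ends \<open>\<alpha>eee\<dots>\<close> and \<open>\<beta>ccc\<dots>\<close> are of
  the same kind because the constant words 0 and 1 are the least and the greatest point.
\<close>

lemma self_similar_iff:
  assumes cont: "continuous_on UNIV f"
  shows "self_similar_at f p \<longleftrightarrow> (\<exists>U. open U \<and> p \<in> U \<and> monotone_on U less_fun less_fun f \<and>
        (\<exists>K\<in>L p. \<exists>M\<in>L (f p). \<forall>x\<in>U. (M \<circ> f) x = (f \<circ> K) x))" (is "_ \<longleftrightarrow> ?R")
proof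
  assume "self_similar_at f p"
  then obtain u v e g where *: "p = u \<frown> (\<lambda>_. e)" "f p = v \<frown> (\<lambda>_. e)" "scale_map e g"
    "\<And>x. f (u \<frown> x) = v \<frown> g x"
    using self_similar_deepE by metis
  let ?U = "range ((\<frown>) (u @ [e]))"
  have "p = (u @ [e]) \<frown> (\<lambda>_. e)" using *(1) by (simp flip: conc_conc)
  then have "p \<in> ?U" by blast
  have "monotone_on ?U less_fun less_fun f"
    unfolding monotone_less_fun_iff_farther[where e = e]
  proof (rule monotone_onI)
    fix x y assume "x \<in> ?U" "y \<in> ?U" "farther e x y"
    then obtain x' y' where "x = u \<frown> x'" "y = u \<frown> y'" by (metis (no_types) conc_conc imageE)
    with \<open>farther e x y\<close> show "farther e (f x) (f y)"
      using *(3,4) by (simp add: scale_map_def)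
  qed
  have KM: "prefix_replacement (u @ [e]) u \<in> L p"
    "prefix_replacement (v @ [e]) v \<in> L (f p)"
    using *(1,2) unfolding L_def by blast+
  have op: "open ?U" by (rule open_cone)
  have eq: "(prefix_replacement (v @ [e]) v \<circ> f) x = (f \<circ> prefix_replacement (u @ [e]) u) x"
    if xU: "x \<in> ?U" for x
  proof -
    obtain y where y: "x = (u @ [e]) \<frown> y" using xU by blast
    have fx: "f x = (v @ [e]) \<frown> g y"
      using *(3) *(4)[of "[e] \<frown> y"] unfolding y by (simp add: scale_map_def)
    show ?thesis
      unfolding comp_apply prefix_replacement_def fx unfolding y suffix_length_conc *(4) ..
  qed
  show ?R
    by (intro exI[of _ ?U] conjI bexI[OF _ KM(1)] bexI[OF _ KM(2)] ballI eq) fact+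
next
  assume ?R
  then obtain U u e v c where U: "open U" "p \<in> U" "monotone_on U less_fun less_fun f"
    and p: "p = u \<frown> (\<lambda>_. e)" "f p = v \<frown> (\<lambda>_. c)"
    and eq: "\<And>x. x \<in> U \<Longrightarrow> prefix_replacement (v @ [c]) v (f x) = f (prefix_replacement (u @ [e]) u x)"
    unfolding L_def by auto
  obtain n where n: "\<And>x. prefix n p \<frown> x \<in> U" using open_contains_cone U by blast
  have "f p = (v @ [c]) \<frown> (\<lambda>_. c)" using p(2) by (simp flip: conc_conc)
  from continuous_cantorD[OF cont this]
  obtain m where m: "\<And>x. \<exists>z. f (prefix m p \<frown> x) = (v @ [c]) \<frown> z" by blast
  define w where "w = u @ replicate (n + m) e"
  have w: "\<exists>y. w \<frown> x = prefix n p \<frown> y" "\<exists>y. w \<frown> x = prefix m p \<frown> y" for x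
  proof -
    have "w \<frown> x = prefix n p \<frown> suffix n (w \<frown> x)"
      "w \<frown> x = prefix m p \<frown> suffix m (w \<frown> x)"
      unfolding w_def p by (rule ext; auto simp: conc_def nth_append)+
    then show "\<exists>y. w \<frown> x = prefix n p \<frown> y" "\<exists>y. w \<frown> x = prefix m p \<frown> y" by blast+
  qed
  have wU: "w \<frown> x \<in> U" for x using w(1) n by metis
  have "\<exists>z. f (w \<frown> x) = v \<frown> ([c] \<frown> z)" for x using w(2) m by (metis conc_conc)
  then obtain g0 where g0: "\<And>x. f (w \<frown> x) = v \<frown> ([c] \<frown> g0 x)" by metis
  define g where "g x = [c] \<frown> g0 x" for x
  have g: "f (w \<frown> x) = v \<frown> g x" for x using g0 g_def by simp
  have scale: "g ([e] \<frown> x) = [c] \<frown> g x" for x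
  proof -
    have "prefix_replacement (v @ [c]) v ((v @ [c]) \<frown> g0 ([e] \<frown> x)) = v \<frown> g0 ([e] \<frown> x)"
      unfolding prefix_replacement_def suffix_length_conc ..
    then have "prefix_replacement (v @ [c]) v (f (w \<frown> ([e] \<frown> x))) = v \<frown> g0 ([e] \<frown> x)"
      unfolding g0 by simp
    moreover have "prefix_replacement (u @ [e]) u (w \<frown> ([e] \<frown> x)) = w \<frown> x"
    proof -
      have "w \<frown> ([e] \<frown> x) = (u @ [e]) \<frown> (replicate (n + m) e \<frown> x)"
        by (simp add: w_def replicate_append_same)
      then show ?thesis
        unfolding prefix_replacement_def by (simp only: suffix_length_conc) (simp add: w_def)
    qed
    ultimately have "v \<frown> g0 ([e] \<frown> x) = v \<frown> g x" using eq[OF wU] g by metis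
    then have "g0 ([e] \<frown> x) = g x" by (simp only: conc_same_iff)
    then show ?thesis using g_def[of "[e] \<frown> x"] by (simp only:)
  qed
  have mono: "farther e (g x) (g y)" if "farther e x y" for x y
  proof -
    have "farther e (f (w \<frown> x)) (f (w \<frown> y))"
      using U(3) wU that unfolding monotone_less_fun_iff_farther[where e = e]
      by (auto simp: monotone_on_def)
    then show ?thesis using g by simp
  qed
  have gp: "g (\<lambda>_. e) = (\<lambda>_. c)"
    using g[of "\<lambda>_. e"] p by (simp add: w_def flip: conc_conc)
  have "c = e"
  proof (rule ccontr)
    assume "c \<noteq> e"
    have "farther e (\<lambda>_. \<not> e) (\<lambda>_. e)" unfolding farther_def by auto
    from mono[OF this] have "farther e (g (\<lambda>_. \<not> e)) (\<lambda>_. c)" using gp by simp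
    then show False using \<open>c \<noteq> e\<close> unfolding farther_def by auto
  qed
  then have "scale_map e g" unfolding scale_map_def using scale mono by simp
  then have "self_similar_at f (w \<frown> (\<lambda>_. e))" using self_similar_atI[of f w v g e] g by blast
  then show "self_similar_at f p" using p by (simp add: w_def flip: conc_conc)
qed

text \<open>
  Continuity need not be required: both kinds of germs are continuous.
\<close>

lemma VA_iff:
  "f \<in> VA \<longleftrightarrow> bij f \<and> finite {p. \<not> locally_prefix f p} \<and>
     (\<forall>p. locally_prefix f p \<or> self_similar_at f p)" (is "_ \<longleftrightarrow> ?R")
proof
  assume f: "f \<in> VA"
  then have "f \<in> Homeo" unfolding VA_def by blast
  moreover have "locally_prefix f p \<or> self_similar_at f p" for p
  proof (cases "p \<in> sing f")
    case True
    have "continuous_on UNIV f" using \<open>f \<in> Homeo\<close> unfolding Homeo_iff by blast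
    from self_similar_iff[OF this, of p] show ?thesis using f True unfolding VA_def by simp
  next
    case False
    then show ?thesis unfolding sing_iff by blast
  qed
  moreover have "sing f = {p. \<not> locally_prefix f p}" using sing_iff by blast
  ultimately show ?R using f unfolding VA_def Homeo_iff by auto
next
  assume f: ?R
  have cont: "continuous_on UNIV f"
    using f locally_prefix_cont self_similar_cont by (intro continuous_cantorI) blast
  have self: "self_similar_at f p" if "p \<in> sing f" for p
    using f that sing_iff by blast
  have "ends_in False p \<or> ends_in True p" if "p \<in> sing f" for p
  proof -
    from self[OF that] obtain u e where "p = u \<frown> (\<lambda>_. e)" unfolding self_similar_at_def by blast
    then show ?thesis by (cases e) (auto simp: ends_in_def)
  qed
  moreover have "sing f = {p. \<not> locally_prefix f p}" using sing_iff by blast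
  ultimately show "f \<in> VA"
    unfolding VA_def Homeo_iff using f cont self[unfolded self_similar_iff[OF cont]] by simp
qed

lemma VA_Homeo: "f \<in> VA \<Longrightarrow> f \<in> Homeo"
  by (simp add: VA_def)

lemma VA_bij: "f \<in> VA \<Longrightarrow> bij f"
  by (simp add: VA_iff)

lemma V_subset_VA: "f \<in> V \<Longrightarrow> f \<in> VA"
  by (simp add: V_iff VA_iff)

lemma sing_comp_subset:
  assumes "bij f"
  shows "{p. \<not> locally_prefix (h \<circ> f) p} \<subseteq>
    {p. \<not> locally_prefix f p} \<union> inverse_map f ` {p. \<not> locally_prefix h p}"
proof
  fix p assume "p \<in> {p. \<not> locally_prefix (h \<circ> f) p}"
  then have "\<not> locally_prefix f p \<or> \<not> locally_prefix h (f p)"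
    using locally_prefix_comp by blast
  moreover have "p = inverse_map f (f p)" using assms by (simp add: bij_def)
  ultimately show "p \<in> {p. \<not> locally_prefix f p} \<union> inverse_map f ` {p. \<not> locally_prefix h p}"
    by blast
qed

text \<open>
  A point at which only one of two maps is singular is eventually constant together with its image,
  and there a prefix replacement is itself self-similar.
\<close>

lemma VA_comp:
  assumes "f \<in> VA" "h \<in> VA"
  shows "h \<circ> f \<in> VA"
proof -
  have "bij (h \<circ> f)" using assms by (simp add: VA_bij bij_comp)
  moreover have "finite {p. \<not> locally_prefix (h \<circ> f) p}"
    using sing_comp_subset[of f h] assms unfolding VA_iff by (meson finite_Un finite_imageI finite_subset)
  moreover have "self_similar_at (h \<circ> f) p" if ns: "\<not> locally_prefix (h \<circ> f) p" for p
  proof -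
    have "\<exists>v e. f p = v \<frown> (\<lambda>_. e)"
    proof (cases "locally_prefix f p")
      case True
      then have "self_similar_at h (f p)"
        using locally_prefix_comp ns assms(2) unfolding VA_iff by blast
      then show ?thesis unfolding self_similar_at_def by blast
    next
      case False
      then have "self_similar_at f p" using assms(1) unfolding VA_iff by blast
      then show ?thesis using self_similar_deepE by metis
    qed
    then obtain v e where v: "f p = v \<frown> (\<lambda>_. e)" by blast
    have "self_similar_at f p"
      using locally_prefix_self_similar[of f p v e] v assms(1) unfolding VA_iff by blast
    moreover have "self_similar_at h (f p)"
    proof (cases "locally_prefix h (f p)")
      case True
      then obtain u w x where h: "f p = u \<frown> x" "moves h u w" "h (f p) = w \<frown> x" "length u \<ge> length v"
        using locally_prefix_deepE[OF True, of "length v"] by metis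
      have "x = suffix (length u) (v \<frown> (\<lambda>_. e))" using h(1) v suffix_length_conc by metis
      then have "x = (\<lambda>_. e)" using h(4) by (auto simp: conc_def)
      then show ?thesis using locally_prefix_self_similar[OF True] h(3) by metis
    next
      case False
      then show ?thesis using assms(2) unfolding VA_iff by blast
    qed
    ultimately show ?thesis by (rule self_similar_comp)
  qed
  ultimately show ?thesis unfolding VA_iff by blast
qed

lemma VA_inverse:
  assumes "f \<in> VA"
  shows "inverse_map f \<in> VA"
proof -
  have bij: "bij f" and H: "f \<in> Homeo" using assms by (auto simp: VA_bij VA_Homeo)
  have inv: "f (inverse_map f q) = q" for q using bij by (rule inverse_map_apply(2))
  have "\<not> locally_prefix f (inverse_map f q)" if "\<not> locally_prefix (inverse_map f) q" for q
    using locally_prefix_inverse[OF bij] that inv by metis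
  then have "{q. \<not> locally_prefix (inverse_map f) q} \<subseteq> f ` {p. \<not> locally_prefix f p}"
    using inv by (metis (mono_tags, lifting) imageI mem_Collect_eq subsetI)
  then have "finite {q. \<not> locally_prefix (inverse_map f) q}"
    using assms unfolding VA_iff by (meson finite_imageI finite_subset)
  moreover have "locally_prefix (inverse_map f) q \<or> self_similar_at (inverse_map f) q" for q
    using locally_prefix_inverse[OF bij] self_similar_inverse[OF H] inv assms
    unfolding VA_iff by metis
  ultimately show ?thesis unfolding VA_iff using bij bij_imp_bij_inv by blast
qed

text \<open>
  Koenig's lemma: by compactness, a property that every point acquires at some depth, and that
  persists, holds at one depth for all points.
\<close>

lemma uniform_depth:
  assumes mono: "\<And>w s. P w \<Longrightarrow> P (w @ s)" and ex: "\<And>p :: cantor. \<exists>n. P (prefix n p)"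
  obtains N where "\<And>w. length w = N \<Longrightarrow> P w"
proof -
  have "UNIV \<subseteq> (\<Union>w\<in>{w. P w}. range (\<lambda>x :: cantor. w \<frown> x))"
  proof
    fix p :: cantor
    obtain n where "P (prefix n p)" using ex by blast
    moreover have "p \<in> range (\<lambda>x. prefix n p \<frown> x)" by (metis prefix_suffix rangeI)
    ultimately show "p \<in> (\<Union>w\<in>{w. P w}. range (\<lambda>x. w \<frown> x))" by blast
  qed
  then obtain W where W: "W \<subseteq> {w. P w}" "finite W"
    "UNIV \<subseteq> (\<Union>w\<in>W. range (\<lambda>x :: cantor. w \<frown> x))"
    using compactE_image[OF cantor_compact, of "{w. P w}" "\<lambda>w. range (\<lambda>x. w \<frown> x)"] open_cone
    by metis
  have "P w" if w: "length w = (\<Sum>v\<in>W. length v)" for w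
  proof -
    have "w \<frown> (\<lambda>_. False) \<in> (\<Union>v\<in>W. range (\<lambda>x :: cantor. v \<frown> x))" using W(3) by blast
    then obtain v x where v: "v \<in> W" "w \<frown> (\<lambda>_. False) = v \<frown> x" by blast
    have "length v \<le> length w" using v(1) W(2) w by (simp add: member_le_sum)
    then obtain s where "w = v @ s" by (rule conc_eq_longer[OF v(2)[symmetric]])
    then show ?thesis using mono W(1) v(1) by blast
  qed
  then show thesis using that by blast
qed

section \<open>Complete prefix codes\<close>

text \<open>
  \<open>code e r D\<close>: the cones of the words in \<open>D\<close> partition the cone of \<open>r\<close>, and \<open>D\<close> lists them in the
  order in which they approach the end \<open>reee\<dots>\<close>. The word lists arise from \<open>[r]\<close> by splitting cones.
\<close>

inductive code :: "bool \<Rightarrow> bool list \<Rightarrow> bool list list \<Rightarrow> bool" for e r where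
  root: "code e r [r]"
| split: "code e r (A @ w # B) \<Longrightarrow> code e r (A @ (w @ [\<not> e]) # (w @ [e]) # B)"

text \<open>
  The words \<open>u\<close> and \<open>v\<close> branch, with \<open>v\<close> on the side of \<open>e\<close>. This makes the cones disjoint and
  orders all their points in the same way.
\<close>

definition before :: "bool \<Rightarrow> bool list \<Rightarrow> bool list \<Rightarrow> bool" where
  "before e u v \<longleftrightarrow> (\<exists>c s t. u = c @ (\<not> e) # s \<and> v = c @ e # t)"

lemma before_disjoint: "before e u v \<Longrightarrow> disjoint_cones u v"
  unfolding before_def by auto

lemma before_farther: "before e u v \<Longrightarrow> farther e (u \<frown> x) (v \<frown> y)"
proof -
  assume "before e u v"
  then obtain c s t where *: "u = c @ (\<not> e) # s" "v = c @ e # t" unfolding before_def by blast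
  have "farther e ([\<not> e] \<frown> (s \<frown> x)) ([e] \<frown> (t \<frown> y))" unfolding farther_Cons_iff by simp
  then have "farther e (c \<frown> ([\<not> e] \<frown> (s \<frown> x))) (c \<frown> ([e] \<frown> (t \<frown> y)))"
    unfolding farther_conc_iff .
  then show ?thesis unfolding * by simp
qed

lemma before_append: "before e u v \<Longrightarrow> before e (u @ s) (v @ t)"
  unfolding before_def by fastforce

lemma before_prepend: "before e u v \<Longrightarrow> before e (s @ u) (s @ v)"
  unfolding before_def by (metis append.assoc)

lemma before_append1: "before e u v \<Longrightarrow> before e (u @ s) v" "before e u v \<Longrightarrow> before e u (v @ t)"
  using before_append[of e u v s "[]"] before_append[of e u v "[]" t] by auto

lemma code_sorted: "code e r D \<Longrightarrow> sorted_wrt (before e) D"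
proof (induction rule: code.induct)
  case (split A w B)
  have "before e (w @ [\<not> e]) (w @ [e])" unfolding before_def by blast
  with split.IH show ?case
    by (auto simp: sorted_wrt_append intro: before_append1)
qed simp

lemma code_disjoint:
  assumes "code e r D"
  shows "sorted_wrt disjoint_cones D"
  by (rule sorted_wrt_mono_rel[OF _ code_sorted[OF assms]]) (rule before_disjoint)

lemma sorted_disjoint_distinct:
  assumes "sorted_wrt disjoint_cones D"
  shows "distinct D"
proof -
  have "\<not> disjoint_cones u u" for u by (simp add: disjoint_cones_def)
  then show ?thesis
    using assms unfolding distinct_conv_nth sorted_wrt_iff_nth_less
    by (metis linorder_neqE_nat)
qed

lemma code_complete: "code e r D \<Longrightarrow> \<exists>w\<in>set D. \<exists>y. r \<frown> x = w \<frown> y"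
proof (induction rule: code.induct)
  case (split A w B)
  then obtain v y where v: "v \<in> set (A @ w # B)" "r \<frown> x = v \<frown> y" by blast
  show ?case
  proof (cases "v = w")
    case True
    obtain d z where "y = [d] \<frown> z" by (rule word_Cons_cases)
    then have "r \<frown> x = (w @ [d]) \<frown> z" using v True by simp
    moreover have "w @ [d] \<in> set (A @ (w @ [\<not> e]) # (w @ [e]) # B)" by (cases "d = e") auto
    ultimately show ?thesis by blast
  next
    case False
    then show ?thesis using v by auto
  qed
qed auto

lemma code_nonempty: "code e r D \<Longrightarrow> D \<noteq> []"
  by (induction rule: code.induct) auto

lemma code_extends: "code e r D \<Longrightarrow> w \<in> set D \<Longrightarrow> \<exists>s. w = r @ s"
proof (induction arbitrary: w rule: code.induct)
  case (split A v B)
  obtain s where "v = r @ s" using split.IH[of v] by auto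
  with split.IH[of w] split.prems show ?case by auto
qed auto

fun expand :: "bool \<Rightarrow> bool list \<Rightarrow> nat \<Rightarrow> bool list list" where
  "expand e w 0 = [w]"
| "expand e w (Suc k) = expand e (w @ [\<not> e]) k @ expand e (w @ [e]) k"

lemma length_expand [simp]: "length (expand e w k) = 2 ^ k"
  by (induction k arbitrary: w) auto

lemma set_expand: "set (expand e w k) = {w @ v | v. length v = k}"
proof (induction k arbitrary: w)
  case (Suc k)
  show ?case
  proof (intro Set.set_eqI iffI)
    fix u assume "u \<in> {w @ v | v. length v = Suc k}"
    then obtain d v where "u = (w @ [d]) @ v" "length v = k" by (auto simp: length_Suc_conv)
    then show "u \<in> set (expand e w (Suc k))" by (cases "d = e") (auto simp: Suc)
  next
    fix u assume "u \<in> set (expand e w (Suc k))"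
    then obtain d v where "u = (w @ [d]) @ v" "length v = k" by (auto simp: Suc)
    then have "u = w @ (d # v)" "length (d # v) = Suc k" by auto
    then show "u \<in> {w @ v | v. length v = Suc k}" by blast
  qed
qed auto

lemma moves_expand: "moves f w v \<Longrightarrow> list_all2 (moves f) (expand e w k) (expand e v k)"
  by (induction k arbitrary: w v) (auto intro: moves_append list_all2_appendI)

lemma code_expand: "code e r (A @ w # B) \<Longrightarrow> code e r (A @ expand e w k @ B)"
proof (induction k arbitrary: A w B)
  case (Suc k)
  have "code e r (A @ (w @ [\<not> e]) # (w @ [e]) # B)" by (rule split[OF Suc.prems])
  from Suc.IH[OF this] have "code e r ((A @ expand e (w @ [\<not> e]) k) @ (w @ [e]) # B)" by simp
  from Suc.IH[OF this] show ?case by simp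
qed simp

text \<open>
  Codes can be refined to a different depth in each cone; this is used to make target cones uniform.
\<close>

lemma code_expand_each:
  "code e r (A @ D) \<Longrightarrow> code e r (A @ concat (map (\<lambda>w. expand e w (k w)) D))"
proof (induction D arbitrary: A)
  case (Cons w D)
  from code_expand[OF Cons.prems] have "code e r ((A @ expand e w (k w)) @ D)" by simp
  from Cons.IH[OF this] show ?case by simp
qed simp

lemma code_uniform: "code e r (expand e r k)"
  using code_expand[of e r "[]" r "[]" k] root by simp

lemma list_all2_moves_concat:
  "(\<And>w. w \<in> set D \<Longrightarrow> moves f w (g w)) \<Longrightarrow>
    list_all2 (moves f) (concat (map (\<lambda>w. expand e w (k w)) D))
      (concat (map (\<lambda>w. expand e (g w) (k w)) D))"
  by (induction D) (auto intro: moves_expand list_all2_appendI)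

section \<open>Generating V by swaps\<close>

locale map_group =
  fixes H :: "(cantor \<Rightarrow> cantor) set"
  assumes bij: "f \<in> H \<Longrightarrow> bij f"
    and id_closed: "id \<in> H"
    and comp_closed: "f \<in> H \<Longrightarrow> g \<in> H \<Longrightarrow> f \<circ> g \<in> H"
    and inverse_closed: "f \<in> H \<Longrightarrow> inverse_map f \<in> H"
begin

lemma swap_conjugate_closed:
  assumes "h \<in> H" "moves h u u'" "moves h v v'" "swap u' v' \<in> H" "disjoint_cones u v"
  shows "swap u v \<in> H"
proof -
  have d: "disjoint_cones u' v'" using disjoint_cones_moves assms bij by blast
  have "inverse_map h \<circ> swap u' v' \<circ> inverse_map (inverse_map h) = swap u v"
    using assms d bij by (intro swap_conjugate moves_inverse bij_imp_bij_inv) auto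
  then show ?thesis using assms by (metis comp_closed inverse_closed)
qed

end

interpretation VA: map_group VA
  by unfold_locales (auto simp: VA_bij VA_comp VA_inverse V_subset_VA V_id)

lemma list_all2_moves_refl: "f = id \<Longrightarrow> list_all2 (moves f) D D"
  by (simp add: list_all2_same)

lemma list_all2_moves_comp:
  "list_all2 (moves f) D E \<Longrightarrow> list_all2 (moves g) E F \<Longrightarrow> list_all2 (moves (g \<circ> f)) D F"
  by (rule list_all2_trans[of "moves f" "moves g"]) (auto intro: moves_comp)

lemma list_all2_moves_inverse:
  "bij f \<Longrightarrow> list_all2 (moves f) D E \<Longrightarrow> list_all2 (moves (inverse_map f)) E D"
  by (rule list_all2_all_nthI) (auto simp: list_all2_conv_all_nth intro: moves_inverse)

lemma list_all2_moves_split_iff: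
  assumes "length A = length A'"
  shows "list_all2 (moves f) (A @ (w @ [\<not> e]) # (w @ [e]) # B) (A' @ (v @ [\<not> e]) # (v @ [e]) # B') \<longleftrightarrow>
    list_all2 (moves f) (A @ w # B) (A' @ v # B')"
  using assms moves_split_iff[of f w v e] by (auto simp: list_all2_append)

locale swap_group = map_group +
  assumes swap_closed: "disjoint_cones u v \<Longrightarrow> swap u v \<in> H"
begin

text \<open>
  Selection sort: a swap brings the required word to the next position and fixes the cones of all
  other words.
\<close>

lemma moves_permutation:
  "\<lbrakk>sorted_wrt disjoint_cones (A @ B); mset B = mset B'\<rbrakk> \<Longrightarrow>
    \<exists>h\<in>H. list_all2 (moves h) (A @ B) (A @ B')"
proof (induction B arbitrary: A B')
  case Nil
  then show ?case using id_closed list_all2_moves_refl[of id A] by auto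
next
  case (Cons w B)
  have "w \<in># mset B'" using Cons.prems(2) by (metis list.set_intros(1) set_mset_mset)
  then have "w \<in> set B'" by simp
  then obtain C D where B': "B' = C @ w # D" by (meson split_list)
  show ?case
  proof (cases C)
    case Nil
    have "mset B = mset D" using Cons.prems(2) B' Nil by simp
    then show ?thesis using Cons.IH[of "A @ [w]" D] Cons.prems(1) B' Nil by simp
  next
    case (Cons v C')
    note C = this
    have m: "mset B = mset (C' @ v # D)" using Cons.prems(2) B' C by simp
    then obtain h where h: "h \<in> H" "list_all2 (moves h) (A @ w # B) (A @ w # C' @ v # D)"
      using Cons.IH[of "A @ [w]" "C' @ v # D"] Cons.prems(1) by auto
    have dis: "disjoint_cones x y" if "x \<in> set A \<and> y \<in> set (w # C' @ v # D) \<or>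
        x = w \<and> y \<in> set (C' @ v # D)" for x y
      using Cons.prems(1) that mset_eq_setD[OF m] by (auto simp: sorted_wrt_append)
    have "disjoint_cones y v" if "y \<in> set C' \<or> y \<in> set D" for y
    proof -
      have "sorted_wrt disjoint_cones B" using Cons.prems(1) by (simp add: sorted_wrt_append)
      then have *: "\<And>i j. i < j \<Longrightarrow> j < length B \<Longrightarrow> disjoint_cones (B ! i) (B ! j)"
        by (rule sorted_wrt_nth_less)
      have "distinct B" using sorted_disjoint_distinct \<open>sorted_wrt disjoint_cones B\<close> .
      then have "distinct (C' @ v # D)" using m by (metis mset_eq_imp_distinct_iff)
      then have "y \<noteq> v" using that by auto
      moreover have "y \<in> set B" "v \<in> set B" using that mset_eq_setD[OF m] by auto
      ultimately show ?thesis
        using * disjoint_cones_sym by (metis in_set_conv_nth linorder_neqE_nat)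
    qed
    then have "list_all2 (moves (swap w v)) (A @ w # C' @ v # D) (A @ v # C' @ w # D)"
      using dis moves_swap_left[of w v] moves_swap_right[of w v] disjoint_cones_sym
      by (auto simp: list_all2_append list_all2_same intro!: moves_swap_other)
    then have "list_all2 (moves (swap w v \<circ> h)) (A @ w # B) (A @ v # C' @ w # D)"
      using h(2) list_all2_moves_comp by blast
    moreover have "swap w v \<circ> h \<in> H"
      using h(1) dis[of w v] by (intro comp_closed swap_closed) auto
    ultimately show ?thesis using B' C by auto
  qed
qed

text \<open>
  Both codes contain a split cone. After a permutation of the second code the two split cones
  correspond, and undoing both splits reduces the length.
\<close>

lemma codes_related:
  "code e r D \<Longrightarrow> code e r E \<Longrightarrow> length D = length E \<Longrightarrow> \<exists>h\<in>H. list_all2 (moves h) D E"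
proof (induction arbitrary: E rule: code.induct)
  case root
  then have "E = [r]" by (auto elim: code.cases)
  then show ?case by (intro bexI[of _ id]) (simp_all add: id_closed)
next
  case (split A w B)
  from split.prems obtain A' v B' where E: "E = A' @ (v @ [\<not> e]) # (v @ [e]) # B'"
    "code e r (A' @ v # B')"
    by (auto elim: code.cases)
  define R where "R = A' @ B'"
  define F where "F v' = take (length A) R @ v' @ drop (length A) R" for v' :: "bool list list"
  have len: "length A + length B = length R" using split.prems(2) E(1) R_def by simp
  have "mset (take (length A) R) + mset (drop (length A) R) = mset R"
    unfolding mset_append[symmetric] by simp
  then have mF: "mset (F v') = mset v' + mset R" for v'
    unfolding F_def by (simp add: union_ac)
  obtain h where h: "h \<in> H" "list_all2 (moves h) (A @ w # B) (A' @ v # B')"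
    using split.IH[OF E(2)] split.prems(2) E(1) by auto
  have s: "sorted_wrt disjoint_cones (A' @ v # B')" "sorted_wrt disjoint_cones E"
    using code_disjoint[OF E(2)] code_disjoint[OF split.prems(1)] .
  obtain k where k: "k \<in> H" "list_all2 (moves k) (A' @ v # B') (F [v])"
    using moves_permutation[of "[]" "A' @ v # B'" "F [v]"] s mF R_def by auto
  obtain l where l: "l \<in> H" "list_all2 (moves l) E (F [v @ [\<not> e], v @ [e]])"
    using moves_permutation[of "[]" E "F [v @ [\<not> e], v @ [e]]"] s mF R_def E(1) by auto
  have "list_all2 (moves (k \<circ> h)) (A @ w # B) (F [v])"
    using h(2) k(2) list_all2_moves_comp by blast
  then have "list_all2 (moves (k \<circ> h)) (A @ (w @ [\<not> e]) # (w @ [e]) # B) (F [v @ [\<not> e], v @ [e]])"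
    using list_all2_moves_split_iff[of A "take (length A) R" "k \<circ> h" w e B v "drop (length A) R"]
      len unfolding F_def by simp
  then have "list_all2 (moves (inverse_map l \<circ> (k \<circ> h))) (A @ (w @ [\<not> e]) # (w @ [e]) # B) E"
    using list_all2_moves_comp list_all2_moves_inverse[OF bij[OF l(1)] l(2)] by blast
  moreover have "inverse_map l \<circ> (k \<circ> h) \<in> H" using h k l comp_closed inverse_closed by simp
  ultimately show ?case by blast
qed

text \<open>
  An element of V takes the cones of a code to disjoint cones that cover everything. When the code
  is refined until all target cones have the same length, the targets form a uniform code.
\<close>

lemma V_subset: "V \<subseteq> H"
proof
  fix f assume f: "f \<in> V"
  have mono: "\<exists>v. moves f (w @ s) v" if "\<exists>v. moves f w v" for w s
    using that moves_append by blast
  obtain N where N: "\<And>w. length w = N \<Longrightarrow> \<exists>v. moves f w v"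
    using uniform_depth[of "\<lambda>w. \<exists>v. moves f w v", OF mono] f
    unfolding V_iff locally_prefix_def by metis
  then obtain g where g: "\<And>w. length w = N \<Longrightarrow> moves f w (g w)" by metis
  define U where "U = expand False [] N"
  have U: "w \<in> set U \<longleftrightarrow> length w = N" for w unfolding U_def set_expand by auto
  define M where "M = Max (length ` g ` set U)"
  have M: "length (g w) \<le> M" if "w \<in> set U" for w
    unfolding M_def using that by (intro Max_ge) auto
  define D where "D = concat (map (\<lambda>w. expand False w (M - length (g w))) U)"
  define E where "E = concat (map (\<lambda>w. expand False (g w) (M - length (g w))) U)"
  have codeD: "code False [] D"
    unfolding D_def using code_expand_each[of False "[]" "[]" U] code_uniform U_def by simp
  have DE: "list_all2 (moves f) D E"
    unfolding D_def E_def by (rule list_all2_moves_concat) (use g U in blast)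
  have bf: "bij f" using f by (rule V_bij)
  have "sorted_wrt disjoint_cones D"
    using codeD by (rule code_disjoint)
  then have sE: "sorted_wrt disjoint_cones E"
    using DE disjoint_cones_moves[OF bf]
    unfolding sorted_wrt_iff_nth_less list_all2_conv_all_nth by (metis order.strict_trans)
  then have dE: "distinct E" by (rule sorted_disjoint_distinct)
  have lE: "length v = M" if "v \<in> set E" for v
    using that M unfolding E_def by (auto simp: set_expand)
  have "set E = set (expand False [] M)"
  proof (intro Set.set_eqI iffI)
    fix u assume "u \<in> set (expand False [] M)"
    then have u: "length u = M" by (simp add: set_expand)
    obtain x where x: "f x = u \<frown> (\<lambda>_. False)" using bf by (metis bij_pointE)
    obtain w y where w: "w \<in> set D" "x = w \<frown> y" using code_complete[OF codeD, of x] by auto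
    then obtain v where v: "v \<in> set E" "moves f w v"
      using DE by (metis in_set_conv_nth list_all2_conv_all_nth)
    have "v \<frown> y = u \<frown> (\<lambda>_. False)" using movesD[OF v(2)] w(2) x by simp
    then have "v = u"
      using arg_cong[of _ _ "prefix M"] lE[OF v(1)] u prefix_length_conc by metis
    then show "u \<in> set E" using v(1) by simp
  qed (use lE in \<open>auto simp: set_expand\<close>)
  moreover have "distinct (expand False [] M)"
    by (intro sorted_disjoint_distinct code_disjoint[OF code_uniform])
  ultimately have "mset E = mset (expand False [] M)"
    using dE set_eq_iff_mset_eq_distinct by blast
  then have "length D = length (expand False [] M)"
    using DE by (metis list_all2_lengthD mset_eq_length)
  then obtain h where h: "h \<in> H" "list_all2 (moves h) D (expand False [] M)"
    using codes_related[OF codeD code_uniform] by blast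
  obtain k where k: "k \<in> H" "list_all2 (moves k) E (expand False [] M)"
    using moves_permutation[of "[]" E] sE \<open>mset E = _\<close> by auto
  define l where "l = inverse_map k \<circ> h"
  have l: "l \<in> H" "list_all2 (moves l) D E"
    unfolding l_def using h k comp_closed inverse_closed
      list_all2_moves_comp list_all2_moves_inverse bij by blast+
  have "f x = l x" for x
  proof -
    obtain w y where w: "w \<in> set D" "x = w \<frown> y" using code_complete[OF codeD, of x] by auto
    then obtain v where v: "moves f w v" "moves l w v"
      using DE l(2) by (metis in_set_conv_nth list_all2_conv_all_nth)
    then show ?thesis using w(2) by (simp add: movesD)
  qed
  then show "f \<in> H" using l(1) by (metis ext)
qed

end

section \<open>Swaps from a partition into at least three cones\<close>

lemma swap_eq_split:
  assumes d: "disjoint_cones u v"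
  shows "swap u v = swap (u @ [True]) (v @ [True]) \<circ> swap (u @ [False]) (v @ [False])"
proof
  fix x :: cantor
  have d': "disjoint_cones (u @ [a]) (v @ [b])" for a b
    using d by (intro disjoint_cones_appendL disjoint_cones_appendR)
  have o: "moves (swap (u @ [True]) (v @ [True])) (w @ [False]) (w @ [False])"
    "moves (swap (u @ [False]) (v @ [False])) (w @ [True]) (w @ [True])" if "w = u \<or> w = v" for w
    using that d' disjoint_cones_sym[OF d'] by (auto intro!: moves_swap_other)
  consider y where "x = u \<frown> y" | y where "x = v \<frown> y" | "x \<notin> range ((\<frown>) u)" "x \<notin> range ((\<frown>) v)"
    by blast
  then show "swap u v x = (swap (u @ [True]) (v @ [True]) \<circ> swap (u @ [False]) (v @ [False])) x"
  proof cases
    case (1 y)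
    obtain a and z :: cantor where y: "y = [a] \<frown> z" by (rule word_Cons_cases)
    show ?thesis
      using swap_left[OF d, of y] swap_left[OF d', where x = z] movesD[OF o(1), of v z] movesD[OF o(2), of u z]
      unfolding 1 y by (cases a) simp_all
  next
    case (2 y)
    obtain a and z :: cantor where y: "y = [a] \<frown> z" by (rule word_Cons_cases)
    show ?thesis
      using swap_right[OF d, of y] swap_right[OF d', where x = z] movesD[OF o(1), of u z] movesD[OF o(2), of v z]
      unfolding 2 y by (cases a) simp_all
  next
    case 3
    then have "x \<notin> range ((\<frown>) (u @ [a]))" "x \<notin> range ((\<frown>) (v @ [a]))" for a
      by (auto simp flip: conc_conc)
    then show ?thesis using 3 by (simp add: swap_other)
  qed
qed

text \<open>
  A swap of two cones inside cells is conjugate, by a swap of a half of one cell with a whole cell,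
  to a swap of two cones of smaller depth. A third cell makes this possible.
\<close>

lemma (in map_group) swaps_from_cells:
  fixes ws :: "bool list list"
  assumes len: "length ws \<ge> 3"
    and complete: "\<And>x :: cantor. \<exists>i < length ws. \<exists>y. x = ws ! i \<frown> y"
    and disj: "\<And>i j. \<lbrakk>i < length ws; j < length ws; i \<noteq> j\<rbrakk> \<Longrightarrow> disjoint_cones (ws ! i) (ws ! j)"
    and cells: "\<And>i j. \<lbrakk>i < length ws; j < length ws; i \<noteq> j\<rbrakk> \<Longrightarrow> swap (ws ! i) (ws ! j) \<in> H"
    and halves: "\<And>i j d. \<lbrakk>i < length ws; j < length ws; i \<noteq> j\<rbrakk> \<Longrightarrow> swap (ws ! i) (ws ! j @ [d]) \<in> H"
    and uv: "disjoint_cones u v"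
  shows "swap u v \<in> H"
proof -
  have third: "\<exists>k < length ws. k \<noteq> i \<and> k \<noteq> j" for i j
  proof -
    have "(0 \<noteq> i \<and> 0 \<noteq> j) \<or> (1 \<noteq> i \<and> 1 \<noteq> j) \<or> (2 \<noteq> i \<and> 2 \<noteq> j)" by arith
    then consider "0 \<noteq> i \<and> 0 \<noteq> j" | "1 \<noteq> i \<and> 1 \<noteq> j" | "2 \<noteq> i \<and> 2 \<noteq> j" by blast
    then show ?thesis
    proof cases
      case 1
      then show ?thesis using len by (intro exI[of _ 0]) auto
    next
      case 2
      then show ?thesis using len by (intro exI[of _ 1]) auto
    next
      case 3
      then show ?thesis using len by (intro exI[of _ 2]) auto
    qed
  qed
  have inside: "swap (ws ! i @ x) (ws ! j @ y) \<in> H"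
    if "i < length ws" "j < length ws" "disjoint_cones (ws ! i @ x) (ws ! j @ y)" for i j x y
    using that
  proof (induction "length x + length y" arbitrary: i j x y rule: less_induct)
    case less
    have reduce: "swap (ws ! i @ d # x') (ws ! j @ y) \<in> H"
      if ij: "i < length ws" "j < length ws" and d: "disjoint_cones (ws ! i @ d # x') (ws ! j @ y)"
        and l: "Suc (length x' + length y) = length x0 + length y0" 
        and IH: "\<And>i j x y. \<lbrakk>length x + length y < length x0 + length y0; i < length ws; j < length ws;
          disjoint_cones (ws ! i @ x) (ws ! j @ y)\<rbrakk> \<Longrightarrow> swap (ws ! i @ x) (ws ! j @ y) \<in> H"
      for i j d x' y and x0 y0 :: "bool list"
    proof -
      obtain k where k: "k < length ws" "k \<noteq> i" "k \<noteq> j" using third by blast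
      let ?h = "swap (ws ! k) (ws ! i @ [d])"
      have hd: "disjoint_cones (ws ! k) (ws ! i @ [d])"
        using disj k ij by (intro disjoint_cones_appendR)
      have h: "?h \<in> H" using halves k ij by blast
      have hu: "moves ?h (ws ! i @ d # x') (ws ! k @ x')"
        using moves_append[OF moves_swap_right[OF hd], of x'] by simp
      show ?thesis
      proof (cases "i = j \<and> (\<exists>y'. y = d # y')")
        case True
        then obtain y' where y: "i = j" "y = d # y'" by blast
        have hv: "moves ?h (ws ! j @ y) (ws ! k @ y')"
          using moves_append[OF moves_swap_right[OF hd], of y'] y by simp
        have "swap (ws ! k @ x') (ws ! k @ y') \<in> H"
          using IH[of x' y' k k] l d k y by simp
        then show ?thesis using swap_conjugate_closed[OF h hu hv _ d] by blast
      next
        case False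
        have "disjoint_cones (ws ! i @ [d]) (ws ! j @ y)"
        proof (cases "i = j")
          case True
          then show ?thesis
            using False d disjoint_cones_append[of "ws ! j" "d # x'" "[]"] by (cases y) auto
        next
          case False
          then show ?thesis using disj ij by (intro disjoint_cones_appendL disjoint_cones_appendR)
        qed
        moreover have "disjoint_cones (ws ! k) (ws ! j @ y)"
          using disj k ij by (intro disjoint_cones_appendR)
        ultimately have hv: "moves ?h (ws ! j @ y) (ws ! j @ y)" by (rule moves_swap_other[rotated])
        have "disjoint_cones (ws ! k @ x') (ws ! j @ y)"
          using disjoint_cones_moves[OF bij[OF h] hu hv d] .
        then have "swap (ws ! k @ x') (ws ! j @ y) \<in> H" using IH[of x' y k j] l k ij by simp
        then show ?thesis using swap_conjugate_closed[OF h hu hv _ d] by blast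
      qed
    qed
    show ?case
    proof (cases x)
      case (Cons d x')
      then show ?thesis using reduce[of i j d x' y x y] less by simp
    next
      case Nil
      show ?thesis
      proof (cases y)
        case (Cons d y')
        then have "swap (ws ! j @ y) (ws ! i @ x) \<in> H"
          using reduce[of j i d y' x x y] less disjoint_cones_sym by simp
        then show ?thesis using less.prems(3) swap_commute by metis
      next
        case Nil
        have "i \<noteq> j" using less.prems(3) \<open>x = []\<close> Nil by (auto simp: disjoint_cones_def)
        then show ?thesis using cells less.prems \<open>x = []\<close> Nil by simp
      qed
    qed
  qed
  obtain M where M: "\<And>i. i < length ws \<Longrightarrow> length (ws ! i) \<le> M"
    using finite_maxlen[of "set ws"] by (metis finite_set less_imp_le nth_mem)
  have deep: "\<exists>i < length ws. \<exists>x. w = ws ! i @ x" if w: "length w \<ge> M" for w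
  proof -
    obtain i y where i: "i < length ws" "w \<frown> (\<lambda>_. False) = ws ! i \<frown> y" using complete by blast
    have "length (ws ! i) \<le> length w" using M[OF i(1)] w by simp
    then obtain s where "w = ws ! i @ s" by (rule conc_eq_longer[OF i(2)[symmetric]])
    then show ?thesis using i(1) by blast
  qed
  have "swap u v \<in> H" if "disjoint_cones u v" "length u + n \<ge> M" "length v + n \<ge> M" for u v n
    using that
  proof (induction n arbitrary: u v)
    case 0
    obtain i x where "i < length ws" "u = ws ! i @ x" using deep[of u] 0 by auto
    moreover obtain j y where "j < length ws" "v = ws ! j @ y" using deep[of v] 0 by auto
    ultimately show ?case using inside 0 by blast
  next
    case (Suc n)
    have "swap (u @ [a]) (v @ [a]) \<in> H" for a
      using Suc.prems by (intro Suc.IH disjoint_cones_appendL disjoint_cones_appendR) auto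
    then show ?case unfolding swap_eq_split[OF Suc.prems(1)] by (intro comp_closed)
  qed
  from this[OF uv, of M] show ?thesis by simp
qed

section \<open>A cyclic permutation of cones\<close>

text \<open>
  A partition into the cones of \<open>0, 10, 110, \<dots>\<close> and the remaining cone of \<open>1\<^sup>m\<^sup>-\<^sup>1\<close>. The first two
  cells are the same for all \<open>m \<ge> 3\<close>, so that elements supported on them can be fixed before \<open>m\<close>.
\<close>

definition cell :: "nat \<Rightarrow> nat \<Rightarrow> bool list" where
  "cell m i = replicate i True @ (if Suc i < m then [False] else [])"

definition cell_index :: "nat \<Rightarrow> cantor \<Rightarrow> nat" where
  "cell_index m x = (LEAST i. Suc i = m \<or> \<not> x i)"

definition rotation :: "nat \<Rightarrow> cantor \<Rightarrow> cantor" where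
  "rotation m x = cell m (Suc (cell_index m x) mod m) \<frown> suffix (length (cell m (cell_index m x))) x"

lemma cell_index_cell: "i < m \<Longrightarrow> cell_index m (cell m i \<frown> x) = i"
  unfolding cell_index_def
proof (rule Least_equality)
  assume i: "i < m"
  then show "Suc i = m \<or> \<not> (cell m i \<frown> x) i"
    by (cases "Suc i < m") (auto simp: cell_def conc_def nth_append)
  fix j assume j: "Suc j = m \<or> \<not> (cell m i \<frown> x) j"
  show "i \<le> j"
  proof (rule ccontr)
    assume "\<not> i \<le> j"
    then show False using j i by (auto simp: cell_def conc_def nth_append)
  qed
qed

lemma cell_complete:
  assumes "m > 0"
  obtains i y where "i < m" "x = cell m i \<frown> y"
proof -
  let ?P = "\<lambda>i. Suc i = m \<or> \<not> x i"
  define i where "i = cell_index m x"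
  have "?P (m - 1)" using assms by simp
  then have i: "?P i" "i \<le> m - 1" "\<And>j. j < i \<Longrightarrow> x j"
    unfolding i_def cell_index_def using LeastI Least_le not_less_Least by (metis (mono_tags, lifting))+
  have "x = cell m i \<frown> suffix (length (cell m i)) x"
  proof
    fix k
    show "x k = (cell m i \<frown> suffix (length (cell m i)) x) k"
      using i by (auto simp: cell_def conc_def nth_append less_Suc_eq)
  qed
  moreover have "i < m" using i(2) assms by simp
  ultimately show thesis using that by blast
qed

lemma cell_disjoint:
  assumes "i < m" "j < m" "i \<noteq> j"
  shows "disjoint_cones (cell m i) (cell m j)"
  unfolding disjoint_cones_def using cell_index_cell assms by metis

lemma cell_index_less: "m > 0 \<Longrightarrow> cell_index m x < m"
  by (metis cell_complete cell_index_cell)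

lemma moves_rotation: "i < m \<Longrightarrow> moves (rotation m) (cell m i) (cell m (Suc i mod m))"
  unfolding moves_def rotation_def by (simp add: cell_index_cell)

lemma cell_index_rotation: "m > 0 \<Longrightarrow> cell_index m (rotation m x) = Suc (cell_index m x) mod m"
  unfolding rotation_def by (simp add: cell_index_cell)

lemma rotation_in_V:
  assumes m: "m > 0"
  shows "rotation m \<in> V"
proof -
  have "inj (rotation m)"
  proof (rule injI)
    fix x x'
    assume eq: "rotation m x = rotation m x'"
    obtain i y where x: "i < m" "x = cell m i \<frown> y" using cell_complete[OF m] by metis
    obtain j z where x': "j < m" "x' = cell m j \<frown> z" using cell_complete[OF m] by metis
    have "Suc i mod m = Suc j mod m"
      using arg_cong[OF eq, of "cell_index m"] m x x' by (simp add: cell_index_rotation cell_index_cell)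
    then have "i = j"
      using x(1) x'(1) by (metis Suc_lessI mod_Suc mod_less nat.inject mod_self zero_less_Suc nat.distinct(1))
    then show "x = x'"
      using eq movesD[OF moves_rotation[OF x(1)]] x x' by simp
  qed
  moreover have "surj (rotation m)"
    unfolding surj_def
  proof
    fix y
    obtain j z where y: "j < m" "y = cell m j \<frown> z" using cell_complete[OF m] by metis
    have "\<exists>i < m. j = Suc i mod m"
    proof (cases j)
      case 0
      then show ?thesis using m by (intro exI[of _ "m - 1"]) simp
    next
      case (Suc i)
      then show ?thesis using y(1) by (intro exI[of _ i]) simp
    qed
    then obtain i where i: "i < m" "j = Suc i mod m" by blast
    then have "y = rotation m (cell m i \<frown> z)" using y(2) movesD[OF moves_rotation] by simp
    then show "\<exists>x. y = rotation m x" by blast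
  qed
  moreover have "locally_prefix (rotation m) p" for p
    using cell_complete[OF m, of p] locally_prefixI moves_rotation by metis
  ultimately show ?thesis unfolding V_iff bij_def by blast
qed

text \<open>
  Three swaps near the first two cells, together with the rotation of all cells, generate all
  swaps: conjugation by the rotation and by swaps of cells reaches all pairs of cells.
\<close>

lemma (in map_group) V_subset_from_cells:
  assumes m: "m \<ge> 3" and rot: "rotation m \<in> H"
    and s1: "swap [False] [True, False] \<in> H"
    and s2: "swap [False] [True, False, False] \<in> H"
    and s3: "swap [True, False, False] [True, False, True] \<in> H"
  shows "V \<subseteq> H"
proof -
  have c01: "cell m 0 = [False]" "cell m 1 = [True, False]" using m by (auto simp: cell_def)
  have dis: "\<And>i j. i < m \<Longrightarrow> j < m \<Longrightarrow> i \<noteq> j \<Longrightarrow> disjoint_cones (cell m i) (cell m j)"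
    by (rule cell_disjoint)
  have adj: "swap (cell m i) (cell m (Suc i)) \<in> H" if "Suc i < m" for i
    using that
  proof (induction i)
    case 0
    then show ?case using s1 c01 by simp
  next
    case (Suc i)
    have "moves (inverse_map (rotation m)) (cell m (Suc (Suc i))) (cell m (Suc i))"
      "moves (inverse_map (rotation m)) (cell m (Suc i)) (cell m i)"
      using moves_inverse[OF bij[OF rot] moves_rotation[of i m]]
        moves_inverse[OF bij[OF rot] moves_rotation[of "Suc i" m]] Suc.prems by simp_all
    then show ?case
      using swap_conjugate_closed[OF inverse_closed[OF rot]] Suc dis by simp
  qed
  have cells_less: "swap (cell m i) (cell m j) \<in> H" if "i < j" "j < m" for i j
    using that
  proof (induction j)
    case (Suc j)
    show ?case
    proof (cases "i = j")
      case True
      then show ?thesis using adj Suc.prems by simp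
    next
      case False
      let ?h = "swap (cell m j) (cell m (Suc j))"
      have "moves ?h (cell m i) (cell m i)"
        using dis Suc.prems False by (intro moves_swap_other) auto
      moreover have "moves ?h (cell m (Suc j)) (cell m j)"
        using dis Suc.prems by (intro moves_swap_right) auto
      ultimately show ?thesis
        using swap_conjugate_closed[of ?h "cell m i" "cell m i" "cell m (Suc j)" "cell m j"]
          Suc adj dis False by simp
    qed
  qed simp
  have cells: "swap (cell m i) (cell m j) \<in> H" if "i < m" "j < m" "i \<noteq> j" for i j
    using cells_less[of i j] cells_less[of j i] that swap_commute[OF dis[of i j]]
    by (cases "i < j") auto
  have to01: "\<exists>h\<in>H. moves h (cell m i) (cell m 0) \<and> moves h (cell m j) (cell m 1)"
    if ij: "i < m" "j < m" "i \<noteq> j" for i j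
  proof -
    define h1 where "h1 = (if i = 0 then id else swap (cell m i) (cell m 0))"
    define j' where "j' = (if i \<noteq> 0 \<and> j = 0 then i else j)"
    have j': "j' < m" "j' \<noteq> 0" using ij unfolding j'_def by auto
    define h2 where "h2 = (if j' = 1 then id else swap (cell m j') (cell m 1))"
    have "h1 \<in> H" unfolding h1_def using cells[of i 0] ij m id_closed by simp
    moreover have "h2 \<in> H" unfolding h2_def using cells[of j' 1] j' m id_closed by simp
    moreover have "moves h1 (cell m i) (cell m 0)"
      unfolding h1_def using moves_swap_left[OF dis[of i 0]] ij m by auto
    moreover have "moves h1 (cell m j) (cell m j')"
      unfolding h1_def j'_def
      using moves_swap_right[OF dis[of i 0]] moves_swap_other[OF dis[of i j] dis[of 0 j]] ij m by auto
    moreover have "moves h2 (cell m 0) (cell m 0)"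
      unfolding h2_def using moves_swap_other[OF dis[of j' 0] dis[of 1 0]] j' m by auto
    moreover have "moves h2 (cell m j') (cell m 1)"
      unfolding h2_def using moves_swap_left[OF dis[of j' 1]] j' m by auto
    ultimately show ?thesis using moves_comp comp_closed by blast
  qed
  have half01: "swap (cell m 0) (cell m 1 @ [d]) \<in> H" for d
  proof (cases d)
    case True
    let ?h = "swap [True, False, False] [True, False, True]"
    have "moves ?h [False] [False]" by (intro moves_swap_other) auto
    moreover have "moves ?h [True, False, True] [True, False, False]" by (intro moves_swap_right) auto
    ultimately show ?thesis
      using swap_conjugate_closed[OF s3 _ _ s2] True c01 by simp
  next
    case False
    then show ?thesis using s2 c01 by simp
  qed
  have halves: "swap (cell m i) (cell m j @ [d]) \<in> H" if ij: "i < m" "j < m" "i \<noteq> j" for i j d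
  proof -
    obtain h where h: "h \<in> H" "moves h (cell m i) (cell m 0)" "moves h (cell m j) (cell m 1)"
      using to01[OF ij] by blast
    show ?thesis
      using swap_conjugate_closed[OF h(1,2) moves_append[OF h(3)] half01]
        disjoint_cones_appendR[OF dis[OF ij]] by blast
  qed
  have "swap_group H"
  proof
    fix u v assume "disjoint_cones u v"
    moreover have "\<exists>i < length (map (cell m) [0..<m]). \<exists>y. x = map (cell m) [0..<m] ! i \<frown> y" for x
    proof -
      obtain i y where "i < m" "x = cell m i \<frown> y" using m by (rule_tac cell_complete[of m x]) auto
      then show ?thesis by (intro exI[of _ i]) auto
    qed
    ultimately show "swap u v \<in> H"
      using m cells halves dis by (intro swaps_from_cells[of "map (cell m) [0..<m]" u v]) simp_all
  qed
  then show ?thesis by (rule swap_group.V_subset)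
qed

section \<open>Two elements that generate many commutators\<close>

abbreviation commutator :: "(cantor \<Rightarrow> cantor) \<Rightarrow> (cantor \<Rightarrow> cantor) \<Rightarrow> cantor \<Rightarrow> cantor" where
  "commutator f g \<equiv> f \<circ> g \<circ> inverse_map f \<circ> inverse_map g"

lemma (in map_group) commutator_closed: "f \<in> H \<Longrightarrow> g \<in> H \<Longrightarrow> commutator f g \<in> H"
  by (intro comp_closed inverse_closed)

lemma commutator_apply: "bij f \<Longrightarrow> bij g \<Longrightarrow> commutator f g (g (f x)) = f (g x)"
  by (simp add: bij_def)

lemma commutator_unique:
  assumes "bij p" "bij q" and "\<And>x. k (q (p x)) = p (q x)"
  shows "commutator p q = k"
proof
  fix y
  have "y = q (p (inverse_map p (inverse_map q y)))"
    using assms by (simp add: inverse_map_apply)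
  then show "commutator p q y = k y" using assms(3)[of "inverse_map p (inverse_map q y)"] by simp
qed

text \<open>
  If the supports of \<open>p\<close> and \<open>q\<close> meet only in \<open>S\<close>, the parts of \<open>p\<close> and \<open>q\<close> outside \<open>S\<close> cancel in the
  commutator.
\<close>

lemma commutator_overlap:
  assumes bij: "bij p" "bij q" "bij f" "bij g"
    and on_S: "\<And>x. x \<in> S \<Longrightarrow> p x = f x" "\<And>x. x \<in> S \<Longrightarrow> q x = g x"
    and S: "\<And>x. x \<in> S \<Longrightarrow> f x \<in> S" "\<And>x. x \<in> S \<Longrightarrow> g x \<in> S"
    and off_S: "\<And>x. x \<notin> S \<Longrightarrow> f x = x" "\<And>x. x \<notin> S \<Longrightarrow> g x = x"
    and R: "\<And>x. x \<in> R \<Longrightarrow> p x \<in> R" "\<And>x. x \<in> R' \<Longrightarrow> q x \<in> R'"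
    and off_R: "\<And>x. x \<notin> S \<Longrightarrow> x \<notin> R \<Longrightarrow> p x = x" "\<And>x. x \<notin> S \<Longrightarrow> x \<notin> R' \<Longrightarrow> q x = x"
    and disj: "R \<inter> S = {}" "R' \<inter> S = {}" "R \<inter> R' = {}"
  shows "commutator p q = commutator f g"
proof (rule commutator_unique[OF bij(1,2)])
  have k_off: "commutator f g x = x" if "x \<notin> S" for x
  proof -
    have "inverse_map f x = x" "inverse_map g x = x"
      using off_S[OF that] bij by (metis bij_inv_eq_iff)+
    then show ?thesis using off_S[OF that] by simp
  qed
  fix x
  show "commutator f g (q (p x)) = p (q x)"
  proof (cases "x \<in> S")
    case True
    then show ?thesis
      using on_S S commutator_apply[OF bij(3,4), of x] by simp
  next
    case nS: False
    show ?thesis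
    proof (cases "x \<in> R")
      case True
      then have "p x \<in> R" using R by blast
      then have "p x \<notin> S" "q (p x) = p x" "q x = x" using disj True off_R nS by blast+
      then show ?thesis using k_off by simp
    next
      case False
      then have px: "p x = x" using off_R nS by blast
      have "q x \<notin> S \<and> q x \<notin> R"
        using R(2)[of x] off_R(2)[of x] nS disj False by (cases "x \<in> R'") auto
      then show ?thesis using px k_off off_R(1) by simp
    qed
  qed
qed

text \<open>
  The powers of 4 form a Sidon set. This is the reason for the positions used below.
\<close>

lemma sum_powers_of_4_unique:
  assumes "(4::nat) ^ a + 4 ^ b = 4 ^ c + 4 ^ d"
  shows "a = c \<and> b = d \<or> a = d \<and> b = c"
proof -
  have *: "a = c \<and> b = d" if "a \<le> b" "c \<le> d" "(4::nat) ^ a + 4 ^ b = 4 ^ c + 4 ^ d" for a b c d :: nat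
  proof -
    have le: "b \<le> d" if "a \<le> b" "c \<le> d" "(4::nat) ^ a + 4 ^ b = 4 ^ c + 4 ^ d" for a b c d :: nat
    proof (rule ccontr)
      assume "\<not> b \<le> d"
      then have "(4::nat) ^ Suc d \<le> 4 ^ b" by (intro power_increasing) auto
      moreover have "(4::nat) ^ c \<le> 4 ^ d" using that(2) by (intro power_increasing) auto
      moreover have "(4::nat) ^ a > 0" "(4::nat) ^ d > 0" by simp_all
      ultimately show False using that(3) unfolding power_Suc by linarith
    qed
    have "b = d" using le[OF that] le[OF that(2,1) that(3)[symmetric]] by simp
    then show ?thesis using that(3) by (simp add: power_inject_exp)
  qed
  show ?thesis
    using *[of a b c d] *[of b a c d] *[of a b d c] *[of b a d c] assms by (cases "a \<le> b"; cases "c \<le> d") auto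
qed

lemma foldr_disjoint_supports:
  assumes "\<And>i x. i \<in> set is \<Longrightarrow> x \<in> M i \<Longrightarrow> g i x \<in> M i"
    and "\<And>i x. i \<in> set is \<Longrightarrow> x \<notin> M i \<Longrightarrow> g i x = x"
    and "\<And>i j. i \<in> set is \<Longrightarrow> j \<in> set is \<Longrightarrow> i \<noteq> j \<Longrightarrow> M i \<inter> M j = {}" and "distinct is"
  shows "(\<forall>i\<in>set is. \<forall>x\<in>M i. foldr (\<lambda>i f. g i \<circ> f) is id x = g i x) \<and>
    (\<forall>x. (\<forall>i\<in>set is. x \<notin> M i) \<longrightarrow> foldr (\<lambda>i f. g i \<circ> f) is id x = x)"
  using assms
proof (induction "is")
  case (Cons j js)
  let ?f = "foldr (\<lambda>i f. g i \<circ> f) js id"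
  have IH: "\<And>i x. i \<in> set js \<Longrightarrow> x \<in> M i \<Longrightarrow> ?f x = g i x"
    "\<And>x. (\<forall>i\<in>set js. x \<notin> M i) \<Longrightarrow> ?f x = x"
  proof -
    have "(\<forall>i\<in>set js. \<forall>x\<in>M i. ?f x = g i x) \<and> (\<forall>x. (\<forall>i\<in>set js. x \<notin> M i) \<longrightarrow> ?f x = x)"
      by (rule Cons.IH) (use Cons.prems in auto)
    then show "\<And>i x. i \<in> set js \<Longrightarrow> x \<in> M i \<Longrightarrow> ?f x = g i x"
      "\<And>x. (\<forall>i\<in>set js. x \<notin> M i) \<Longrightarrow> ?f x = x" by blast+
  qed
  have "g j (?f x) = g i x" if "i \<in> set (j # js)" "x \<in> M i" for i x
  proof (cases "i = j")
    case True
    then have "\<forall>k\<in>set js. x \<notin> M k"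
      using that Cons.prems(3)[of j] Cons.prems(4) by fastforce
    then show ?thesis using IH(2) True by simp
  next
    case False
    then have i: "i \<in> set js" using that by simp
    have "g i x \<in> M i" using Cons.prems(1) that by blast
    then have "g i x \<notin> M j" using Cons.prems(3)[of i j] i False by auto
    then show ?thesis using IH(1)[OF i that(2)] Cons.prems(2)[of j] by simp
  qed
  moreover have "g j (?f x) = x" if "\<forall>i\<in>set (j # js). x \<notin> M i" for x
    using IH(2) that Cons.prems(2)[of j] by simp
  ultimately show ?case unfolding foldr.simps comp_apply by blast
qed simp

lemma cell_index_funpow: "m > 0 \<Longrightarrow> cell_index m ((rotation m ^^ n) x) = (cell_index m x + n) mod m"
  by (induction n) (auto simp: cell_index_rotation cell_index_less mod_Suc_eq)

lemma (in map_group) funpow_closed: "f \<in> H \<Longrightarrow> f ^^ n \<in> H"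
  by (induction n) (auto simp: id_closed comp_closed)

text \<open>
  The cones are arranged in a cycle of length \<open>m\<close>. A conjugate of each \<open>c i\<close>, moved from the first two
  cones by \<open>4\<^sup>i\<^sup>+\<^sup>1\<close> steps, is a factor of \<open>b\<close>. Differences of these positions determine the pair of
  positions, even up to an error of one step. Hence two conjugates of \<open>b\<close> that place \<open>c i\<close> and \<open>c j\<close>,
  respectively, on the first two cones have no other overlap of supports, and their commutator is
  that of \<open>c i\<close> and \<open>c j\<close>.
\<close>

lemma two_elements_generate_commutators:
  fixes c :: "nat \<Rightarrow> cantor \<Rightarrow> cantor"
  assumes c: "\<And>i. i < n \<Longrightarrow> c i \<in> VA"
    and supp: "\<And>i. i < n \<Longrightarrow> moves (c i) [True, True] [True, True]"
  obtains m b where "m \<ge> 3" "b \<in> VA"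
    "\<And>H i j. \<lbrakk>map_group H; rotation m \<in> H; b \<in> H; i < n; j < n; i \<noteq> j\<rbrakk> \<Longrightarrow> commutator (c i) (c j) \<in> H"
proof -
  define m :: nat where "m = 4 ^ (n + 1)"
  define pos :: "nat \<Rightarrow> nat" where "pos i = 4 ^ (i + 1)" for i
  define q where "q = cell_index m"
  have m: "m \<ge> 4" "m > 0" unfolding m_def using power_increasing[of 1 "n + 1" "4::nat"] by auto
  have pos_le: "pos i \<le> 4 ^ n" if "i < n" for i
    unfolding pos_def using that by (intro power_increasing) auto
  have pos: "pos i + pos j < m" "pos i + 1 < m" if "i < n" "j < n" for i j
  proof -
    have "(4::nat) ^ n > 0" "m = 4 * 4 ^ n" unfolding m_def by simp_all
    then show "pos i + pos j < m" "pos i + 1 < m"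
      using pos_le[OF that(1)] pos_le[OF that(2)] by linarith+
  qed
  have dvd: "4 dvd pos i" "4 dvd m" for i unfolding pos_def m_def by simp_all
  define r where "r = rotation m"
  have r: "r \<in> VA" "r ^^ k \<in> VA" for k
    unfolding r_def using rotation_in_V[OF m(2)] V_subset_VA VA.funpow_closed by blast+
  have bij: "bij (r ^^ k)" "bij (c i)" if "i < n" for k i using r c that VA_bij by blast+
  have qr: "q ((r ^^ k) x) = (q x + k) mod m" for k x
    unfolding q_def r_def by (rule cell_index_funpow[OF m(2)])
  have q_less: "q x < m" for x unfolding q_def by (rule cell_index_less[OF m(2)])
  define S where "S = {x. q x = 0 \<or> q x = 1}"
  have off_S: "c i x = x" if "i < n" "x \<notin> S" for i x
  proof -
    obtain k y where k: "k < m" "x = cell m k \<frown> y" using cell_complete[OF m(2)] by metis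
    then have "k \<ge> 2" using that(2) cell_index_cell[of k m y] unfolding S_def q_def by auto
    then obtain l where "k = 2 + l" using le_Suc_ex by blast
    then obtain s where "cell m k = [True, True] @ s" by (simp add: cell_def)
    then have "x = [True, True] \<frown> (s \<frown> y)" using k(2) by simp
    then show ?thesis using movesD[OF supp[OF that(1)]] by metis
  qed
  have on_S: "c i x \<in> S" if "i < n" "x \<in> S" for i x
  proof (rule ccontr)
    assume "c i x \<notin> S"
    then have "c i (c i x) = c i x" using off_S that by blast
    then have "c i x = x" using bij(2)[OF that(1)] by (metis bij_def inj_eq)
    then show False using that \<open>c i x \<notin> S\<close> by simp
  qed
  define T where "T i = (r ^^ pos i) \<circ> c i \<circ> inverse_map (r ^^ pos i)" for i
  define M where "M i = {x. q x = pos i \<or> q x = pos i + 1}" for i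
  have M_iff: "(r ^^ pos i) x \<in> M i \<longleftrightarrow> x \<in> S" if i: "i < n" for i x
  proof -
    have "(q x + pos i) mod m = (pos i + d) mod m \<longleftrightarrow> q x = d" if "d < m" for d
    proof
      assume eq: "(q x + pos i) mod m = (pos i + d) mod m"
      have "(q x + pos i + (m - pos i)) mod m = (pos i + d + (m - pos i)) mod m"
        using eq by (metis mod_add_left_eq)
      then show "q x = d" using pos(2)[OF i i] q_less[of x] that by simp
    qed (simp add: add.commute)
    from this[of 0] this[of 1] show ?thesis
      unfolding M_def S_def using qr[of "pos i" x] pos(2)[OF i i] m by simp
  qed
  have T_apply: "T i ((r ^^ pos i) x) = (r ^^ pos i) (c i x)" if "i < n" for i x
    unfolding T_def using bij(1)[OF that, of "pos i"] by (simp add: bij_def)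
  have T_M: "T i x \<in> M i" if iM: "i < n" "x \<in> M i" for i x
  proof -
    obtain y where "x = (r ^^ pos i) y" using bij(1)[OF iM(1)] by (metis bij_pointE)
    then show ?thesis using iM T_apply M_iff on_S by metis
  qed
  have T_off: "T i x = x" if iM: "i < n" "x \<notin> M i" for i x
  proof -
    obtain y where "x = (r ^^ pos i) y" using bij(1)[OF iM(1)] by (metis bij_pointE)
    then show ?thesis using iM T_apply M_iff off_S by metis
  qed
  have pos_eq: "i = j \<and> d = e" if "pos i + d = pos j + e" "d \<le> 1" "e \<le> 1" for i j d e
  proof -
    have "(pos i + d) mod 4 = (pos j + e) mod 4" using that(1) by simp
    then have "d mod 4 = e mod 4" using dvd(1)[of i] dvd(1)[of j] by (metis mod_add_left_eq dvd_imp_mod_0 add_0)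
    then have "d = e" using that by simp
    then show ?thesis using that(1) unfolding pos_def by simp
  qed
  have M_disj: "M i \<inter> M j = {}" if "i \<noteq> j" for i j
    using pos_eq[of i 0 j 0] pos_eq[of i 0 j 1] pos_eq[of i 1 j 0] pos_eq[of i 1 j 1] that
    unfolding M_def by auto
  define b where "b = foldr (\<lambda>i f. T i \<circ> f) [0..<n] id"
  have b_all: "(\<forall>i\<in>set [0..<n]. \<forall>x\<in>M i. b x = T i x) \<and>
      (\<forall>x. (\<forall>i\<in>set [0..<n]. x \<notin> M i) \<longrightarrow> b x = x)"
    unfolding b_def by (rule foldr_disjoint_supports) (use T_M T_off M_disj in auto)
  have b: "b x = T i x" if "i < n" "x \<in> M i" for i x
    using b_all that by simp
  have b_off: "b x = x" if "\<And>i. i < n \<Longrightarrow> x \<notin> M i" for x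
    using b_all that by simp
  have "T i \<in> VA" if "i < n" for i
    unfolding T_def using r(2) c that by (intro VA.comp_closed VA.inverse_closed)
  then have bVA: "b \<in> VA"
  proof -
    have "foldr (\<lambda>i f. T i \<circ> f) js id \<in> VA" if "set js \<subseteq> {..<n}" for js
      using that \<open>\<And>i. i < n \<Longrightarrow> T i \<in> VA\<close>
      by (induction js) (auto simp: VA.id_closed intro!: VA.comp_closed)
    from this[of "[0..<n]"] show ?thesis unfolding b_def by (simp add: atLeast0LessThan)
  qed
  define P where "P i = inverse_map (r ^^ pos i) \<circ> b \<circ> (r ^^ pos i)" for i
  \<comment> \<open>Contains the part of the support of \<open>P i\<close> that does not come from \<open>c i\<close>.\<close>
  define R where "R i = {x. \<exists>k<n. k \<noteq> i \<and> (r ^^ pos i) x \<in> M k}" for i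
  have inv: "inverse_map (r ^^ k) ((r ^^ k) x) = x" "(r ^^ k) (inverse_map (r ^^ k) x) = x" for k x
    using inverse_map_apply[OF VA_bij[OF r(2)]] .
  have P_S: "P i x = c i x" if "i < n" "x \<in> S" for i x
    using b[OF that(1), of "(r ^^ pos i) x"] M_iff T_apply that inv unfolding P_def by simp
  have P_R: "P i x \<in> R i" if iR: "i < n" "x \<in> R i" for i x
  proof -
    obtain k where k: "k < n" "k \<noteq> i" "(r ^^ pos i) x \<in> M k" using iR(2) unfolding R_def by blast
    have "(r ^^ pos i) (P i x) = T k ((r ^^ pos i) x)" unfolding P_def using b k inv by simp
    then show ?thesis unfolding R_def using T_M k by auto
  qed
  have P_off: "P i x = x" if "i < n" "x \<notin> S" "x \<notin> R i" for i x
  proof -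
    have "(r ^^ pos i) x \<notin> M k" if "k < n" for k
      using that \<open>i < n\<close> \<open>x \<notin> S\<close> \<open>x \<notin> R i\<close> M_iff unfolding R_def by (cases "k = i") auto
    then show ?thesis unfolding P_def using b_off inv by simp
  qed
  have R_S: "R i \<inter> S = {}" if "i < n" for i
    using M_iff[OF that] M_disj unfolding R_def by blast
  have R_R: "R i \<inter> R j = {}" if ij: "i < n" "j < n" "i \<noteq> j" for i j
  proof (rule ccontr)
    assume "R i \<inter> R j \<noteq> {}"
    then obtain x k l where x: "k < n" "k \<noteq> i" "(r ^^ pos i) x \<in> M k" "l < n" "l \<noteq> j" "(r ^^ pos j) x \<in> M l"
      unfolding R_def by blast
    have M_mod: "\<exists>d\<le>1. (q x + pos i) mod m = pos k + d" if "(r ^^ pos i) x \<in> M k" for i k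
      using that qr[of "pos i" x] unfolding M_def by (auto simp: le_Suc_eq)
    obtain d e where de: "(q x + pos i) mod m = pos k + d" "(q x + pos j) mod m = pos l + e" "d \<le> 1" "e \<le> 1"
      using M_mod[OF x(3)] M_mod[OF x(6)] by blast
    have "(q x + pos i + pos j) mod m = (pos k + d + pos j) mod m"
      using de(1) by (metis mod_add_left_eq)
    moreover have "(q x + pos i + pos j) mod m = (pos l + e + pos i) mod m"
      using de(2) by (metis mod_add_left_eq add.assoc add.commute)
    ultimately have eq: "(pos k + d + pos j) mod m = (pos l + e + pos i) mod m" by simp
    \<comment> \<open>Positions and \<open>m\<close> are multiples of 4, so the errors \<open>d\<close> and \<open>e\<close> of at most one step agree.\<close>
    then have "(pos k + d + pos j) mod 4 = (pos l + e + pos i) mod 4"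
      using dvd(2) by (metis mod_mod_cancel)
    moreover have "(pos k + d + pos j) mod 4 = d mod 4" "(pos l + e + pos i) mod 4 = e mod 4"
      using dvd(1)[of k] dvd(1)[of j] dvd(1)[of l] dvd(1)[of i] by (auto elim!: dvdE simp: mod_simps)
    ultimately have "d = e" using de by simp
    have "(4::nat) ^ n > 0" "m = 4 * 4 ^ n" unfolding m_def by simp_all
    \<comment> \<open>There is no wrap-around, since \<open>m\<close> is four times the largest position.\<close>
    then have small: "pos k + d + pos j < m" "pos l + e + pos i < m"
      using pos_le[OF x(1)] pos_le[OF x(4)] pos_le[OF ij(1)] pos_le[OF ij(2)] de(3,4) by linarith+
    then have "pos k + pos j = pos l + pos i" using eq \<open>d = e\<close> by simp
    then show False
      using sum_powers_of_4_unique[of "k + 1" "j + 1" "l + 1" "i + 1"] x ij unfolding pos_def by auto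
  qed
  show thesis
  proof (rule that)
    show "m \<ge> 3" using m by simp
    show "b \<in> VA" by fact
    fix H i j
    assume H: "map_group H" "rotation m \<in> H" "b \<in> H" and ij: "i < n" "j < n" "i \<noteq> j"
    interpret H: map_group H by fact
    have PH: "P i \<in> H" for i
      unfolding P_def using H r_def by (intro H.comp_closed H.inverse_closed H.funpow_closed) auto
    have "commutator (P i) (P j) = commutator (c i) (c j)"
      by (rule commutator_overlap[OF H.bij[OF PH] H.bij[OF PH] bij(2)[OF ij(1)] bij(2)[OF ij(2)]
          P_S[OF ij(1)] P_S[OF ij(2)] on_S[OF ij(1)] on_S[OF ij(2)] off_S[OF ij(1)] off_S[OF ij(2)]
          P_R[OF ij(1)] P_R[OF ij(2)] P_off[OF ij(1)] P_off[OF ij(2)] R_S[OF ij(1)] R_S[OF ij(2)]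
          R_R[OF ij]])
    moreover have "commutator (P i) (P j) \<in> H" using PH by (intro H.commutator_closed)
    ultimately show "commutator (c i) (c j) \<in> H" by simp
  qed
qed

section \<open>A calculus of germs\<close>

text \<open>
  A list \<open>D\<close> of words stands for the sequence of cones \<open>e\<^sup>q w\<close>, with \<open>q\<close> increasing and \<open>w\<close> running
  through \<open>D\<close> for each \<open>q\<close>. A germ of a map at \<open>eee\<dots>\<close> is described by two lists of equal length.
\<close>

definition eventually_moves ::
    "bool \<Rightarrow> (cantor \<Rightarrow> cantor) \<Rightarrow> bool list list \<Rightarrow> bool list list \<Rightarrow> bool" where
  "eventually_moves e h D E \<longleftrightarrow>
    (\<exists>K. \<forall>q\<ge>K. list_all2 (\<lambda>w v. moves h (replicate q e @ w) (replicate q e @ v)) D E)"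

lemma eventually_movesI:
  "(\<And>q. q \<ge> K \<Longrightarrow> list_all2 (\<lambda>w v. moves h (replicate q e @ w) (replicate q e @ v)) D E) \<Longrightarrow>
    eventually_moves e h D E"
  unfolding eventually_moves_def by blast

lemma eventually_moves_comp:
  assumes "eventually_moves e h D E" "eventually_moves e k E F"
  shows "eventually_moves e (k \<circ> h) D F"
proof -
  obtain K where K: "\<And>q. q \<ge> K \<Longrightarrow> list_all2 (\<lambda>w v. moves h (replicate q e @ w) (replicate q e @ v)) D E"
    using assms(1) unfolding eventually_moves_def by blast
  obtain K' where K': "\<And>q. q \<ge> K' \<Longrightarrow> list_all2 (\<lambda>w v. moves k (replicate q e @ w) (replicate q e @ v)) E F"
    using assms(2) unfolding eventually_moves_def by blast
  show ?thesis
  proof (rule eventually_movesI[of "max K K'"])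
    fix q assume q: "max K K' \<le> q"
    have *: "\<And>w v u. moves h (replicate q e @ w) (replicate q e @ v) \<Longrightarrow>
        moves k (replicate q e @ v) (replicate q e @ u) \<Longrightarrow>
        moves (k \<circ> h) (replicate q e @ w) (replicate q e @ u)"
      by (rule moves_comp)
    show "list_all2 (\<lambda>w v. moves (k \<circ> h) (replicate q e @ w) (replicate q e @ v)) D F"
      by (rule list_all2_trans[OF * K K']) (use q in auto)
  qed
qed

lemma eventually_moves_inverse:
  assumes "bij h" "eventually_moves e h D E"
  shows "eventually_moves e (inverse_map h) E D"
proof -
  obtain K where K: "\<And>q. q \<ge> K \<Longrightarrow> list_all2 (\<lambda>w v. moves h (replicate q e @ w) (replicate q e @ v)) D E"
    using assms(2) unfolding eventually_moves_def by blast
  show ?thesis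
    by (rule eventually_movesI[of K])
      (use K moves_inverse[OF assms(1)] in \<open>auto simp: list_all2_conv_all_nth\<close>)
qed

lemma eventually_moves_id: "eventually_moves e id D D"
  by (rule eventually_movesI[of 0]) (simp add: list_all2_same)

lemma eventually_moves_split_iff:
  assumes "length A = length A'"
  shows "eventually_moves e h (A @ (w @ [\<not> e]) # (w @ [e]) # B) (A' @ (v @ [\<not> e]) # (v @ [e]) # B')
    \<longleftrightarrow> eventually_moves e h (A @ w # B) (A' @ v # B')"
proof -
  have "moves h (replicate q e @ w) (replicate q e @ v) \<longleftrightarrow>
      moves h (replicate q e @ w @ [\<not> e]) (replicate q e @ v @ [\<not> e]) \<and>
      moves h (replicate q e @ w @ [e]) (replicate q e @ v @ [e])" for q
    using moves_split_iff[of h "replicate q e @ w" "replicate q e @ v" e] by auto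
  then show ?thesis
    unfolding eventually_moves_def using assms by (simp add: list_all2_append)
qed

text \<open>
  Rotation removes the first cone of the sequence described by a list, that is, shifts the index.
\<close>

fun rot :: "bool \<Rightarrow> bool list list \<Rightarrow> bool list list" where
  "rot e [] = []"
| "rot e (w # D) = D @ [e # w]"

lemma length_rot [simp]: "length (rot e D) = length D"
  by (cases D) auto

lemma length_rot_pow [simp]: "length ((rot e ^^ k) D) = length D"
  by (induction k) auto

lemma eventually_moves_rot_iff:
  assumes "length D = length E"
  shows "eventually_moves e h (rot e D) (rot e E) \<longleftrightarrow> eventually_moves e h D E"
proof (cases D)
  case (Cons w D')
  then obtain v E' where E: "E = v # E'" using assms by (cases E) auto
  let ?R = "\<lambda>q w v. moves h (replicate q e @ w) (replicate q e @ v)"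
  have shift: "?R q (e # w) (e # v) \<longleftrightarrow> ?R (Suc q) w v" for q
    by (simp add: replicate_app_Cons_same)
  have len: "length D' = length E'" using assms Cons E by simp
  show ?thesis
  proof
    assume "eventually_moves e h D E"
    then obtain K where "\<And>q. q \<ge> K \<Longrightarrow> list_all2 (?R q) D E"
      unfolding eventually_moves_def by blast
    then have "list_all2 (?R q) (rot e D) (rot e E)" if "q \<ge> K" for q
      using that shift[of q] Cons E len by (auto simp: list_all2_append le_SucI simp del: replicate_Suc)
    then show "eventually_moves e h (rot e D) (rot e E)" by (rule eventually_movesI)
  next
    assume "eventually_moves e h (rot e D) (rot e E)"
    then obtain K where K: "\<And>q. q \<ge> K \<Longrightarrow> list_all2 (?R q) (rot e D) (rot e E)"
      unfolding eventually_moves_def by blast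
    have "list_all2 (?R q) D E" if q: "q \<ge> Suc K" for q
    proof -
      obtain q' where "q = Suc q'" "q' \<ge> K" using q by (cases q) auto
      then show ?thesis
        using K[of q] K[of q'] shift[of q'] q Cons E len
        by (auto simp: list_all2_append simp del: replicate_Suc)
    qed
    then show "eventually_moves e h D E" by (rule eventually_movesI)
  qed
qed (use assms in simp)

lemma rot_pow_append: "(rot e ^^ length P) (P @ Q) = Q @ map ((#) e) P"
proof (induction P arbitrary: Q)
  case (Cons w P)
  have "(rot e ^^ length (w # P)) ((w # P) @ Q) = (rot e ^^ length P) (P @ (Q @ [e # w]))"
    by (simp add: funpow_swap1)
  then show ?case using Cons.IH[of "Q @ [e # w]"] by simp
qed simp

text \<open>
  The vine with \<open>n\<close> leaves is the code of the cone of \<open>\<not>e\<close> obtained by splitting \<open>n - 1\<close> times the cone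
  that is nearest to the end \<open>e\<close>; \<open>tip\<close> is that cone.
\<close>

definition tip :: "bool \<Rightarrow> nat \<Rightarrow> bool list" where
  "tip e k = (\<not> e) # replicate k e"

definition leaf :: "bool \<Rightarrow> nat \<Rightarrow> bool list" where
  "leaf e j = tip e j @ [\<not> e]"

definition vine :: "bool \<Rightarrow> nat \<Rightarrow> bool list list" where
  "vine e n = map (leaf e) [0..<n - 1] @ [tip e (n - 1)]"

lemma tip_Suc: "tip e (Suc k) = tip e k @ [e]"
  by (simp add: tip_def replicate_append_same)

lemma vine_Suc: "vine e (Suc n) = map (leaf e) [0..<n] @ [tip e n]"
  by (simp add: vine_def)

lemma vine_split_last: "vine e (Suc (Suc n)) = map (leaf e) [0..<n] @ [tip e n @ [\<not> e], tip e n @ [e]]"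
  by (simp add: vine_def leaf_def tip_Suc)

context map_group
begin

definition germs :: "bool \<Rightarrow> (cantor \<Rightarrow> cantor) set" where
  "germs e = {h \<in> H. h (\<lambda>_. e) = (\<lambda>_. e) \<and> (\<forall>p. p \<noteq> (\<lambda>_. e) \<longrightarrow> locally_prefix h p)}"

lemma germs_group: "map_group (germs e)"
proof
  fix f g assume f: "f \<in> germs e"
  then show "bij f" unfolding germs_def using bij by blast
  then have inv: "f (inverse_map f p) = p" "inverse_map f (f p) = p" for p
    by (simp_all add: bij_def surj_f_inv_f)
  then have fix': "inverse_map f (\<lambda>_. e) = (\<lambda>_. e)" using f unfolding germs_def by (metis (mono_tags, lifting) mem_Collect_eq)
  have "locally_prefix (inverse_map f) p" if "p \<noteq> (\<lambda>_. e)" for p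
  proof -
    have "inverse_map f p \<noteq> (\<lambda>_. e)"
    proof
      assume "inverse_map f p = (\<lambda>_. e)"
      then have "f (inverse_map f p) = f (\<lambda>_. e)" by simp
      then show False using that inv f unfolding germs_def by simp
    qed
    then have "locally_prefix f (inverse_map f p)" using f unfolding germs_def by blast
    then show ?thesis using locally_prefix_inverse[OF \<open>bij f\<close>, of "inverse_map f p"] inv by simp
  qed
  then show "inverse_map f \<in> germs e"
    using fix' f inverse_closed unfolding germs_def by blast
  assume g: "g \<in> germs e"
  have "locally_prefix (f \<circ> g) p" if "p \<noteq> (\<lambda>_. e)" for p
  proof (rule locally_prefix_comp)
    show "locally_prefix g p" using g that unfolding germs_def by blast
    have "bij g" "g (\<lambda>_. e) = (\<lambda>_. e)" using g bij unfolding germs_def by blast+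
    then have "g p \<noteq> (\<lambda>_. e)" using that unfolding bij_def inj_def by metis
    then show "locally_prefix f (g p)" using f unfolding germs_def by blast
  qed
  then show "f \<circ> g \<in> germs e"
    using f g comp_closed unfolding germs_def by simp
next
  show "id \<in> germs e"
    unfolding germs_def using id_closed V_id V_iff by simp
qed

text \<open>
  The group realizes the germ described by two lists, without singularities elsewhere.
\<close>

definition germ_rel :: "bool \<Rightarrow> bool list list \<Rightarrow> bool list list \<Rightarrow> bool" where
  "germ_rel e D E \<longleftrightarrow> length D = length E \<and> (\<exists>h\<in>germs e. eventually_moves e h D E)"

lemma germ_rel_refl: "germ_rel e D D"
  unfolding germ_rel_def using eventually_moves_id map_group.id_closed[OF germs_group] by blast

lemma germ_rel_trans [trans]: "germ_rel e D E \<Longrightarrow> germ_rel e E F \<Longrightarrow> germ_rel e D F"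
  unfolding germ_rel_def
  using eventually_moves_comp map_group.comp_closed[OF germs_group] by (metis (no_types, lifting))

lemma germ_rel_sym: "germ_rel e D E \<Longrightarrow> germ_rel e E D"
  unfolding germ_rel_def
  using eventually_moves_inverse map_group.inverse_closed[OF germs_group] map_group.bij[OF germs_group]
  by (metis (no_types, lifting))

lemma germ_rel_split_iff:
  assumes "length A = length A'"
  shows "germ_rel e (A @ (w @ [\<not> e]) # (w @ [e]) # B) (A' @ (v @ [\<not> e]) # (v @ [e]) # B')
    \<longleftrightarrow> germ_rel e (A @ w # B) (A' @ v # B')"
  unfolding germ_rel_def eventually_moves_split_iff[OF assms] by simp

lemma germ_rel_rot_iff: "germ_rel e (rot e D) (rot e E) \<longleftrightarrow> germ_rel e D E"
  unfolding germ_rel_def using eventually_moves_rot_iff by auto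

lemma germ_rel_rot_pow_iff: "germ_rel e ((rot e ^^ k) D) ((rot e ^^ k) E) \<longleftrightarrow> germ_rel e D E"
  by (induction k) (auto simp: germ_rel_rot_iff)

lemma germ_rel_rot_pow:
  assumes "germ_rel e D (rot e D)"
  shows "germ_rel e D ((rot e ^^ k) D)"
proof (induction k)
  case (Suc k)
  have "germ_rel e ((rot e ^^ k) D) ((rot e ^^ k) (rot e D))"
    using assms by (simp only: germ_rel_rot_pow_iff)
  then show ?case using germ_rel_trans[OF Suc] by (simp add: funpow_swap1)
qed (simp add: germ_rel_refl)

text \<open>
  The scaling itself is the germ of an element of V.
\<close>

lemma germ_rel_map_Cons:
  assumes V: "V \<subseteq> H"
  shows "germ_rel e D (map ((#) e) D)"
proof -
  obtain f where f: "f \<in> V" "moves f [e] [e, e]"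
    using V_moves_exists[of "[\<not> e]" "[e]" "[e, e]"] by auto
  have "f (\<lambda>_. e) = (\<lambda>_. e)"
    using movesD[OF f(2), of "\<lambda>_. e"] conc_const[of 2 e] by (simp add: numeral_2_eq_2)
  then have "f \<in> germs e" using f(1) V V_iff[of f] unfolding germs_def by auto
  moreover have "eventually_moves e f D (map ((#) e) D)"
  proof (rule eventually_movesI[of 1])
    fix q :: nat assume "1 \<le> q"
    then obtain k where q: "q = Suc k" by (cases q) auto
    have "moves f (replicate q e @ w) (replicate q e @ e # w)" for w
      using moves_append[OF f(2), of "replicate k e @ w"] by (simp add: q replicate_app_Cons_same)
    then show "list_all2 (\<lambda>w v. moves f (replicate q e @ w) (replicate q e @ v)) D (map ((#) e) D)"
      by (simp add: list_all2_conv_all_nth)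
  qed
  ultimately show ?thesis unfolding germ_rel_def by auto
qed

end

section \<open>Generating all germs\<close>

text \<open>
  For consecutive cones \<open>a\<close>, \<open>b\<close>, \<open>c\<close> that make up one period, the basic move shifts the subdivision
  from \<open>b\<close> to \<open>a\<close> and fixes \<open>c\<close>. The triples are the three windows, with different first cones, of the
  periodic sequence given by the vine with three leaves.
\<close>

definition basic_source :: "bool \<Rightarrow> bool list \<times> bool list \<times> bool list \<Rightarrow> bool list list" where
  "basic_source e = (\<lambda>(a, b, c). [a, b @ [\<not> e], b @ [e], c])"

definition basic_target :: "bool \<Rightarrow> bool list \<times> bool list \<times> bool list \<Rightarrow> bool list list" where
  "basic_target e = (\<lambda>(a, b, c). [a @ [\<not> e], a @ [e], b, c])"

definition basic_triples :: "bool \<Rightarrow> (bool list \<times> bool list \<times> bool list) list" where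
  "basic_triples e =
    [([\<not> e, \<not> e], [\<not> e, e, \<not> e], [\<not> e, e, e]),
     ([\<not> e, e, \<not> e], [\<not> e, e, e], [e, \<not> e, \<not> e]),
     ([\<not> e, e, e], [e, \<not> e, \<not> e], [e, \<not> e, e, \<not> e])]"

locale germ_generation = map_group +
  fixes e :: bool
  assumes V_sub: "V \<subseteq> H"
    and basic: "\<And>t. t \<in> set (basic_triples e) \<Longrightarrow> germ_rel e (basic_source e t) (basic_target e t)"
begin

abbreviation germ_eq (infix "\<approx>" 50) where "D \<approx> E \<equiv> germ_rel e D E"
abbreviation "ne \<equiv> \<not> e"

text \<open>
  Let \<open>\<alpha>\<close>, \<open>\<beta>\<close>, \<open>\<gamma>\<close> be the vine \<open>A, B, C\<close> with its first, second, or third cone split. The basic moves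
  lead from \<open>\<gamma>\<close> to \<open>\<beta>\<close>, to \<open>\<alpha>\<close>, and on to \<open>\<gamma>\<close> with the index shifted by one. So \<open>\<gamma>\<close> rotates by one
  step, hence \<open>\<alpha>\<close> by two; but \<open>\<alpha>\<close> consists of two split cones, and unsplitting both turns its
  rotation by two steps into a rotation of the vine with two leaves.
\<close>

lemma last_cones_move_2: "[[ne, ne], [ne, e, ne], [ne, e, e]] \<approx> [[ne, ne, ne], [ne, ne, e], [ne, e]]"
  and vine_2_rotates: "[[ne, ne], [ne, e]] \<approx> [[ne, e], [e, ne, ne]]"
  and last_cones_move_3: "[[ne, ne], [ne, e, ne], [ne, e, e, ne], [ne, e, e, e]] \<approx>
    [[ne, ne], [ne, e, ne, ne], [ne, e, ne, e], [ne, e, e]]"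
proof -
  let ?A = "[ne, ne]" and ?B = "[ne, e, ne]" and ?C = "[ne, e, e]"
  define \<gamma> where "\<gamma> = [?A, ?B, ?C @ [ne], ?C @ [e]]"
  define \<beta> where "\<beta> = [?A, ?B @ [ne], ?B @ [e], ?C]"
  define \<alpha> where "\<alpha> = [?A @ [ne], ?A @ [e], ?B, ?C]"
  have "\<beta> \<approx> \<alpha>"
    using basic[of "(?A, ?B, ?C)"] unfolding \<beta>_def \<alpha>_def
    by (simp add: basic_triples_def basic_source_def basic_target_def)
  have "rot e \<gamma> \<approx> rot e \<beta>"
    using basic[of "(?B, ?C, e # ?A)"] unfolding \<beta>_def \<gamma>_def
    by (simp add: basic_triples_def basic_source_def basic_target_def)
  then have "\<gamma> \<approx> \<beta>" by (simp only: germ_rel_rot_iff)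
  have "rot e (rot e (rot e \<alpha>)) \<approx> rot e (rot e \<gamma>)"
    using basic[of "(?C, e # ?A, e # ?B)"] unfolding \<alpha>_def \<gamma>_def
    by (simp add: basic_triples_def basic_source_def basic_target_def)
  then have "rot e \<alpha> \<approx> \<gamma>" by (simp only: germ_rel_rot_iff)
  have ga: "\<gamma> \<approx> \<alpha>" using \<open>\<gamma> \<approx> \<beta>\<close> \<open>\<beta> \<approx> \<alpha>\<close> by (rule germ_rel_trans)
  then have "rot e \<gamma> \<approx> rot e \<alpha>" by (simp only: germ_rel_rot_iff)
  then have "rot e \<gamma> \<approx> \<gamma>" using \<open>rot e \<alpha> \<approx> \<gamma>\<close> by (rule germ_rel_trans)
  then have gr: "\<gamma> \<approx> rot e \<gamma>" by (rule germ_rel_sym)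
  show "[?A, ?B, ?C] \<approx> [[ne, ne, ne], [ne, ne, e], [ne, e]]"
    using ga germ_rel_split_iff[of "[?A, ?B]" "[[ne, ne, ne], [ne, ne, e]]" e ?C "[]" "[ne, e]" "[]"]
    unfolding \<gamma>_def \<alpha>_def by simp
  have "\<gamma> \<approx> rot e (rot e \<gamma>)" using germ_rel_rot_pow[OF gr, of 2] by (simp add: numeral_2_eq_2)
  also have "rot e (rot e \<gamma>) \<approx> rot e (rot e \<alpha>)" using ga by (simp only: germ_rel_rot_iff)
  finally have "\<alpha> \<approx> rot e (rot e \<alpha>)" using germ_rel_trans[OF germ_rel_sym[OF ga]] by blast
  then show "[[ne, ne], [ne, e]] \<approx> [[ne, e], [e, ne, ne]]"
    using germ_rel_split_iff[of "[]" "[]" e ?A "[[ne, e]]" "[ne, e]" "[[e, ne, ne]]"]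
      germ_rel_split_iff[of "[?A @ [ne], ?A @ [e]]" "[[ne, e] @ [ne], [ne, e] @ [e]]" e "[ne, e]" "[]"
        "[e, ne, ne]" "[]"]
    unfolding \<alpha>_def by simp
  show "[?A, ?B, [ne, e, e, ne], [ne, e, e, e]] \<approx> [?A, [ne, e, ne, ne], [ne, e, ne, e], ?C]"
    using \<open>\<gamma> \<approx> \<beta>\<close> unfolding \<gamma>_def \<beta>_def by simp
qed

lemma vine_3_rotates: "vine e 3 \<approx> rot e (vine e 3)"
proof -
  have "[[ne, ne, ne], [ne, ne, e], [ne, e]] \<approx> [[ne, e, ne], [ne, e, e], [e, ne, ne]]"
    using germ_rel_split_iff[of "[]" "[]" e "[ne, ne]" "[[ne, e]]" "[ne, e]" "[[e, ne, ne]]"] vine_2_rotates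
    by simp
  with last_cones_move_2 have "[[ne, ne], [ne, e, ne], [ne, e, e]] \<approx> [[ne, e, ne], [ne, e, e], [e, ne, ne]]"
    by (rule germ_rel_trans)
  then show ?thesis by (simp add: vine_def leaf_def tip_def numeral_eq_Suc upt_rec)
qed

lemma split_3:
  assumes "w # B \<approx> v # B'"
  shows "[w @ [ne], w @ [e, ne], w @ [e, e]] @ B \<approx> [v @ [ne], v @ [e, ne], v @ [e, e]] @ B'"
    and "[w @ [ne, ne], w @ [ne, e], w @ [e]] @ B \<approx> [v @ [ne, ne], v @ [ne, e], v @ [e]] @ B'"
proof -
  have s: "[w @ [ne], w @ [e]] @ B \<approx> [v @ [ne], v @ [e]] @ B'"
    using assms germ_rel_split_iff[of "[]" "[]" e w B v B'] by simp
  then show "[w @ [ne], w @ [e, ne], w @ [e, e]] @ B \<approx> [v @ [ne], v @ [e, ne], v @ [e, e]] @ B'"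
    using germ_rel_split_iff[of "[w @ [ne]]" "[v @ [ne]]" e "w @ [e]" B "v @ [e]" B'] by simp
  show "[w @ [ne, ne], w @ [ne, e], w @ [e]] @ B \<approx> [v @ [ne, ne], v @ [ne, e], v @ [e]] @ B'"
    using s germ_rel_split_iff[of "[]" "[]" e "w @ [ne]" "(w @ [e]) # B" "v @ [ne]" "(v @ [e]) # B'"] by simp
qed

text \<open>
  The rotation by half a period carries the last cone of the vine with two leaves to the first one
  and conjugates the move \<open>last_cones_move_3\<close> into the first cone.
\<close>

lemma inner_move:
  "[[ne, ne, ne], [ne, ne, e, ne], [ne, ne, e, e], [ne, e]] \<approx>
   [[ne, ne, ne, ne], [ne, ne, ne, e], [ne, ne, e], [ne, e]]"
proof -
  have "[[ne, ne, ne], [ne, ne, e, ne], [ne, ne, e, e], [ne, e]] \<approx>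
      [[ne, e, ne], [ne, e, e, ne], [ne, e, e, e], [e, ne, ne]]"
    using split_3(1)[OF vine_2_rotates] by simp
  also have "\<dots> \<approx> [[ne, e, ne, ne], [ne, e, ne, e], [ne, e, e], [e, ne, ne]]"
    using last_cones_move_3 germ_rel_rot_iff[of e "[[ne, ne], [ne, e, ne], [ne, e, e, ne], [ne, e, e, e]]"
        "[[ne, ne], [ne, e, ne, ne], [ne, e, ne, e], [ne, e, e]]"]
    by simp
  also have "\<dots> \<approx> [[ne, ne, ne, ne], [ne, ne, ne, e], [ne, ne, e], [ne, e]]"
    using germ_rel_sym[OF split_3(2)[OF vine_2_rotates]] by simp
  finally show ?thesis .
qed

lemma inner_move_extended:
  assumes "k \<ge> 1"
  shows "[leaf e 0 @ [ne], leaf e 0 @ [e, ne], leaf e 0 @ [e, e]] @ map (leaf e) [1..<k] @ [tip e k] \<approx>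
    [leaf e 0 @ [ne, ne], leaf e 0 @ [ne, e], leaf e 0 @ [e]] @ map (leaf e) [1..<k] @ [tip e k]"
    (is "?P @ ?T k \<approx> ?Q @ ?T k")
  using assms
proof (induction k rule: dec_induct)
  case base
  show ?case using inner_move by (simp add: leaf_def tip_def)
next
  case (step k)
  have "(?P @ map (leaf e) [1..<k]) @ (tip e k @ [ne]) # (tip e k @ [e]) # [] \<approx>
      (?Q @ map (leaf e) [1..<k]) @ (tip e k @ [ne]) # (tip e k @ [e]) # []"
    by (subst germ_rel_split_iff) (use step.IH in simp_all)
  moreover have "?T (Suc k) = map (leaf e) [1..<k] @ [tip e k @ [ne], tip e k @ [e]]"
    using step.hyps by (simp add: leaf_def tip_Suc)
  ultimately show ?case by simp
qed

text \<open>
  The rotation of the vine with \<open>k + 1\<close> leaves carries its last cone to the first one, where the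
  move is an instance of \<open>inner_move\<close>. Thus one move inside a cone yields all moves of this kind.
\<close>

lemma last_cones_move:
  assumes rho: "vine e (Suc k) \<approx> rot e (vine e (Suc k))" and k: "k \<ge> 1"
  shows "map (leaf e) [0..<k] @ [tip e k @ [ne], tip e k @ [e, ne], tip e k @ [e, e]] \<approx>
    map (leaf e) [0..<k] @ [tip e k @ [ne, ne], tip e k @ [ne, e], tip e k @ [e]]"
    (is "?L @ ?P \<approx> ?L @ ?Q")
proof -
  have upt: "[0..<k] = 0 # [1..<k]" using k by (simp add: upt_rec)
  let ?T = "map (leaf e) [1..<k] @ [tip e k]"
  have "leaf e 0 # ?T = vine e (Suc k)" unfolding vine_def using upt by simp
  moreover have "(rot e ^^ k) (vine e (Suc k)) = tip e k # map ((#) e) ?L"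
    using rot_pow_append[where e = e and P = "?L" and Q = "[tip e k]"] by (simp add: vine_def)
  ultimately have r: "leaf e 0 # ?T \<approx> tip e k # map ((#) e) ?L"
    using germ_rel_rot_pow[OF rho, of k] by simp
  have "?P @ map ((#) e) ?L \<approx> ?Q @ map ((#) e) ?L"
    using germ_rel_trans[OF germ_rel_trans[OF germ_rel_sym[OF split_3(1)[OF r]] inner_move_extended[OF k]]
        split_3(2)[OF r]] .
  moreover have "(rot e ^^ k) (?L @ ?P) = ?P @ map ((#) e) ?L" "(rot e ^^ k) (?L @ ?Q) = ?Q @ map ((#) e) ?L"
    using rot_pow_append[where e = e and P = "?L"] by simp_all
  ultimately show ?thesis using germ_rel_rot_pow_iff by metis
qed

text \<open>
  The rotation of the vine with \<open>k + 3\<close> leaves is that of the vine with \<open>k + 2\<close> leaves, up to a move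
  inside the last cones.
\<close>

lemma vine_rotates_step:
  assumes rho: "vine e (Suc (Suc k)) \<approx> rot e (vine e (Suc (Suc k)))"
    and rho': "vine e (Suc k) \<approx> rot e (vine e (Suc k))" and k: "k \<ge> 1"
  shows "vine e (Suc (Suc (Suc k))) \<approx> rot e (vine e (Suc (Suc (Suc k))))"
proof -
  have upt: "[0..<Suc k] = 0 # [1..<Suc k]" "[0..<Suc (Suc k)] = 0 # [1..<Suc (Suc k)]"
    by (simp_all add: upt_rec)
  have v3: "vine e (Suc (Suc (Suc k))) =
      map (leaf e) [0..<k] @ [tip e k @ [ne], tip e k @ [e, ne], tip e k @ [e, e]]"
    by (simp add: vine_def leaf_def tip_Suc)
  have v2: "vine e (Suc (Suc k)) = map (leaf e) [0..<k] @ leaf e k # [tip e (Suc k)]"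
    by (simp add: vine_def)
  have r2: "rot e (vine e (Suc (Suc k))) = map (leaf e) [1..<Suc k] @ tip e (Suc k) # [e # leaf e 0]"
    unfolding vine_Suc upt by (simp del: upt_Suc)
  have r3: "rot e (vine e (Suc (Suc (Suc k)))) =
      map (leaf e) [1..<Suc k] @ (tip e (Suc k) @ [ne]) # (tip e (Suc k) @ [e]) # [e # leaf e 0]"
    unfolding vine_Suc upt using k by (simp add: leaf_def tip_Suc)
  have "map (leaf e) [0..<k] @ (leaf e k @ [ne]) # (leaf e k @ [e]) # [tip e (Suc k)] \<approx>
      rot e (vine e (Suc (Suc (Suc k))))"
    unfolding r3 by (subst germ_rel_split_iff) (use rho[unfolded r2, unfolded v2] in simp_all)
  moreover have "vine e (Suc (Suc (Suc k))) \<approx>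
      map (leaf e) [0..<k] @ (leaf e k @ [ne]) # (leaf e k @ [e]) # [tip e (Suc k)]"
    unfolding v3 using last_cones_move[OF rho' k] by (simp add: leaf_def tip_Suc)
  ultimately show ?thesis using germ_rel_trans by blast
qed

lemma vine_rotates: "n \<ge> 1 \<Longrightarrow> vine e n \<approx> rot e (vine e n)"
proof (induction n rule: less_induct)
  case (less n)
  consider "n = 1" | "n = 2" | "n = 3" | "n \<ge> 4" using less.prems by linarith
  then show ?case
  proof cases
    case 1
    then show ?thesis using germ_rel_map_Cons[OF V_sub, of e "[tip e 0]"] by (simp add: vine_def)
  next
    case 2
    then show ?thesis using vine_2_rotates by (simp add: vine_def leaf_def tip_def numeral_2_eq_2)
  next
    case 3
    then show ?thesis using vine_3_rotates by simp
  next
    case 4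
    define k where "k = n - 3"
    have "n = Suc (Suc (Suc k))" "k \<ge> 1" using 4 unfolding k_def by simp_all
    then show ?thesis using vine_rotates_step[of k] less.IH[of "Suc (Suc k)"] less.IH[of "Suc k"] by simp
  qed
qed

text \<open>
  By induction along the splits of a code. Splitting any cone of a vine is the same as splitting
  its last cone, up to a rotation, and the latter gives the next vine.
\<close>

lemma code_vine: "code e [ne] D \<Longrightarrow> D \<approx> vine e (length D)"
proof (induction rule: code.induct)
  case root
  then show ?case using germ_rel_refl by (simp add: vine_def tip_def)
next
  case (split A w B)
  define n where "n = length A + length B"
  define m where "m = length B"
  have mn: "m \<le> n" unfolding m_def n_def by simp
  let ?P = "map (leaf e) [0..<m]" and ?Q = "map (leaf e) [m..<n]"
  have up: "[0..<n] = [0..<m] @ [m..<n]" "[0..<Suc n] = [0..<m] @ [m..<Suc n]"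
    using mn upt_add_eq_append[of 0 m "n - m"] upt_add_eq_append[of 0 m "Suc n - m"] by simp_all
  have v: "vine e (Suc n) = ?P @ ?Q @ [tip e n]" unfolding vine_def by (simp add: up)
  have v': "vine e (Suc (Suc n)) = ?P @ ?Q @ [tip e n @ [ne], tip e n @ [e]]"
    unfolding vine_split_last by (simp add: up)
  have "A @ w # B \<approx> vine e (Suc n)" using split.IH by (simp add: n_def)
  also have "vine e (Suc n) \<approx> (rot e ^^ m) (vine e (Suc n))"
    by (intro germ_rel_rot_pow vine_rotates) simp
  also have "(rot e ^^ m) (vine e (Suc n)) = ?Q @ tip e n # map ((#) e) ?P"
    using rot_pow_append[where e = e and P = "?P" and Q = "?Q @ [tip e n]"] by (simp add: v)
  finally have "A @ (w @ [ne]) # (w @ [e]) # B \<approx> ?Q @ (tip e n @ [ne]) # (tip e n @ [e]) # map ((#) e) ?P"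
    by (subst germ_rel_split_iff) (simp_all add: n_def m_def)
  also have "\<dots> = (rot e ^^ m) (vine e (Suc (Suc n)))"
    using rot_pow_append[where e = e and P = "?P" and Q = "?Q @ [tip e n @ [ne], tip e n @ [e]]"] by (simp add: v')
  also have "\<dots> \<approx> vine e (Suc (Suc n))"
    by (rule germ_rel_sym, rule germ_rel_rot_pow, rule vine_rotates) simp
  finally show ?case by (simp add: n_def)
qed

text \<open>Since vines are related to their rotations, so are all codes.\<close>

lemma codes_germ_related:
  assumes "code e [ne] D" "code e [ne] E" "length D = length E"
  shows "D \<approx> (rot e ^^ k) E"
proof -
  have E: "E \<approx> vine e (length E)" by (rule code_vine[OF assms(2)])
  have "length E \<ge> 1" using code_nonempty[OF assms(2)] by (cases E) auto
  then have "vine e (length E) \<approx> (rot e ^^ k) (vine e (length E))"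
    by (intro germ_rel_rot_pow vine_rotates)
  also have "\<dots> \<approx> (rot e ^^ k) E"
    using germ_rel_sym[OF E] by (simp only: germ_rel_rot_pow_iff)
  finally have "vine e (length D) \<approx> (rot e ^^ k) E" using assms(3) by simp
  with code_vine[OF assms(1)] show ?thesis by (rule germ_rel_trans)
qed

end

section \<open>Realizing germs by elements of VA\<close>

definition period_nth :: "bool \<Rightarrow> bool list list \<Rightarrow> nat \<Rightarrow> bool list" where
  "period_nth e D k = replicate (k div length D) e @ D ! (k mod length D)"

lemma period_nth_less: "j < length D \<Longrightarrow> period_nth e D j = D ! j"
  by (simp add: period_nth_def)

lemma period_nth_add: "D \<noteq> [] \<Longrightarrow> period_nth e D (k + q * length D) = replicate q e @ period_nth e D k"
  by (simp add: period_nth_def replicate_add add.commute flip: append_assoc)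

lemma period_nth_rot: "D \<noteq> [] \<Longrightarrow> period_nth e (rot e D) k = period_nth e D (Suc k)"
proof (cases D)
  case (Cons w D')
  let ?n = "Suc (length D')"
  have less: "k mod ?n < ?n" by simp
  show ?thesis
  proof (cases "Suc (k mod ?n) = ?n")
    case True
    then have "Suc k mod ?n = 0" "Suc k div ?n = Suc (k div ?n)" by (simp_all add: mod_Suc div_Suc)
    then show ?thesis using True Cons
      by (simp add: period_nth_def nth_append replicate_app_Cons_same)
  next
    case False
    then have "Suc k mod ?n = Suc (k mod ?n)" "Suc k div ?n = k div ?n" by (simp_all add: mod_Suc div_Suc)
    moreover have "k mod ?n < length D'" using False less by linarith
    ultimately show ?thesis using Cons by (simp add: period_nth_def nth_append)
  qed
qed simp

lemma period_nth_rot_pow: "D \<noteq> [] \<Longrightarrow> period_nth e ((rot e ^^ i) D) k = period_nth e D (k + i)"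
proof (induction i arbitrary: k)
  case (Suc i)
  have "(rot e ^^ i) D \<noteq> []" using Suc.prems length_rot_pow[of i e D] by (metis length_0_conv)
  then show ?case using Suc by (simp add: period_nth_rot)
qed simp

text \<open>
  One period is ordered because a code is, and different periods because words of a code start with
  \<open>\<not>e\<close>.
\<close>

lemma code_period_before:
  assumes D: "code e [\<not> e] D" and kl: "k < l"
  shows "before e (period_nth e D k) (period_nth e D l)"
proof -
  let ?n = "length D"
  have n: "?n > 0" using code_nonempty[OF D] by simp
  have "k div ?n \<le> l div ?n" using kl by (simp add: div_le_mono)
  then consider "k div ?n = l div ?n" | "k div ?n < l div ?n" by linarith
  then show ?thesis
  proof cases
    case 1
    then have "k mod ?n < l mod ?n" using kl by (metis div_mult_mod_eq nat_add_left_cancel_less)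
    then show ?thesis
      using sorted_wrt_nth_less[OF code_sorted[OF D], of "k mod ?n" "l mod ?n"] n 1
      unfolding period_nth_def by (simp add: before_prepend)
  next
    case 2
    then obtain d where d: "l div ?n = k div ?n + Suc d" using less_iff_Suc_add by auto
    obtain s where s: "D ! (k mod ?n) = (\<not> e) # s"
      using code_extends[OF D nth_mem[of "k mod ?n" D]] n by auto
    show ?thesis
      unfolding before_def period_nth_def d replicate_add s by auto
  qed
qed

lemma near_cases:
  obtains "x = (\<lambda>_. e)" | k y where "x = (replicate k e @ [\<not> e]) \<frown> y"
proof (cases "x = (\<lambda>_. e)")
  case False
  then have ex: "\<exists>k. x k \<noteq> e" by auto
  define k where "k = (LEAST k. x k \<noteq> e)"
  have k: "x k \<noteq> e" "\<And>i. i < k \<Longrightarrow> x i = e"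
    unfolding k_def using LeastI_ex[OF ex] not_less_Least by blast+
  have "x = (replicate k e @ [\<not> e]) \<frown> suffix (Suc k) x"
  proof
    fix i
    show "x i = ((replicate k e @ [\<not> e]) \<frown> suffix (Suc k) x) i"
      using k by (cases "i < k"; cases "i = k") (auto simp: conc_def nth_append)
  qed
  then show thesis using that(2) by blast
qed (use that in blast)

text \<open>
  The homeomorphism that takes the standard partition into the cones \<open>e\<^sup>k\<not>e\<close> to the partition
  described by the code \<open>D\<close>. It conjugates shifts of the standard partition to rotations of \<open>D\<close>.
\<close>

definition theta :: "bool \<Rightarrow> bool list list \<Rightarrow> cantor \<Rightarrow> cantor" where
  "theta e D x = (if x = (\<lambda>_. e) then x
     else period_nth e D (LEAST k. x k \<noteq> e) \<frown> suffix (Suc (LEAST k. x k \<noteq> e)) x)"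

lemma theta_const [simp]: "theta e D (\<lambda>_. e) = (\<lambda>_. e)"
  by (simp add: theta_def)

lemma moves_theta: "moves (theta e D) (replicate k e @ [\<not> e]) (period_nth e D k)"
  unfolding moves_def
proof
  fix y :: cantor
  let ?x = "(replicate k e @ [\<not> e]) \<frown> y"
  have "(LEAST i. ?x i \<noteq> e) = k"
    by (rule Least_equality) (auto simp: conc_def nth_append split: if_splits)
  moreover have "?x k \<noteq> e" by (simp add: conc_def nth_append)
  then have "?x \<noteq> (\<lambda>_. e)" by metis
  moreover have "suffix (Suc k) ?x = y"
    using suffix_length_conc[of "replicate k e @ [\<not> e]" y] by simp
  ultimately show "theta e D ?x = period_nth e D k \<frown> y" by (simp add: theta_def)
qed

lemma before_const: "before e u (replicate k e) \<Longrightarrow> farther e (u \<frown> x) (\<lambda>_. e)"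
  using before_farther[of e u "replicate k e" x "\<lambda>_. e"] by simp

lemma farther_const: "\<not> farther e (\<lambda>_. e) y"
  unfolding farther_def by auto

lemma theta_farther:
  assumes D: "code e [\<not> e] D" and xy: "farther e x y"
  shows "farther e (theta e D x) (theta e D y)"
proof -
  obtain k x' where x: "x = (replicate k e @ [\<not> e]) \<frown> x'"
    using near_cases[of x e] xy farther_const by metis
  have tx: "theta e D x = period_nth e D k \<frown> x'" unfolding x by (rule movesD[OF moves_theta])
  show ?thesis
  proof (cases rule: near_cases[of y e])
    case 1
    have "k mod length D < length D" using code_nonempty[OF D] by simp
    then obtain s where "D ! (k mod length D) = (\<not> e) # s"
      using code_extends[OF D nth_mem] by fastforce
    then have "before e (period_nth e D k) (replicate (Suc (k div length D)) e)"
      unfolding before_def period_nth_def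
      by (intro exI[of _ "replicate (k div length D) e"] exI[of _ s] exI[of _ "[]"])
        (simp add: replicate_append_same)
    from before_const[OF this] show ?thesis unfolding tx 1 by simp
  next
    case (2 l y')
    have ty: "theta e D y = period_nth e D l \<frown> y'" unfolding 2 by (rule movesD[OF moves_theta])
    consider "k < l" | "k = l" | "l < k" by linarith
    then show ?thesis
    proof cases
      case 1
      then show ?thesis using code_period_before[OF D] before_farther tx ty by simp
    next
      case 2
      then have "farther e x' y'" using xy x \<open>y = _\<close> by (simp only: farther_conc_iff)
      then show ?thesis using 2 tx ty by simp
    next
      case 3
      then obtain d where d: "k = l + Suc d" using less_iff_Suc_add by auto
      have "before e (replicate l e @ [\<not> e]) (replicate k e @ [\<not> e])"
        unfolding before_def d
        by (rule exI[of _ "replicate l e"], rule exI[of _ "[]"], rule exI[of _ "replicate d e @ [\<not> e]"])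
          (simp add: replicate_app_Cons_same replicate_add)
      then have "farther e y x" unfolding x 2 by (rule before_farther)
      then show ?thesis using xy farther_asym by blast
    qed
  qed
qed

lemma code_period_complete:
  assumes "code e [\<not> e] D" "x \<noteq> (\<lambda>_. e)"
  obtains k y where "x = period_nth e D k \<frown> y"
proof -
  obtain q z where x: "x = (replicate q e @ [\<not> e]) \<frown> z" using near_cases[of x e] assms(2) by metis
  obtain w y where w: "w \<in> set D" "[\<not> e] \<frown> z = w \<frown> y" using code_complete[OF assms(1)] by blast
  then obtain j where j: "j < length D" "w = D ! j" by (metis in_set_conv_nth)
  have "x = replicate q e \<frown> ([\<not> e] \<frown> z)" using x by simp
  also have "\<dots> = (replicate q e @ w) \<frown> y" unfolding w(2) by simp
  also have "replicate q e @ w = period_nth e D (j + q * length D)"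
    using j code_nonempty[OF assms(1)] by (simp add: period_nth_add period_nth_less)
  finally show thesis by (rule that)
qed

lemma bij_theta:
  assumes D: "code e [\<not> e] D"
  shows "bij (theta e D)"
proof (rule bijI)
  show "inj (theta e D)"
    using theta_farther[OF D] by (metis farther_irrefl farther_total injI)
  show "surj (theta e D)"
    unfolding surj_def
  proof
    fix y
    show "\<exists>x. y = theta e D x"
    proof (cases "y = (\<lambda>_. e)")
      case True
      then show ?thesis by (intro exI[of _ "\<lambda>_. e"]) simp
    next
      case False
      then obtain k z where "y = period_nth e D k \<frown> z" using code_period_complete[OF D] by blast
      then show ?thesis using movesD[OF moves_theta] by metis
    qed
  qed
qed

lemma locally_prefix_theta:
  assumes "x \<noteq> (\<lambda>_. e)"
  shows "locally_prefix (theta e D) x"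
proof -
  obtain k y where "x = (replicate k e @ [\<not> e]) \<frown> y" using near_cases[of x e] assms by metis
  then show ?thesis using locally_prefixI[OF moves_theta] by simp
qed

lemma fixes_const_if_moves: "moves f [e] (replicate (Suc i) e) \<Longrightarrow> f (\<lambda>_. e) = (\<lambda>_. e)"
  using movesD[of f "[e]" "replicate (Suc i) e" "\<lambda>_. e"] conc_const[of "Suc i" e]
  by (simp del: replicate_Suc)

text \<open>
  The germ is realized by the map \<open>\<theta>\<^sub>E s \<theta>\<^sub>D\<^sup>-\<^sup>1\<close>, where \<open>s\<close> is in V and shifts the standard partition by
  \<open>i\<close> cones near the end. The maps \<open>\<theta>\<close> themselves need not be in VA, but each respects the order and
  is a prefix replacement away from the end; the composition also commutes with the scaling.
\<close>

lemma VA_codes_germ_related: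
  assumes D: "code e [\<not> e] D" and E: "code e [\<not> e] E" and len: "length D = length E"
  shows "VA.germ_rel e D ((rot e ^^ i) E)"
proof -
  let ?c = "(\<lambda>_. e) :: cantor"
  obtain s where s: "s \<in> V" "moves s [e] (replicate (Suc i) e)"
    using V_moves_exists[of "[\<not> e]" "[e]" "replicate (Suc i) e"] by auto
  define t where "t = inverse_map (theta e D)"
  define h where "h = theta e E \<circ> s \<circ> t"
  define n where "n = length D"
  have n: "n \<ge> 1" "D \<noteq> []" "E \<noteq> []" "length E = n"
    unfolding n_def using code_nonempty[OF D] code_nonempty[OF E] len by (simp_all add: Suc_leI)
  have bD: "bij (theta e D)" and bE: "bij (theta e E)" and bs: "bij s"
    using bij_theta D E s(1) V_bij by blast+
  have t: "t (theta e D x) = x" "theta e D (t x) = x" for x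
    unfolding t_def using inverse_map_apply[OF bD] .
  have bt: "bij t" unfolding t_def using bD by (rule bij_imp_bij_inv)
  have bh: "bij h" unfolding h_def using bD bE bs bt by (intro bij_comp)
  have tc: "t ?c = ?c" using t(1)[of ?c] by simp
  have sc: "s ?c = ?c" using fixes_const_if_moves[OF s(2)] .
  have hc: "h ?c = ?c" unfolding h_def using tc sc by simp
  have loc: "locally_prefix h p" if p: "p \<noteq> ?c" for p
  proof -
    have tp: "t p \<noteq> ?c" using t(2)[of p] p by auto
    have stp: "s (t p) \<noteq> ?c" using tp sc bs by (metis bij_def inj_eq)
    have "locally_prefix t p"
      using locally_prefix_inverse[OF bD locally_prefix_theta[OF tp, of D]] t unfolding t_def by simp
    then have "locally_prefix (s \<circ> t) p" using locally_prefix_comp s(1) V_iff by blast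
    then show ?thesis
      using locally_prefix_comp[of "s \<circ> t" p "theta e E"] locally_prefix_theta[of "s (t p)" e E] stp
      unfolding h_def by (simp add: comp_assoc)
  qed
  have h_moves: "moves h (period_nth e D k) (period_nth e E (k + i))" if k: "k \<ge> 1" for k
  proof -
    have "moves t (period_nth e D k) (replicate k e @ [\<not> e])"
      unfolding t_def by (rule moves_inverse[OF bD moves_theta])
    moreover have "replicate k e = [e] @ replicate (k - 1) e"
      "replicate (k + i) e = replicate (Suc i) e @ replicate (k - 1) e"
      using k by (cases k; simp; metis add.commute replicate_add add_Suc replicate_Suc append_Cons)+
    then have "moves s (replicate k e @ [\<not> e]) (replicate (k + i) e @ [\<not> e])"
      using moves_append[OF s(2), of "replicate (k - 1) e @ [\<not> e]"] by simp
    ultimately show ?thesis unfolding h_def using moves_theta moves_comp by (metis comp_assoc)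
  qed
  have t_cone: "\<exists>z. t ([e] \<frown> x) = [e] \<frown> z" for x
  proof (cases rule: near_cases[of "t ([e] \<frown> x)" e])
    case 1
    then show ?thesis by (intro exI[of _ ?c]) (simp only: conc_single_const)
  next
    case (2 k y)
    have "[e] \<frown> x = period_nth e D k \<frown> y"
      using t(2)[of "[e] \<frown> x"] movesD[OF moves_theta[of e D k], of y] 2 by simp
    have "k \<noteq> 0"
    proof
      assume "k = 0"
      have "D ! 0 \<in> set D" using n by simp
      then obtain u where "D ! 0 = (\<not> e) # u" using code_extends[OF D] by fastforce
      then have "[e] \<frown> x = [\<not> e] \<frown> (u \<frown> y)"
        using \<open>[e] \<frown> x = _\<close> \<open>k = 0\<close> n by (simp add: period_nth_def)
      then show False unfolding conc_single_eq_iff by simp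
    qed
    then obtain j where "k = Suc j" by (cases k) auto
    then have "t ([e] \<frown> x) = [e] \<frown> ((replicate j e @ [\<not> e]) \<frown> y)" using 2 by simp
    then show ?thesis by blast
  qed
  have "scale_map e (\<lambda>x. h ([e] \<frown> x))"
    unfolding scale_map_def
  proof (intro conjI allI impI)
    fix x
    show "h ([e] \<frown> ([e] \<frown> x)) = [e] \<frown> h ([e] \<frown> x)"
    proof (cases "[e] \<frown> x = ?c")
      case True
      then show ?thesis using hc by (simp only: conc_single_const)
    next
      case False
      then obtain k y where ky: "[e] \<frown> x = period_nth e D k \<frown> y"
        using code_period_complete[OF D] by blast
      have "t ([e] \<frown> x) = (replicate k e @ [\<not> e]) \<frown> y"
        using ky movesD[OF moves_theta[of e D k], of y] t(1) by metis
      then have "k \<noteq> 0" using t_cone[of x] by (auto simp: conc_single_eq_iff)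
      then have k: "k \<ge> 1" by simp
      have "[e] \<frown> ([e] \<frown> x) = period_nth e D (k + n) \<frown> y"
        using period_nth_add[OF n(2), of e k 1] unfolding n_def ky by simp
      then have "h ([e] \<frown> ([e] \<frown> x)) = period_nth e E (k + n + i) \<frown> y"
        using movesD[OF h_moves[of "k + n"]] k by simp
      also have "period_nth e E (k + n + i) = [e] @ period_nth e E (k + i)"
        using period_nth_add[OF n(3), of e "k + i" 1] n(4) by (simp add: add_ac)
      finally show ?thesis using movesD[OF h_moves[OF k], of y] ky by simp
    qed
  next
    fix x y
    assume xy: "farther e x y"
    obtain x' y' where x': "t ([e] \<frown> x) = [e] \<frown> x'" and y': "t ([e] \<frown> y) = [e] \<frown> y'"
      using t_cone by metis
    have "farther e ([e] \<frown> x) ([e] \<frown> y)" using xy by (simp only: farther_conc_iff)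
    then have "farther e (t ([e] \<frown> x)) (t ([e] \<frown> y))"
      using theta_farther[OF D] t(2) farther_asym farther_total by (metis farther_irrefl)
    then have "farther e x' y'" unfolding x' y' by (simp only: farther_conc_iff)
    then have "farther e (s ([e] \<frown> x')) (s ([e] \<frown> y'))"
      unfolding movesD[OF s(2)] by (simp only: farther_conc_iff)
    then show "farther e (h ([e] \<frown> x)) (h ([e] \<frown> y))"
      unfolding h_def comp_apply x' y' by (rule theta_farther[OF E])
  qed
  then have "self_similar_at h ([e] \<frown> ?c)"
    using self_similar_atI[of h "[e]" "[]" "\<lambda>x. h ([e] \<frown> x)" e] by simp
  then have "self_similar_at h ?c" by simp
  then have "locally_prefix h p \<or> self_similar_at h p" for p using loc by (cases "p = ?c") auto
  moreover have "finite {p. \<not> locally_prefix h p}"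
    by (rule finite_subset[of _ "{?c}"]) (use loc in auto)
  ultimately have "h \<in> VA" unfolding VA_iff using bh by blast
  then have "h \<in> VA.germs e" unfolding VA.germs_def using hc loc by blast
  moreover have "eventually_moves e h D ((rot e ^^ i) E)"
  proof (rule eventually_movesI[of 1])
    fix q :: nat assume q: "1 \<le> q"
    show "list_all2 (\<lambda>w v. moves h (replicate q e @ w) (replicate q e @ v)) D ((rot e ^^ i) E)"
      unfolding list_all2_conv_all_nth
    proof (intro conjI allI impI)
      show "length D = length ((rot e ^^ i) E)" using len by simp
      fix j assume j: "j < length D"
      have "replicate q e @ D ! j = period_nth e D (j + q * length D)"
        using period_nth_add[OF n(2), of e j q] period_nth_less[OF j, of e] by simp
      moreover have "(rot e ^^ i) E ! j = period_nth e E (j + i)"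
        using period_nth_rot_pow[OF n(3), of e i j] period_nth_less[of j "(rot e ^^ i) E" e] j len by simp
      then have "replicate q e @ (rot e ^^ i) E ! j = period_nth e E (j + q * length D + i)"
        using period_nth_add[OF n(3), of e "j + i" q] len by (simp add: add_ac)
      moreover have "j + q * length D \<ge> 1" using q n(1) unfolding n_def by (simp add: add_increasing)
      ultimately show "moves h (replicate q e @ D ! j) (replicate q e @ (rot e ^^ i) E ! j)"
        using h_moves by simp
    qed
  qed
  ultimately show ?thesis unfolding VA.germ_rel_def using len by auto
qed

section \<open>The basic moves as commutators\<close>

lemma commutator_conjugate:
  fixes t f g :: "cantor \<Rightarrow> cantor"
  assumes "bij t" "bij f" "bij g"
  shows "commutator (t \<circ> f \<circ> inverse_map t) (t \<circ> g \<circ> inverse_map t) = t \<circ> commutator f g \<circ> inverse_map t"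
proof (rule commutator_unique)
  show "bij (t \<circ> f \<circ> inverse_map t)" "bij (t \<circ> g \<circ> inverse_map t)"
    using assms by (auto intro!: bij_comp bij_imp_bij_inv)
  fix x
  have "inverse_map t (t y) = y" for y using assms(1) by (simp add: bij_def)
  then show "(t \<circ> commutator f g \<circ> inverse_map t) ((t \<circ> g \<circ> inverse_map t) ((t \<circ> f \<circ> inverse_map t) x)) =
      (t \<circ> f \<circ> inverse_map t) ((t \<circ> g \<circ> inverse_map t) x)"
    using commutator_apply[OF assms(2,3)] by (simp only: comp_apply)
qed

lemma code_splits:
  assumes "code e r (A @ w # B)" "D = A @ (w @ [\<not> e]) # (w @ [e]) # B"
  shows "code e r D"
  using code.split[OF assms(1)] assms(2) by simp

lemma code_2: "code e [\<not> e] [[\<not> e, \<not> e], [\<not> e, e]]"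
  by (rule code_splits[where A = "[]" and B = "[]"]) (auto intro: root)

lemma code_3_inner: "code e [\<not> e] [[\<not> e, \<not> e], [\<not> e, e, \<not> e], [\<not> e, e, e]]"
  by (rule code_splits[where A = "[[\<not> e, \<not> e]]" and w = "[\<not> e, e]" and B = "[]"])
    (use code_2[of e] in simp_all)

lemma code_3_outer: "code e [\<not> e] [[\<not> e, \<not> e, \<not> e], [\<not> e, \<not> e, e], [\<not> e, e]]"
  by (rule code_splits[where A = "[]" and w = "[\<not> e, \<not> e]" and B = "[[\<not> e, e]]"])
    (use code_2[of e] in simp_all)

lemma code_4_a: "code e [\<not> e] [[\<not> e, \<not> e, \<not> e], [\<not> e, \<not> e, e, \<not> e], [\<not> e, \<not> e, e, e], [\<not> e, e]]"
  by (rule code_splits[where A = "[[\<not> e, \<not> e, \<not> e]]" and w = "[\<not> e, \<not> e, e]" and B = "[[\<not> e, e]]"])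
    (use code_3_outer[of e] in simp_all)

lemma code_4_b: "code e [\<not> e] [[\<not> e, \<not> e, \<not> e, \<not> e], [\<not> e, \<not> e, \<not> e, e], [\<not> e, \<not> e, e], [\<not> e, e]]"
  by (rule code_splits[where A = "[]" and w = "[\<not> e, \<not> e, \<not> e]" and B = "[[\<not> e, \<not> e, e], [\<not> e, e]]"])
    (use code_3_outer[of e] in simp_all)

lemma code_4_c: "code e [\<not> e] [[\<not> e, \<not> e], [\<not> e, e, \<not> e], [\<not> e, e, e, \<not> e], [\<not> e, e, e, e]]"
  by (rule code_splits[where A = "[[\<not> e, \<not> e], [\<not> e, e, \<not> e]]" and w = "[\<not> e, e, e]" and B = "[]"])
    (use code_3_inner[of e] in simp_all)

lemma code_4_d: "code e [\<not> e] [[\<not> e, \<not> e], [\<not> e, e, \<not> e, \<not> e], [\<not> e, e, \<not> e, e], [\<not> e, e, e]]"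
  by (rule code_splits[where A = "[[\<not> e, \<not> e]]" and w = "[\<not> e, e, \<not> e]" and B = "[[\<not> e, e, e]]"])
    (use code_3_inner[of e] in simp_all)

lemma code_4_e: "code e [\<not> e] [[\<not> e, \<not> e, \<not> e], [\<not> e, \<not> e, e], [\<not> e, e, \<not> e], [\<not> e, e, e]]"
  by (rule code_splits[where A = "[[\<not> e, \<not> e, \<not> e], [\<not> e, \<not> e, e]]" and w = "[\<not> e, e]" and B = "[]"])
    (use code_3_outer[of e] in simp_all)

lemma eventually_moves_splitI:
  assumes "eventually_moves e h (A @ w # B) (A' @ v # B')" "length A = length A'"
    "D = A @ (w @ [\<not> e]) # (w @ [e]) # B" "E = A' @ (v @ [\<not> e]) # (v @ [e]) # B'"
  shows "eventually_moves e h D E"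
  using eventually_moves_split_iff[OF assms(2)] assms by simp

text \<open>
  VA realizes every germ, so any two families of four consecutive cones that fill one period are
  equivalent in VA. The first list is the period in which \<open>basic_commutators\<close> finds a commutator.
\<close>

lemma basic_source_germ:
  assumes "(a, b, c) \<in> set (basic_triples e)"
  shows "VA.germ_rel e
    [[\<not> e, \<not> e, \<not> e, e], [\<not> e, \<not> e, e], [\<not> e, e], [e, \<not> e, \<not> e, \<not> e, \<not> e]]
    [a, b, c @ [\<not> e], c @ [e]]"
proof -
  let ?D = "[[\<not> e, \<not> e, \<not> e, \<not> e], [\<not> e, \<not> e, \<not> e, e], [\<not> e, \<not> e, e], [\<not> e, e]]"
  have D: "VA.germ_rel e (rot e ?D) ?D"
    using VA_codes_germ_related[OF code_4_b code_4_b, of e 1] VA.germ_rel_sym by auto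
  have "\<exists>E i. code e [\<not> e] E \<and> length E = 4 \<and> [a, b, c @ [\<not> e], c @ [e]] = (rot e ^^ i) E"
  proof -
    from assms consider
      "(a, b, c) = ([\<not> e, \<not> e], [\<not> e, e, \<not> e], [\<not> e, e, e])"
    | "(a, b, c) = ([\<not> e, e, \<not> e], [\<not> e, e, e], [e, \<not> e, \<not> e])"
    | "(a, b, c) = ([\<not> e, e, e], [e, \<not> e, \<not> e], [e, \<not> e, e, \<not> e])"
      unfolding basic_triples_def by auto
    then show ?thesis
    proof cases
      case 1
      then show ?thesis using code_4_c[of e]
        by (intro exI[of _ "[[\<not> e, \<not> e], [\<not> e, e, \<not> e], [\<not> e, e, e, \<not> e], [\<not> e, e, e, e]]"] exI[of _ 0]) simp
    next
      case 2
      then show ?thesis using code_4_e[of e]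
        by (intro exI[of _ "[[\<not> e, \<not> e, \<not> e], [\<not> e, \<not> e, e], [\<not> e, e, \<not> e], [\<not> e, e, e]]"] exI[of _ 2])
          (simp add: numeral_2_eq_2)
    next
      case 3
      then show ?thesis using code_4_d[of e]
        by (intro exI[of _ "[[\<not> e, \<not> e], [\<not> e, e, \<not> e, \<not> e], [\<not> e, e, \<not> e, e], [\<not> e, e, e]]"] exI[of _ 3])
          (simp add: numeral_3_eq_3)
    qed
  qed
  then obtain E i where E: "code e [\<not> e] E" "length E = 4" "[a, b, c @ [\<not> e], c @ [e]] = (rot e ^^ i) E"
    by blast
  have "VA.germ_rel e ?D ((rot e ^^ i) E)"
    by (rule VA_codes_germ_related[OF code_4_b E(1)]) (simp add: E(2))
  from VA.germ_rel_trans[OF D this] show ?thesis unfolding E(3) by simp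
qed

text \<open>
  The commutator is computed on the list \<open>L0\<close> by following its cones through \<open>x\<close>, \<open>y\<^sup>-\<^sup>1\<close>, \<open>x\<^sup>-\<^sup>1\<close> and
  \<open>y\<close>, which lead to \<open>L1\<close>, \<open>L2\<close>, \<open>L3\<close> and \<open>L4\<close>. Up to a rotation, it shifts a subdivision from the
  second to the first of two consecutive cones. A conjugation in VA brings it to the cones of the triple.
\<close>

lemma basic_commutators:
  assumes "t \<in> set (basic_triples e)"
  obtains f g where "f \<in> VA" "g \<in> VA" "commutator f g \<in> VA.germs e"
    "eventually_moves e (commutator f g) (basic_source e t) (basic_target e t)"
proof -
  let ?ne = "\<not> e"
  interpret G: map_group "VA.germs e" by (rule VA.germs_group)
  obtain y where y: "y \<in> VA.germs e" "eventually_moves e y [[?ne, ?ne], [?ne, e, ?ne], [?ne, e, e]]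
      [[?ne, ?ne, ?ne], [?ne, ?ne, e], [?ne, e]]"
    using VA_codes_germ_related[OF code_3_inner code_3_outer, of e 0] unfolding VA.germ_rel_def by auto
  obtain x where x: "x \<in> VA.germs e" "eventually_moves e x
      [[?ne, ?ne, ?ne], [?ne, ?ne, e, ?ne], [?ne, ?ne, e, e], [?ne, e]]
      [[?ne, ?ne, ?ne, ?ne], [?ne, ?ne, ?ne, e], [?ne, ?ne, e], [?ne, e]]"
    using VA_codes_germ_related[OF code_4_a code_4_b, of e 0] unfolding VA.germ_rel_def by auto
  define z where "z = inverse_map x"
  define p where "p = commutator y z"
  let ?L0 = "[[?ne, ?ne, ?ne, ?ne], [?ne, ?ne, ?ne, e], [?ne, ?ne, e, ?ne], [?ne, ?ne, e, e], [?ne, e]]"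
  let ?L1 = "[[?ne, ?ne, ?ne, ?ne, ?ne], [?ne, ?ne, ?ne, ?ne, e], [?ne, ?ne, ?ne, e], [?ne, ?ne, e], [?ne, e]]"
  let ?L2 = "[[?ne, ?ne, ?ne, ?ne], [?ne, ?ne, ?ne, e], [?ne, ?ne, e], [?ne, e, ?ne], [?ne, e, e]]"
  let ?L3 = "[[?ne, ?ne, ?ne], [?ne, ?ne, e, ?ne], [?ne, ?ne, e, e], [?ne, e, ?ne], [?ne, e, e]]"
  let ?L4 = "[[?ne, ?ne, ?ne, ?ne], [?ne, ?ne, ?ne, e, ?ne], [?ne, ?ne, ?ne, e, e], [?ne, ?ne, e], [?ne, e]]"
  have z: "z \<in> VA.germs e" unfolding z_def using x(1) by (rule G.inverse_closed)
  have zx: "inverse_map z = x" unfolding z_def using G.bij[OF x(1)] by (rule inv_inv_eq)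
  have y1: "eventually_moves e y [[?ne, ?ne, ?ne], [?ne, ?ne, e], [?ne, e, ?ne], [?ne, e, e]]
      [[?ne, ?ne, ?ne, ?ne], [?ne, ?ne, ?ne, e], [?ne, ?ne, e], [?ne, e]]"
    by (rule eventually_moves_splitI[where A = "[]" and A' = "[]" and w = "[?ne, ?ne]" and v = "[?ne, ?ne, ?ne]"
        and B = "[[?ne, e, ?ne], [?ne, e, e]]" and B' = "[[?ne, ?ne, e], [?ne, e]]"]) (use y in simp_all)
  have s1: "eventually_moves e x ?L0 ?L1"
    by (rule eventually_moves_splitI[where A = "[]" and A' = "[]" and w = "[?ne, ?ne, ?ne]"
        and v = "[?ne, ?ne, ?ne, ?ne]" and B = "[[?ne, ?ne, e, ?ne], [?ne, ?ne, e, e], [?ne, e]]"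
        and B' = "[[?ne, ?ne, ?ne, e], [?ne, ?ne, e], [?ne, e]]"]) (use x in simp_all)
  have s2: "eventually_moves e y ?L2 ?L1"
    by (rule eventually_moves_splitI[where A = "[]" and A' = "[]" and w = "[?ne, ?ne, ?ne]"
        and v = "[?ne, ?ne, ?ne, ?ne]" and B = "[[?ne, ?ne, e], [?ne, e, ?ne], [?ne, e, e]]"
        and B' = "[[?ne, ?ne, ?ne, e], [?ne, ?ne, e], [?ne, e]]"]) (use y1 in simp_all)
  have s3: "eventually_moves e x ?L3 ?L2"
    by (rule eventually_moves_splitI[where A = "[[?ne, ?ne, ?ne], [?ne, ?ne, e, ?ne], [?ne, ?ne, e, e]]"
        and A' = "[[?ne, ?ne, ?ne, ?ne], [?ne, ?ne, ?ne, e], [?ne, ?ne, e]]" and w = "[?ne, e]"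
        and v = "[?ne, e]" and B = "[]" and B' = "[]"]) (use x in simp_all)
  have s4: "eventually_moves e y ?L3 ?L4"
    by (rule eventually_moves_splitI[where A = "[[?ne, ?ne, ?ne]]" and A' = "[[?ne, ?ne, ?ne, ?ne]]"
        and w = "[?ne, ?ne, e]" and v = "[?ne, ?ne, ?ne, e]" and B = "[[?ne, e, ?ne], [?ne, e, e]]"
        and B' = "[[?ne, ?ne, e], [?ne, e]]"]) (use y1 in simp_all)
  have "eventually_moves e (y \<circ> (z \<circ> (inverse_map y \<circ> x))) ?L0 ?L4"
    unfolding z_def
    by (intro eventually_moves_comp[OF _ s4] eventually_moves_comp[OF _ eventually_moves_inverse[OF G.bij[OF x(1)] s3]]
        eventually_moves_comp[OF s1 eventually_moves_inverse[OF G.bij[OF y(1)] s2]])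
  then have "eventually_moves e p ?L0 ?L4" unfolding p_def zx by (simp only: comp_assoc)
  then have p: "eventually_moves e p (rot e ?L0) (rot e ?L4)"
    by (subst eventually_moves_rot_iff) simp_all
  obtain a b c where t: "t = (a, b, c)" by (metis prod_cases3)
  obtain k where k: "k \<in> VA.germs e" "eventually_moves e k
    [[?ne, ?ne, ?ne, e], [?ne, ?ne, e], [?ne, e], [e, ?ne, ?ne, ?ne, ?ne]] [a, b, c @ [?ne], c @ [e]]"
    using basic_source_germ[of a b c e] assms t unfolding VA.germ_rel_def by auto
  have k1: "eventually_moves e k (rot e ?L0) [a, b @ [?ne], b @ [e], c @ [?ne], c @ [e]]"
    by (rule eventually_moves_splitI[where A = "[[?ne, ?ne, ?ne, e]]" and A' = "[a]" and w = "[?ne, ?ne, e]" and v = b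
        and B = "[[?ne, e], [e, ?ne, ?ne, ?ne, ?ne]]" and B' = "[c @ [?ne], c @ [e]]"]) (use k in simp_all)
  have k2: "eventually_moves e k (rot e ?L4) [a @ [?ne], a @ [e], b, c @ [?ne], c @ [e]]"
    by (rule eventually_moves_splitI[where A = "[]" and A' = "[]" and w = "[?ne, ?ne, ?ne, e]" and v = a
        and B = "[[?ne, ?ne, e], [?ne, e], [e, ?ne, ?ne, ?ne, ?ne]]" and B' = "[b, c @ [?ne], c @ [e]]"])
      (use k in simp_all)
  define f where "f = k \<circ> y \<circ> inverse_map k"
  define g where "g = k \<circ> z \<circ> inverse_map k"
  have fg: "commutator f g = k \<circ> p \<circ> inverse_map k"
    unfolding f_def g_def p_def using k(1) y(1) z G.bij by (intro commutator_conjugate)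
  have "eventually_moves e (commutator f g) [a, b @ [?ne], b @ [e], c @ [?ne], c @ [e]]
      [a @ [?ne], a @ [e], b, c @ [?ne], c @ [e]]"
    unfolding fg by (rule eventually_moves_comp[OF eventually_moves_inverse[OF G.bij[OF k(1)] k1]
        eventually_moves_comp[OF p k2]])
  then have "eventually_moves e (commutator f g) (basic_source e t) (basic_target e t)"
    using eventually_moves_split_iff[of "[a, b @ [?ne], b @ [e]]" "[a @ [?ne], a @ [e], b]" e _ c "[]" c "[]"]
    unfolding t basic_source_def basic_target_def by simp
  moreover have "f \<in> VA.germs e" "g \<in> VA.germs e"
    unfolding f_def g_def using k(1) y(1) z by (auto intro!: G.comp_closed G.inverse_closed)
  moreover from this have "commutator f g \<in> VA.germs e" by (rule G.commutator_closed)
  ultimately show thesis using that unfolding VA.germs_def by blast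
qed

section \<open>Transport to a small cone\<close>

text \<open>
  The copy of \<open>f\<close> on the cone of 0. Every element thus gets a copy that fixes the cone of 11.
\<close>

definition embed :: "(cantor \<Rightarrow> cantor) \<Rightarrow> cantor \<Rightarrow> cantor" where
  "embed f x = (if x 0 then x else [False] \<frown> f (suffix 1 x))"

lemma embed_False: "embed f ([False] \<frown> x) = [False] \<frown> f x"
  using suffix_length_conc[of "[False]" x] by (simp add: embed_def)

lemma embed_True: "embed f ([True] \<frown> x) = [True] \<frown> x"
  by (simp add: embed_def)

lemma bij_embed:
  assumes f: "bij f"
  shows "bij (embed f)"
proof (rule bijI)
  show "inj (embed f)"
  proof (rule injI)
    fix x y :: cantor assume eq: "embed f x = embed f y"
    obtain a x' where x: "x = [a] \<frown> x'" by (rule word_Cons_cases)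
    obtain b y' where y: "y = [b] \<frown> y'" by (rule word_Cons_cases)
    have "a = b \<and> x' = y'"
      using eq f unfolding x y
      by (cases a; cases b) (auto simp: embed_False embed_True conc_single_eq_iff bij_def inj_eq)
    then show "x = y" using x y by simp
  qed
  show "surj (embed f)"
    unfolding surj_def
  proof
    fix y :: cantor
    obtain b y' where y: "y = [b] \<frown> y'" by (rule word_Cons_cases)
    obtain z where "y' = f z" using f by (metis bij_pointE)
    then show "\<exists>x. y = embed f x" using y embed_False embed_True by (cases b) metis+
  qed
qed

lemma embed_commutator:
  assumes "bij f" "bij g"
  shows "embed (commutator f g) = commutator (embed f) (embed g)"
proof (rule commutator_unique[symmetric])
  show "bij (embed f)" "bij (embed g)" using assms bij_embed by blast+
  fix x :: cantor
  obtain a x' where x: "x = [a] \<frown> x'" by (rule word_Cons_cases)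
  show "embed (commutator f g) (embed g (embed f x)) = embed f (embed g x)"
    unfolding x using commutator_apply[OF assms, of x'] by (cases a) (simp_all only: embed_False embed_True)
qed

lemma moves_embed: "moves f u v \<Longrightarrow> moves (embed f) (False # u) (False # v)"
  using embed_False unfolding moves_def by (metis append_Cons append_Nil conc_conc)

lemma locally_prefix_embed: "locally_prefix f x \<Longrightarrow> locally_prefix (embed f) ([False] \<frown> x)"
proof -
  assume "locally_prefix f x"
  then obtain u v y where "x = u \<frown> y" "moves f u v" using locally_prefixE by metis
  then show ?thesis using locally_prefixI[OF moves_embed] by simp
qed

lemma locally_prefix_embed_True: "locally_prefix (embed f) ([True] \<frown> x)"
  by (rule locally_prefixI[of _ "[True]" "[True]"]) (simp add: moves_def embed_True del: conc_conc)

lemma embed_in_VA: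
  assumes f: "f \<in> VA"
  shows "embed f \<in> VA"
proof -
  have "locally_prefix (embed f) p \<or> self_similar_at (embed f) p" for p :: cantor
  proof -
    obtain a x where p: "p = [a] \<frown> x" by (rule word_Cons_cases)
    show ?thesis
    proof (cases "a \<or> locally_prefix f x")
      case True
      then show ?thesis
        using p locally_prefix_embed locally_prefix_embed_True by (cases a) auto
    next
      case False
      then have "self_similar_at f x" using f unfolding VA_iff by blast
      then obtain u v e g where *: "x = u \<frown> (\<lambda>_. e)" "\<And>y. f (u \<frown> y) = v \<frown> g y" "scale_map e g"
        unfolding self_similar_at_def by blast
      have "embed f ((False # u) \<frown> y) = (False # v) \<frown> g y" for y
        using embed_False[of f "u \<frown> y"] *(2)[of y] by simp
      then have "self_similar_at (embed f) ((False # u) \<frown> (\<lambda>_. e))"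
        using *(3) by (rule self_similar_atI)
      then show ?thesis using p *(1) False by simp
    qed
  qed
  moreover have "{p. \<not> locally_prefix (embed f) p} \<subseteq> (\<lambda>x. [False] \<frown> x) ` {x. \<not> locally_prefix f x}"
  proof
    fix p :: cantor assume "p \<in> {p. \<not> locally_prefix (embed f) p}"
    moreover obtain a x where p: "p = [a] \<frown> x" by (rule word_Cons_cases)
    ultimately show "p \<in> (\<lambda>x. [False] \<frown> x) ` {x. \<not> locally_prefix f x}"
      using locally_prefix_embed locally_prefix_embed_True by (cases a) auto
  qed
  then have "finite {p. \<not> locally_prefix (embed f) p}"
    using f unfolding VA_iff by (meson finite_imageI finite_subset)
  ultimately show ?thesis using f bij_embed unfolding VA_iff by blast
qed

text \<open>
  An element of V carries a neighbourhood of \<open>eee\<dots>\<close> to one of \<open>0eee\<dots>\<close>, where the copy of \<open>p\<close> has its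
  germ. Since lists describe germs only eventually, the conjugate realizes the same lists.
\<close>

lemma (in map_group) germs_from_embed:
  assumes V: "V \<subseteq> H" and p: "p \<in> VA.germs e" "embed p \<in> H"
    and moves_p: "eventually_moves e p D E"
  shows "\<exists>h\<in>germs e. eventually_moves e h D E"
proof -
  let ?c = "(\<lambda>_. e) :: cantor"
  \<comment> \<open>A cone disjoint from the cones of \<open>e\<close> and \<open>0e\<close>.\<close>
  define w where "w = (if e then [False, False] else [True])"
  have "disjoint_cones w [e]" "disjoint_cones w [False, e]" unfolding w_def by auto
  then obtain v where v: "v \<in> V" "moves v [e] [False, e]" using V_moves_exists by metis
  have bv: "bij v" using v(1) by (rule V_bij)
  have inv: "inverse_map v (v x) = x" "v (inverse_map v x) = x" for x
    using inverse_map_apply[OF bv] .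
  have vc: "v ?c = [False] \<frown> ?c"
    using movesD[OF v(2), of ?c] by (simp add: conc_Cons[of False "[e]"] del: conc_conc)
  define h where "h = inverse_map v \<circ> embed p \<circ> v"
  have pc: "p ?c = ?c" and ploc: "\<And>x. x \<noteq> ?c \<Longrightarrow> locally_prefix p x"
    using p(1) unfolding VA.germs_def by auto
  have "h ?c = ?c" unfolding h_def using vc pc inv(1)[of ?c] by (simp add: embed_False)
  moreover have "locally_prefix h x" if x: "x \<noteq> ?c" for x
  proof -
    have "v x \<noteq> [False] \<frown> ?c" using x inv(1) vc by metis
    moreover obtain a y where y: "v x = [a] \<frown> y" by (rule word_Cons_cases)
    ultimately have "locally_prefix (embed p) (v x)"
      using ploc locally_prefix_embed locally_prefix_embed_True by (cases a) auto
    then have *: "locally_prefix (embed p \<circ> v) x"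
      using locally_prefix_comp v(1) V_iff by blast
    have "locally_prefix (inverse_map v) (v z)" for z
      using locally_prefix_inverse[OF bv] v(1) V_iff by blast
    then have "locally_prefix (inverse_map v) ((embed p \<circ> v) x)" using inv(2) by metis
    then show ?thesis
      using locally_prefix_comp[OF *] unfolding h_def by (simp add: comp_assoc)
  qed
  moreover have "h \<in> H"
    unfolding h_def using p(2) v(1) V by (intro comp_closed inverse_closed) auto
  ultimately have "h \<in> germs e" unfolding germs_def by blast
  moreover have "eventually_moves e h D E"
  proof -
    obtain K where K: "\<And>q. q \<ge> K \<Longrightarrow> list_all2 (\<lambda>w v. moves p (replicate q e @ w) (replicate q e @ v)) D E"
      using moves_p unfolding eventually_moves_def by blast
    have step: "moves h (replicate q e @ w) (replicate q e @ u)"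
      if q: "q \<ge> 1" and m: "moves p (replicate q e @ w) (replicate q e @ u)" for q w u
    proof -
      obtain k where k: "q = Suc k" using q by (cases q) auto
      have "moves v (replicate q e @ x) (False # (replicate q e @ x))" for x
        using moves_append[OF v(2), of "replicate k e @ x"] by (simp add: k)
      then show ?thesis
        unfolding h_def using moves_embed[OF m] moves_inverse[OF bv] by (blast intro: moves_comp)
    qed
    show ?thesis
      by (rule eventually_movesI[of "max 1 K"]) (use K step in \<open>auto simp: list_all2_conv_all_nth\<close>)
  qed
  ultimately show ?thesis by blast
qed

section \<open>All germs of VA\<close>

text \<open>
  A gap would recur with the period and contradict cofinality.
\<close>

lemma strict_mono_cofinal_periodic:
  fixes \<phi> :: "nat \<Rightarrow> nat"
  assumes mono: "strict_mono \<phi>" and period: "\<And>k t. \<phi> (k + t * n) = \<phi> k + t * m" and m: "m > 0"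
    and cofinal: "\<And>i. i \<ge> B \<Longrightarrow> \<exists>k. \<phi> k = i"
  shows "\<phi> k = \<phi> 0 + k"
proof -
  have "\<phi> (Suc k) = Suc (\<phi> k)" for k
  proof (rule ccontr)
    assume neq: "\<phi> (Suc k) \<noteq> Suc (\<phi> k)"
    have "\<phi> k < \<phi> (Suc k)" using mono by (simp add: strict_mono_def)
    then have gap: "Suc (\<phi> k) < \<phi> (Suc k)" using neq by simp
    have "B * 1 \<le> B * m" using m by (intro mult_left_mono) auto
    then have "Suc (\<phi> k) + B * m \<ge> B" by linarith
    then obtain l where l: "\<phi> l = Suc (\<phi> k) + B * m" using cofinal by blast
    have "\<phi> (k + B * n) < \<phi> l" "\<phi> l < \<phi> (Suc k + B * n)" using gap period[of k B] period[of "Suc k" B] l by simp_all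
    then have "k + B * n < l" "l < Suc k + B * n" using strict_mono_less[OF mono] by blast+
    then show False by simp
  qed
  then show ?thesis by (induction k) auto
qed

lemma word_near_cases:
  obtains q where "w = replicate q e" | q u where "w = replicate q e @ (\<not> e) # u"
proof -
  have "(\<exists>q. w = replicate q e) \<or> (\<exists>q u. w = replicate q e @ (\<not> e) # u)"
  proof (induction w)
    case (Cons a w)
    show ?case
    proof (cases "a = e")
      case True
      have "a # replicate q e = replicate (Suc q) e" "a # replicate q e @ v = replicate (Suc q) e @ v" for q v
        using True by simp_all
      then show ?thesis using Cons by metis
    next
      case False
      then have "a # w = replicate 0 e @ (\<not> e) # w" by simp
      then show ?thesis by blast
    qed
  qed auto
  then show thesis by (elim disjE exE) (erule that)+
qed

lemma scale_map_period:
  assumes g: "scale_map e g" and DE: "list_all2 (moves g) D E" and ne: "D \<noteq> []"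
  shows "moves g (period_nth e D k) (period_nth e E k)"
proof -
  have "k mod length D < length D" using ne by simp
  then have "moves g (D ! (k mod length D)) (E ! (k mod length D))"
    using DE by (simp add: list_all2_conv_all_nth)
  then show ?thesis
    using scale_map_replicate[OF g, of "k div length D"] list_all2_lengthD[OF DE]
    unfolding period_nth_def moves_def by (simp flip: conc_conc)
qed

text \<open>
  A germ that commutes with the scaling is a piecewise prefix replacement on a fundamental domain.
  After a refinement that makes the target cones uniform, monotonicity and surjectivity force the
  target cones to be consecutive, so that the germ is a pair of codes, up to a rotation.
\<close>

lemma (in germ_generation) germ_realized:
  assumes g: "scale_map e g" and loc: "\<And>x. x \<noteq> (\<lambda>_. e) \<Longrightarrow> locally_prefix g x"
    and cofinal: "\<And>x. replicate b e \<frown> x \<in> range g"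
  shows "\<exists>h\<in>germs e. \<exists>K. \<forall>x. h (replicate K e \<frown> x) = g (replicate K e \<frown> x)"
proof -
  have gc: "g (\<lambda>_. e) = (\<lambda>_. e)" by (rule scale_map_fixes[OF g])
  have "\<exists>n v. moves g (ne # prefix n p) v" for p
  proof -
    have "[ne] \<frown> p \<noteq> (\<lambda>_. e)"
    proof
      assume "[ne] \<frown> p = (\<lambda>_. e)"
      from fun_cong[OF this, of 0] show False by simp
    qed
    then have "locally_prefix g ([ne] \<frown> p)" by (rule loc)
    from locally_prefix_deepE[OF this, of 1]
    obtain u v x where u: "[ne] \<frown> p = u \<frown> x" "moves g u v" "length u \<ge> 1" by metis
    then obtain a u' where "u = a # u'" by (cases u) auto
    with u(1) have "a = ne" "p = u' \<frown> x" using conc_Cons_eq_iff[of ne "[]" p a u' x] by auto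
    then have "moves g (ne # prefix (length u') p) v" using u(2) \<open>u = a # u'\<close> by simp
    then show ?thesis by blast
  qed
  then obtain N where N: "\<And>w. length w = N \<Longrightarrow> \<exists>v. moves g (ne # w) v"
    using uniform_depth[of "\<lambda>w. \<exists>v. moves g (ne # w) v"] moves_append by (metis append_Cons)
  define I where "I = expand e [ne] N"
  \<comment> \<open>The target word contains the digit \<open>\<not>e\<close>, since \<open>g\<close> takes only \<open>eee\<dots>\<close> to \<open>eee\<dots>\<close>.\<close>
  have "\<exists>q u. moves g w (replicate q e @ ne # u)" if wI: "w \<in> set I" for w
  proof -
    obtain w' where w: "w = ne # w'" "length w' = N" using wI unfolding I_def set_expand by auto
    then obtain v where v: "moves g w v" using N by blast
    have "v \<noteq> replicate q e" for q
    proof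
      assume "v = replicate q e"
      then have "g (w \<frown> (\<lambda>_. e)) = g (\<lambda>_. e)" using movesD[OF v] gc by simp
      then have "w \<frown> (\<lambda>_. e) = (\<lambda>_. e)" using scale_map_inj[OF g] by (metis injD)
      from fun_cong[OF this, of 0] show False using w by simp
    qed
    then show ?thesis using v word_near_cases[of v e] by metis
  qed
  then obtain q u where qu: "\<And>w. w \<in> set I \<Longrightarrow> moves g w (replicate (q w) e @ ne # u w)" by metis
  define M where "M = Max (length ` u ` set I)"
  have M: "length (u w) \<le> M" if "w \<in> set I" for w
    unfolding M_def using that by (intro Max_ge) auto
  define D where "D = concat (map (\<lambda>w. expand e w (M - length (u w))) I)"
  define E where "E = concat (map (\<lambda>w. expand e (replicate (q w) e @ ne # u w) (M - length (u w))) I)"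
  define U where "U = expand e [ne] M"
  define n where "n = length D"
  have codeD: "code e [ne] D"
    unfolding D_def using code_expand_each[of e "[ne]" "[]" I] code_uniform I_def by simp
  have codeU: "code e [ne] U" unfolding U_def by (rule code_uniform)
  have DE: "list_all2 (moves g) D E"
    unfolding D_def E_def by (rule list_all2_moves_concat) (rule qu)
  have D: "D \<noteq> []" by (rule code_nonempty[OF codeD])
  have len: "length E = n" using list_all2_lengthD[OF DE] by (simp add: n_def)
  have n_pos: "n > 0" using D by (simp add: n_def)
  have U: "length U = 2 ^ M" "U \<noteq> []" unfolding U_def using code_nonempty[OF code_uniform] by auto
  have "\<exists>i. v = period_nth e U i" if v: "v \<in> set E" for v
  proof -
    obtain w s where ws: "w \<in> set I" "v = (replicate (q w) e @ ne # u w) @ s" "length s = M - length (u w)"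
      using v unfolding E_def by (auto simp: set_expand)
    have "[ne] @ (u w @ s) \<in> set U" unfolding U_def set_expand using M[OF ws(1)] ws(3) by auto
    then obtain i where i: "i < length U" "U ! i = [ne] @ (u w @ s)" by (metis in_set_conv_nth)
    have "v = period_nth e U (i + q w * length U)"
      using ws(2) i U(2) by (simp add: period_nth_add period_nth_less)
    then show ?thesis by blast
  qed
  then have "\<forall>j<n. \<exists>i. E ! j = period_nth e U i" using len by simp
  then obtain \<phi>0 where \<phi>0: "\<And>j. j < n \<Longrightarrow> E ! j = period_nth e U (\<phi>0 j)" by metis
  \<comment> \<open>The index in the uniform partition of the image of the \<open>k\<close>-th cone of the domain.\<close>
  define \<phi> where "\<phi> k = \<phi>0 (k mod n) + (k div n) * length U" for k
  have E_nth: "period_nth e E k = period_nth e U (\<phi> k)" for k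
    unfolding \<phi>_def period_nth_add[OF U(2)] using \<phi>0[of "k mod n"] len n_pos
    by (simp add: period_nth_def[of e E])
  have mv: "moves g (period_nth e D k) (period_nth e U (\<phi> k))" for k
    using scale_map_period[OF g DE D, of k] E_nth by simp
  have mono: "strict_mono \<phi>"
    unfolding strict_mono_def
  proof (intro allI impI)
    fix k l :: nat
    assume "k < l"
    let ?x = "(\<lambda>_. e) :: cantor"
    have "farther e (period_nth e D k \<frown> ?x) (period_nth e D l \<frown> ?x)"
      using code_period_before[OF codeD \<open>k < l\<close>] by (rule before_farther)
    then have far: "farther e (period_nth e U (\<phi> k) \<frown> ?x) (period_nth e U (\<phi> l) \<frown> ?x)"
      using g movesD[OF mv] unfolding scale_map_def by metis
    show "\<phi> k < \<phi> l"
    proof (rule ccontr)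
      assume "\<not> \<phi> k < \<phi> l"
      then consider "\<phi> k = \<phi> l" | "\<phi> l < \<phi> k" by linarith
      then show False
      proof cases
        case 1
        then show ?thesis using far by simp
      next
        case 2
        then show ?thesis
          using before_farther[OF code_period_before[OF codeU 2]] far farther_asym by blast
      qed
    qed
  qed
  have period: "\<phi> (k + t * n) = \<phi> k + t * length U" for k t
    unfolding \<phi>_def using n_pos by (simp add: add_mult_distrib)
  have cof: "\<exists>k. \<phi> k = i" if i: "i \<ge> b * length U" for i
  proof -
    have "i = (i - b * length U) + b * length U" using i by simp
    then obtain s where s: "period_nth e U i = replicate b e @ s"
      using period_nth_add[OF U(2), of e "i - b * length U" b] by metis
    obtain y where y: "period_nth e U i \<frown> (\<lambda>_. \<not> e) = g y"
      using cofinal[of "s \<frown> (\<lambda>_. \<not> e)"] s by auto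
    have "y \<noteq> (\<lambda>_. e)"
    proof
      assume "y = (\<lambda>_. e)"
      then have "(\<lambda>_. e) = period_nth e U i \<frown> (\<lambda>_. \<not> e)" using y gc by simp
      from fun_cong[OF this, of "length (period_nth e U i)"] show False by simp
    qed
    then obtain k z where k: "y = period_nth e D k \<frown> z" using code_period_complete[OF codeD] by blast
    then have eq: "period_nth e U i \<frown> (\<lambda>_. \<not> e) = period_nth e U (\<phi> k) \<frown> z"
      using y movesD[OF mv] by simp
    have "disjoint_cones (period_nth e U k) (period_nth e U l)" if "k \<noteq> l" for k l
      using that code_period_before[OF codeU, of k l] code_period_before[OF codeU, of l k]
        before_disjoint disjoint_cones_sym by (meson linorder_neqE_nat)
    then have "i = \<phi> k" using eq unfolding disjoint_cones_def by blast
    then show ?thesis by blast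
  qed
  have \<phi>: "\<phi> k = \<phi> 0 + k" for k
    by (rule strict_mono_cofinal_periodic[OF mono period _ cof]) (use U in simp)
  have "n = length U" using period[of 0 1] \<phi>[of n] by simp
  have "E = (rot e ^^ \<phi> 0) U"
  proof (rule nth_equalityI)
    show "length E = length ((rot e ^^ \<phi> 0) U)" using len \<open>n = length U\<close> by simp
    fix j assume j: "j < length E"
    then have j': "j < n" using len by simp
    have "E ! j = period_nth e U (j + \<phi> 0)"
      using E_nth[of j] period_nth_less[OF j, of e] \<phi>[of j] by (simp add: add.commute)
    also have "\<dots> = (rot e ^^ \<phi> 0) U ! j"
      using period_nth_rot_pow[OF U(2), of e "\<phi> 0" j] period_nth_less[of j "(rot e ^^ \<phi> 0) U" e]
        j' \<open>n = length U\<close> by simp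
    finally show "E ! j = (rot e ^^ \<phi> 0) U ! j" .
  qed
  then have "D \<approx> E"
    using codes_germ_related[OF codeD codeU, of "\<phi> 0"] \<open>n = length U\<close> n_def by simp
  then obtain h K where h: "h \<in> germs e"
    "\<And>k. k \<ge> K \<Longrightarrow> list_all2 (\<lambda>w v. moves h (replicate k e @ w) (replicate k e @ v)) D E"
    unfolding germ_rel_def eventually_moves_def by blast
  have "h (replicate K e \<frown> x) = g (replicate K e \<frown> x)" for x
  proof (cases "x = (\<lambda>_. e)")
    case True
    then show ?thesis using gc h(1) unfolding germs_def by simp
  next
    case False
    then obtain k z where x: "x = period_nth e D k \<frown> z" using code_period_complete[OF codeD] by blast
    define j where "j = k mod n"
    have j: "j < length D" "j < n" unfolding j_def using n_pos n_def by simp_all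
    let ?r = "replicate (K + k div n) e"
    have eq: "replicate K e \<frown> x = (?r @ D ! j) \<frown> z"
      unfolding x period_nth_def j_def n_def by (simp add: replicate_add)
    have "moves h (?r @ D ! j) (?r @ E ! j)"
      using h(2)[of "K + k div n"] j(1) unfolding list_all2_conv_all_nth by simp
    then have "h (replicate K e \<frown> x) = (?r @ E ! j) \<frown> z" unfolding eq by (rule movesD)
    also have "moves g (D ! j) (E ! j)" using DE j(1) unfolding list_all2_conv_all_nth by simp
    from movesD[OF this, of z] have "(?r @ E ! j) \<frown> z = g (?r \<frown> (D ! j \<frown> z))"
      unfolding scale_map_replicate[OF g] by simp
    finally show ?thesis unfolding eq by simp
  qed
  then show ?thesis using h(1) by blast
qed

section \<open>Removing singularities\<close>

lemma finite_separated:
  fixes p :: cantor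
  assumes "finite F" "p \<notin> F"
  obtains N where "\<And>u x. length u \<ge> N \<Longrightarrow> u \<frown> x \<in> F \<Longrightarrow> prefix (length u) p \<noteq> u"
proof -
  have "\<exists>k. s k \<noteq> p k" if "s \<in> F" for s
  proof -
    have "s \<noteq> p" using that assms(2) by blast
    then show ?thesis by (auto simp: fun_eq_iff)
  qed
  then obtain k where k: "\<And>s. s \<in> F \<Longrightarrow> s (k s) \<noteq> p (k s)" by metis
  define N where "N = Suc (\<Sum>s\<in>F. k s)"
  have "prefix (length u) p \<noteq> u" if "length u \<ge> N" "u \<frown> x \<in> F" for u x
  proof
    assume eq: "prefix (length u) p = u"
    let ?s = "u \<frown> x"
    have "k ?s \<le> (\<Sum>s\<in>F. k s)" using that(2) assms(1) by (intro member_le_sum) auto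
    then have less: "k ?s < length u" using that(1) unfolding N_def by simp
    then have "?s (k ?s) = u ! k ?s" by simp
    also have "\<dots> = prefix (length u) p ! k ?s" using eq by simp
    also have "\<dots> = p (k ?s)" using less by simp
    finally show False using k[OF that(2)] by simp
  qed
  then show thesis by (rule that)
qed

text \<open>
  Far enough into the cones, the prefixes \<open>u\<close> and \<open>v\<close> can be cancelled.
\<close>

lemma locally_prefix_factor:
  assumes fg: "\<And>x. f (u \<frown> x) = v \<frown> g x" and "locally_prefix f (u \<frown> x)"
  shows "locally_prefix g x"
proof -
  obtain u' v' y where uv: "u \<frown> x = u' \<frown> y" "moves f u' v'" "f (u \<frown> x) = v' \<frown> y"
    "length u' \<ge> length u + length v" "length v' \<ge> length u + length v"
    using locally_prefix_deepE[OF assms(2), of "length u + length v"] by metis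
  have "length u \<le> length u'" "length v \<le> length v'" using uv(4,5) by simp_all
  obtain s where s: "u' = u @ s" "x = s \<frown> y"
    using conc_eq_longer[OF uv(1) \<open>length u \<le> length u'\<close>] .
  have "v \<frown> g x = v' \<frown> y" using uv(3) fg by simp
  then obtain t where t: "v' = v @ t" using \<open>length v \<le> length v'\<close> by (rule conc_eq_longer)
  have "v \<frown> g (s \<frown> z) = v \<frown> (t \<frown> z)" for z
    using movesD[OF uv(2), of z] fg[of "s \<frown> z"] s t by simp
  then have "moves g s t" unfolding moves_def by (simp only: conc_same_iff) blast
  then show ?thesis unfolding s(2) by (rule locally_prefixI)
qed

text \<open>
  Transported from \<open>eee\<dots>\<close> to \<open>p\<close> by an element of V, the realization of the germ of \<open>f\<close> becomes an
  element \<open>k\<close> whose only singularity is at \<open>p\<close>, and near \<open>p\<close> the quotient of \<open>f\<close> and \<open>k\<close> is a prefix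
  replacement.
\<close>

lemma (in germ_generation) singularity_removable:
  assumes f: "f \<in> VA" and u: "u \<frown> (\<lambda>_. e) = p" and fg: "\<And>x. f (u \<frown> x) = v \<frown> g x"
    and g: "scale_map e g" and loc: "\<And>x. x \<noteq> (\<lambda>_. e) \<Longrightarrow> locally_prefix f (u \<frown> x)"
  shows "\<exists>k\<in>H. k p = p \<and> (\<forall>x. x \<noteq> p \<longrightarrow> locally_prefix k x) \<and> locally_prefix (f \<circ> inverse_map k) p"
proof -
  obtain n where onto: "\<And>x. replicate n e \<frown> x \<in> range g"
    using scale_map_onto_near_end[OF VA_Homeo[OF f] fg g] by blast
  obtain h K where h: "h \<in> germs e" "\<And>x. h (replicate K e \<frown> x) = g (replicate K e \<frown> x)"
    using germ_realized[OF g locally_prefix_factor[OF fg loc] onto] by blast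
  obtain w where "disjoint_cones w [e, e]" "disjoint_cones w (u @ [e, e])"
    using disjoint_from_both[of "[e, e]" "u @ [e, e]"] by auto
  then obtain a where a: "a \<in> V" "moves a [e, e] (u @ [e, e])" using V_moves_exists by metis
  have ba: "bij a" using a(1) by (rule V_bij)
  note inva = inverse_map_apply[OF ba]
  have ac: "a (\<lambda>_. e) = p"
    using movesD[OF a(2), of "\<lambda>_. e"] u conc_const[of 2 e] by (simp add: numeral_2_eq_2 flip: conc_conc)
  define k where "k = a \<circ> h \<circ> inverse_map a"
  have kH: "k \<in> H"
    unfolding k_def using a(1) V_sub h(1) by (intro comp_closed inverse_closed) (auto simp: germs_def)
  have kp: "k p = p" using h(1) ac inva(1)[of "\<lambda>_. e"] unfolding k_def germs_def by auto
  have loc_k: "locally_prefix k x" if x: "x \<noteq> p" for x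
  proof -
    have ia: "locally_prefix (inverse_map a) x" for x
      using locally_prefix_inverse[OF ba, of "inverse_map a x"] a(1) inva unfolding V_iff by simp
    have "inverse_map a x \<noteq> (\<lambda>_. e)" using x ac inva(2) by metis
    then have "locally_prefix h (inverse_map a x)" using h(1) unfolding germs_def by blast
    then have "locally_prefix (h \<circ> inverse_map a) x" using locally_prefix_comp ia by blast
    then show ?thesis
      using locally_prefix_comp[of "h \<circ> inverse_map a" x a] a(1) unfolding k_def V_iff
      by (simp add: comp_assoc)
  qed
  let ?f' = "f \<circ> inverse_map k"
  define m where "m = Suc (Suc K)"
  have m: "replicate m e = [e, e] @ replicate K e" "replicate m e = replicate K e @ [e, e]"
    unfolding m_def by (simp_all add: replicate_append_same flip: replicate_Suc)
      (simp add: replicate_app_Cons_same)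
  have f'_g: "?f' ((u @ replicate m e) \<frown> g x) = (v @ replicate m e) \<frown> g x" for x
  proof -
    let ?x = "replicate m e \<frown> x"
    have hx: "h ?x = replicate m e \<frown> g x"
      using h(2)[of "[e, e] \<frown> x"] scale_map_replicate[OF g, of m x] by (simp add: m(2))
    have am: "a (replicate m e \<frown> y) = (u @ replicate m e) \<frown> y" for y
      using movesD[OF a(2), of "replicate K e \<frown> y"] by (simp add: m(1))
    have "k (u \<frown> ?x) = (u @ replicate m e) \<frown> g x"
      using inva(1)[of ?x] am[of x] hx am[of "g x"] unfolding k_def by simp
    then have "?f' ((u @ replicate m e) \<frown> g x) = f (u \<frown> ?x)"
      using inverse_map_apply(1)[OF bij[OF kH]] by (metis comp_apply)
    also have "\<dots> = (v @ replicate m e) \<frown> g x"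
      unfolding fg scale_map_replicate[OF g] by simp
    finally show ?thesis .
  qed
  have "?f' ((u @ replicate (m + n) e) \<frown> y) = (v @ replicate (m + n) e) \<frown> y" for y
  proof -
    obtain x where x: "replicate n e \<frown> y = g x" using onto by blast
    show ?thesis using f'_g[of x] by (simp add: replicate_add flip: x)
  qed
  then have "moves ?f' (u @ replicate (m + n) e) (v @ replicate (m + n) e)" by (simp add: moves_def)
  from locally_prefixI[OF this, of "\<lambda>_. e"] have "locally_prefix ?f' p"
    using u by (simp flip: conc_conc)
  then show ?thesis using kH kp loc_k by blast
qed

text \<open>
  Induction on the number of singularities: removing one of them creates no others.
\<close>

lemma VA_generated:
  assumes H: "\<And>e. germ_generation H e" and sub: "H \<subseteq> VA"
  shows "VA \<subseteq> H"
proof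
  interpret H: map_group H using H[of False] by (simp add: germ_generation_def)
  fix f assume "f \<in> VA"
  then show "f \<in> H"
  proof (induction "card {p. \<not> locally_prefix f p}" arbitrary: f rule: less_induct)
    case less
    let ?S = "{p. \<not> locally_prefix f p}"
    have fin: "finite ?S" and bf: "bij f" using less.prems unfolding VA_iff by blast+
    show ?case
    proof (cases "?S = {}")
      case True
      then have "f \<in> V" using bf unfolding V_iff by blast
      then show ?thesis using germ_generation.V_sub[OF H[of False]] by blast
    next
      case False
      then obtain p where p: "\<not> locally_prefix f p" by blast
      obtain N where N: "\<And>u x. length u \<ge> N \<Longrightarrow> u \<frown> x \<in> ?S - {p} \<Longrightarrow> prefix (length u) p \<noteq> u"
        using finite_separated[of "?S - {p}" p] fin by blast
      have "self_similar_at f p" using p less.prems unfolding VA_iff by blast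
      then obtain u v e g where *: "p = u \<frown> (\<lambda>_. e)" "scale_map e g"
        "\<And>x. f (u \<frown> x) = v \<frown> g x" "length u \<ge> N"
        using self_similar_deepE[of f p N] by metis
      have "locally_prefix f (u \<frown> x)" if x: "x \<noteq> (\<lambda>_. e)" for x
      proof (rule ccontr)
        assume "\<not> locally_prefix f (u \<frown> x)"
        moreover have "u \<frown> x \<noteq> p" using x *(1) by simp
        ultimately have "prefix (length u) p \<noteq> u" using N[OF *(4), of x] by simp
        then show False using *(1) by simp
      qed
      from germ_generation.singularity_removable[OF H less.prems *(1)[symmetric] *(3,2) this]
      obtain k where k: "k \<in> H" "k p = p" "\<And>x. x \<noteq> p \<Longrightarrow> locally_prefix k x"
        "locally_prefix (f \<circ> inverse_map k) p"
        by blast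
      have bk: "bij k" using k(1) by (rule H.bij)
      note invk = inverse_map_apply[OF bk]
      define f' where "f' = f \<circ> inverse_map k"
      have f'VA: "f' \<in> VA"
        unfolding f'_def using less.prems k(1) sub VA_comp VA_inverse by blast
      have sub': "{q. \<not> locally_prefix f' q} \<subseteq> k ` (?S - {p})"
      proof
        fix q assume q: "q \<in> {q. \<not> locally_prefix f' q}"
        then have "q \<noteq> p" using k(4) unfolding f'_def by auto
        then have ne: "inverse_map k q \<noteq> p" using invk(2) k(2) by metis
        have "locally_prefix (inverse_map k) q"
          using locally_prefix_inverse[OF bk k(3)[OF ne]] invk(2) by simp
        then have "\<not> locally_prefix f (inverse_map k q)"
          using q locally_prefix_comp unfolding f'_def by blast
        then have "inverse_map k q \<in> ?S - {p}" using ne by blast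
        then show "q \<in> k ` (?S - {p})" using invk(2)[of q] by (metis imageI)
      qed
      have fin': "finite (k ` (?S - {p}))" "finite (?S - {p})" using fin by blast+
      have "card {q. \<not> locally_prefix f' q} \<le> card (?S - {p})"
        by (rule order_trans[OF card_mono[OF fin'(1) sub'] card_image_le[OF fin'(2)]])
      also have "\<dots> < card ?S" using p fin by (intro card_Diff1_less) auto
      finally have "f' \<in> H" by (rule less.hyps[OF _ f'VA])
      moreover have "f = f' \<circ> k" unfolding f'_def by (rule ext) (simp only: comp_apply invk(1))
      ultimately show ?thesis using k(1) H.comp_closed by simp
    qed
  qed
qed

section \<open>VA is generated by two elements\<close>

text \<open>
  The halves of the two cones are permuted by a dihedral group of order 8. There the exchange of
  the cones is the central half-turn, which is the commutator of two reflections.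
\<close>

lemma swap_commutator:
  assumes d: "disjoint_cones u v"
  shows "commutator (swap (u @ [False]) (v @ [False]))
      (swap (u @ [False]) (u @ [True]) \<circ> swap (v @ [False]) (v @ [True])) = swap u v"
proof -
  let ?s = "swap (u @ [False]) (v @ [False])"
  let ?a = "swap (u @ [False]) (u @ [True])" and ?b = "swap (v @ [False]) (v @ [True])"
  have d': "disjoint_cones (u @ [x]) (v @ [y])" "disjoint_cones (v @ [y]) (u @ [x])" for x y
    using d disjoint_cones_sym[OF d] by (auto intro: disjoint_cones_appendL disjoint_cones_appendR)
  have du: "disjoint_cones (u @ [False]) (u @ [True])" "disjoint_cones (v @ [False]) (v @ [True])" by simp_all
  have s: "moves ?s (u @ [False]) (v @ [False])" "moves ?s (v @ [False]) (u @ [False])"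
    "moves ?s (u @ [True]) (u @ [True])" "moves ?s (v @ [True]) (v @ [True])"
    using d' by (auto intro: moves_swap_left moves_swap_right intro!: moves_swap_other)
  have a: "moves ?a (u @ [False]) (u @ [True])" "moves ?a (u @ [True]) (u @ [False])"
    "moves ?a (v @ [x]) (v @ [x])" for x
    using d' du by (auto intro: moves_swap_left moves_swap_right intro!: moves_swap_other)
  have b: "moves ?b (v @ [False]) (v @ [True])" "moves ?b (v @ [True]) (v @ [False])"
    "moves ?b (u @ [x]) (u @ [x])" for x
    using d' du by (auto intro: moves_swap_left moves_swap_right intro!: moves_swap_other)
  have w: "moves (swap u v) (u @ [x]) (v @ [x])" "moves (swap u v) (v @ [x]) (u @ [x])" for x
    using moves_append moves_swap_left[OF d] moves_swap_right[OF d] by blast+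
  note m = s[THEN movesD] a[THEN movesD] b[THEN movesD] w[THEN movesD]
  show ?thesis
  proof (rule commutator_unique)
    show "bij ?s" using d' by (intro bij_swap)
    show "bij (?a \<circ> ?b)" using du by (intro bij_comp bij_swap)
    fix x
    have out: "?s x = x" "?a x = x" "?b x = x" "swap u v x = x"
      if "x \<notin> range ((\<frown>) u)" "x \<notin> range ((\<frown>) v)"
    proof -
      have "x \<notin> range ((\<frown>) (u @ [y]))" "x \<notin> range ((\<frown>) (v @ [y]))" for y
        using that by (auto simp flip: conc_conc)
      then show "?s x = x" "?a x = x" "?b x = x" "swap u v x = x"
        using that by (simp_all add: swap_other)
    qed
    consider y z where "x = (u @ [y]) \<frown> z" | y z where "x = (v @ [y]) \<frown> z"
      | "x \<notin> range ((\<frown>) u)" "x \<notin> range ((\<frown>) v)"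
    proof -
      have "\<exists>y z. t \<frown> r = (t @ [y]) \<frown> z" for t and r :: cantor
        using word_Cons_cases[of r] by (metis conc_conc)
      then show ?thesis using that by blast
    qed
    then show "swap u v ((?a \<circ> ?b) (?s x)) = ?s ((?a \<circ> ?b) x)"
    proof cases
      case (1 y z)
      then show ?thesis by (cases y) (simp_all only: m comp_apply)
    next
      case (2 y z)
      then show ?thesis by (cases y) (simp_all only: m comp_apply)
    next
      case 3
      then show ?thesis using out by simp
    qed
  qed
qed

text \<open>
  The commutators are three swaps, which with the rotation give V, and copies of the three basic
  moves at each of the two ends. All factors fix the cone of 11, as required by the construction
  of the two elements.
\<close>

lemma finite_commutator_criterion:
  obtains ps where
    "\<And>f g. (f, g) \<in> set ps \<Longrightarrow> f \<in> VA \<and> g \<in> VA \<and>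
      moves f [True, True] [True, True] \<and> moves g [True, True] [True, True]"
    "\<And>H m. \<lbrakk>map_group H; H \<subseteq> VA; m \<ge> 3; rotation m \<in> H;
      \<And>f g. (f, g) \<in> set ps \<Longrightarrow> commutator f g \<in> H\<rbrakk> \<Longrightarrow> VA \<subseteq> H"
proof -
  define S where "S = (\<lambda>(u, v). (swap (u @ [False]) (v @ [False]),
    swap (u @ [False]) (u @ [True]) \<circ> swap (v @ [False]) (v @ [True])))"
  define cones where "cones = [([False], [True, False]), ([False], [True, False, False]),
    ([True, False, False], [True, False, True])]"
  have S_VA: "fst (S (u, v)) \<in> VA \<and> snd (S (u, v)) \<in> VA \<and>
      moves (fst (S (u, v))) [True, True] [True, True] \<and> moves (snd (S (u, v))) [True, True] [True, True]"
    if "(u, v) \<in> set cones" for u v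
  proof -
    have d: "disjoint_cones u v" "disjoint_cones u [True, True]" "disjoint_cones v [True, True]"
      using that unfolding cones_def by auto
    then have "disjoint_cones (u @ [False]) (v @ [False])"
      "\<And>x. disjoint_cones (u @ [x]) [True, True]" "\<And>x. disjoint_cones (v @ [x]) [True, True]"
      by (auto intro: disjoint_cones_appendL disjoint_cones_appendR)
    then show ?thesis
      unfolding S_def by (auto intro!: V_subset_VA swap_in_V V_comp moves_comp moves_swap_other)
  qed
  have S_comm: "commutator (fst (S (u, v))) (snd (S (u, v))) = swap u v" if "(u, v) \<in> set cones" for u v
  proof -
    have "disjoint_cones u v" using that unfolding cones_def by auto
    then show ?thesis using swap_commutator unfolding S_def by simp
  qed
  define B where "B = [(e, t). e \<leftarrow> [False, True], t \<leftarrow> basic_triples e]"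
  have "\<exists>f g. f \<in> VA \<and> g \<in> VA \<and> commutator f g \<in> VA.germs e \<and>
      eventually_moves e (commutator f g) (basic_source e t) (basic_target e t)"
    if "(e, t) \<in> set B" for e t
  proof -
    have "t \<in> set (basic_triples e)" using that unfolding B_def by auto
    from basic_commutators[OF this] show ?thesis by metis
  qed
  then obtain F G where FG: "\<And>e t. (e, t) \<in> set B \<Longrightarrow> F e t \<in> VA \<and> G e t \<in> VA \<and>
      commutator (F e t) (G e t) \<in> VA.germs e \<and>
      eventually_moves e (commutator (F e t) (G e t)) (basic_source e t) (basic_target e t)"
    by metis
  define ps where "ps = map S cones @ map (\<lambda>(e, t). (embed (F e t), embed (G e t))) B"
  show thesis
  proof (rule that[of ps])
    fix f g assume fg: "(f, g) \<in> set ps"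
    have E: "moves (embed h) [True, True] [True, True]" for h
      unfolding moves_def
    proof
      fix x :: cantor
      show "embed h ([True, True] \<frown> x) = [True, True] \<frown> x"
        using embed_True[of h "[True] \<frown> x"] by simp
    qed
    from fg consider u v where "(u, v) \<in> set cones" "(f, g) = S (u, v)"
      | e t where "(e, t) \<in> set B" "f = embed (F e t)" "g = embed (G e t)"
      unfolding ps_def by auto
    then show "f \<in> VA \<and> g \<in> VA \<and> moves f [True, True] [True, True] \<and> moves g [True, True] [True, True]"
    proof cases
      case (1 u v)
      then show ?thesis using S_VA[OF 1(1)] by (metis fst_conv snd_conv)
    next
      case (2 e t)
      then show ?thesis using FG[OF 2(1)] E embed_in_VA by simp
    qed
  next
    fix H m
    assume H: "map_group H" "H \<subseteq> VA" and m: "m \<ge> 3" and rot: "rotation m \<in> H"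
      and comm: "\<And>f g. (f, g) \<in> set ps \<Longrightarrow> commutator f g \<in> H"
    interpret H: map_group H by (rule H(1))
    have "swap u v \<in> H" if "(u, v) \<in> set cones" for u v
    proof -
      have "S (u, v) \<in> set ps" unfolding ps_def using that by auto
      then show ?thesis using comm[of "fst (S (u, v))" "snd (S (u, v))"] S_comm[OF that] by simp
    qed
    then have V: "V \<subseteq> H"
      using H.V_subset_from_cells[OF m rot] unfolding cones_def by simp
    have "germ_generation H e" for e
    proof
      show "V \<subseteq> H" by (rule V)
      fix t assume t: "t \<in> set (basic_triples e)"
      then have B: "(e, t) \<in> set B" unfolding B_def by (cases e) auto
      then have "(embed (F e t), embed (G e t)) \<in> set ps" unfolding ps_def by auto
      then have "commutator (embed (F e t)) (embed (G e t)) \<in> H" by (rule comm)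
      then have "embed (commutator (F e t) (G e t)) \<in> H"
        using embed_commutator[of "F e t" "G e t"] FG[OF B] VA_bij by simp
      then have "\<exists>h\<in>H.germs e. eventually_moves e h (basic_source e t) (basic_target e t)"
        using H.germs_from_embed[OF V] FG[OF B] by blast
      then show "H.germ_rel e (basic_source e t) (basic_target e t)"
        unfolding H.germ_rel_def by (auto simp: basic_source_def basic_target_def split: prod.splits)
    qed
    then show "VA \<subseteq> H" using H(2) by (rule VA_generated)
  qed
qed

lemma VA_two_generated:
  obtains a b where "a \<in> VA" "b \<in> VA"
    "\<And>H. \<lbrakk>map_group H; H \<subseteq> VA; a \<in> H; b \<in> H\<rbrakk> \<Longrightarrow> VA \<subseteq> H"
proof -
  obtain ps where ps: "\<And>f g. (f, g) \<in> set ps \<Longrightarrow> f \<in> VA \<and> g \<in> VA \<and>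
      moves f [True, True] [True, True] \<and> moves g [True, True] [True, True]"
    and crit: "\<And>H m. \<lbrakk>map_group H; H \<subseteq> VA; m \<ge> 3; rotation m \<in> H;
      \<And>f g. (f, g) \<in> set ps \<Longrightarrow> commutator f g \<in> H\<rbrakk> \<Longrightarrow> VA \<subseteq> H"
    using finite_commutator_criterion by metis
  define c where "c i = (if even i then fst else snd) (ps ! (i div 2))" for i :: nat
  have c: "c i \<in> VA \<and> moves (c i) [True, True] [True, True]" if "i < 2 * length ps" for i
  proof -
    have "i div 2 < length ps" using that by auto
    then have "(fst (ps ! (i div 2)), snd (ps ! (i div 2))) \<in> set ps" by simp
    from ps[OF this] show ?thesis unfolding c_def by auto
  qed
  obtain m b where mb: "m \<ge> 3" "b \<in> VA"
    "\<And>H i j. \<lbrakk>map_group H; rotation m \<in> H; b \<in> H; i < 2 * length ps; j < 2 * length ps; i \<noteq> j\<rbrakk>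
      \<Longrightarrow> commutator (c i) (c j) \<in> H"
    using two_elements_generate_commutators[of "2 * length ps" c] c by blast
  show thesis
  proof (rule that)
    show "rotation m \<in> VA" using rotation_in_V[of m] mb(1) V_subset_VA by simp
    show "b \<in> VA" by fact
    fix H assume H: "map_group H" "H \<subseteq> VA" "rotation m \<in> H" "b \<in> H"
    have "commutator f g \<in> H" if fg: "(f, g) \<in> set ps" for f g
    proof -
      obtain k where k: "k < length ps" "ps ! k = (f, g)" using fg by (metis in_set_conv_nth)
      have "c (2 * k) = f" "c (2 * k + 1) = g" unfolding c_def using k by simp_all
      then show ?thesis using mb(3)[OF H(1,3,4), of "2 * k" "2 * k + 1"] k(1) by simp
    qed
    then show "VA \<subseteq> H" by (rule crit[OF H(1,2) mb(1) H(3)])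
  qed
qed

lemma VA_Bij: "f \<in> VA \<Longrightarrow> f \<in> Bij UNIV"
  by (simp add: Bij_def VA_bij)

lemma VA_group_simps:
  "carrier VA_group = VA" "\<one>\<^bsub>VA_group\<^esub> = id"
  "\<lbrakk>f \<in> VA; g \<in> VA\<rbrakk> \<Longrightarrow> f \<otimes>\<^bsub>VA_group\<^esub> g = f \<circ> g"
  by (auto simp: VA_group_def BijGroup_def VA_Bij compose_def fun_eq_iff)

lemma group_VA_group: "group VA_group"
proof (rule groupI)
  fix f assume f: "f \<in> carrier VA_group"
  then have "inverse_map f \<circ> f = id" using VA_bij by (auto simp: VA_group_simps bij_def fun_eq_iff)
  then show "\<exists>g\<in>carrier VA_group. g \<otimes>\<^bsub>VA_group\<^esub> f = \<one>\<^bsub>VA_group\<^esub>"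
    using f VA_inverse by (intro bexI[of _ "inverse_map f"]) (simp_all add: VA_group_simps)
qed (auto simp: VA_group_simps VA_comp VA.id_closed comp_assoc)

lemma inv_VA_group:
  assumes "f \<in> VA"
  shows "inv\<^bsub>VA_group\<^esub> f = inverse_map f"
proof -
  have "inverse_map f \<circ> f = id" using VA_bij[OF assms] by (auto simp: bij_def fun_eq_iff)
  then show ?thesis
    using assms VA_inverse by (intro group.inv_equality[OF group_VA_group]) (simp_all add: VA_group_simps)
qed

theorem proposition4p8:
  shows "group VA_group \<and>
    (\<exists>f\<in>carrier VA_group. \<exists>g\<in>carrier VA_group. generate VA_group {f, g} = carrier VA_group)"
proof
  show "group VA_group" by (rule group_VA_group)
  obtain a b where ab: "a \<in> VA" "b \<in> VA"
    "\<And>H. \<lbrakk>map_group H; H \<subseteq> VA; a \<in> H; b \<in> H\<rbrakk> \<Longrightarrow> VA \<subseteq> H"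
    using VA_two_generated by metis
  define H where "H = generate VA_group {a, b}"
  have sub: "subgroup H VA_group"
    unfolding H_def using ab by (intro group.generate_is_subgroup[OF group_VA_group]) (simp add: VA_group_simps)
  have "H \<subseteq> VA" using subgroup.subset[OF sub] by (simp add: VA_group_simps)
  moreover have "map_group H"
  proof
    show "bij f" if "f \<in> H" for f using that \<open>H \<subseteq> VA\<close> VA_bij by blast
    show "id \<in> H" using subgroup.one_closed[OF sub] by (simp add: VA_group_simps)
    show "f \<circ> g \<in> H" if "f \<in> H" "g \<in> H" for f g
      using subgroup.m_closed[OF sub that] that \<open>H \<subseteq> VA\<close> by (simp add: VA_group_simps subset_iff)
    show "inverse_map f \<in> H" if "f \<in> H" for f
      using subgroup.m_inv_closed[OF sub that] that \<open>H \<subseteq> VA\<close> by (simp add: inv_VA_group subset_iff)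
  qed
  moreover have "a \<in> H" "b \<in> H" unfolding H_def by (auto intro: generate.incl)
  ultimately have "H = carrier VA_group" using ab(3)[of H] by (auto simp: VA_group_simps)
  then show "\<exists>f\<in>carrier VA_group. \<exists>g\<in>carrier VA_group. generate VA_group {f, g} = carrier VA_group"
    using ab(1,2) unfolding H_def by (auto simp: VA_group_simps)
qed

end
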